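(* Consider the volatility model $X_t=\sigma_tZ_t$, $h(\sigma_{t+1}^2)=\psi_t(h(\sigma_t^2),\theta_0)$, $t\in\mathbb Z$, its inverted maps $\phi_t$, the link function $\ell=h^{-1}$, the set $\mathcal K$, the stationary solutions $g_t(\theta)$ and the approximations $\hat g_t(\theta)$, all as described in the context. Let $\Theta$ be compact with $\theta_0\in\Theta$. Assume: (1) the recursion $h(\sigma_{t+1}^2)=\psi_t(h(\sigma_t^2),\theta_0)$, $t\in\mathbb Z$, admits a unique stationary solution $(\sigma_t^2)$; it is non anticipative (for every $t\in\mathbb Z$, $\sigma_t^2$ is independent of $(Z_t,Z_{t+1},Z_{t+2},\ldots)$) and $\mathbb E[\log^+\sigma_0^2]<\infty$; (2) the maps $x\mapsto 1/\ell(x)$ and $x\mapsto\log(\ell(x))$ are Lipschitz on $\mathcal K$, and there is $m>0$ with $\ell(x)\ge m$ for all $x\in\mathcal K$; (3) for $\theta\in\Theta$, $\ell(g_0(\theta))=\sigma_0^2$ a.s. if and only if $\theta=\theta_0$; (4) the model is continuously invertible on $\Theta$. Then the quasi maximum likelihood estimator $\hat\theta_n=\operatorname{argmin}_{\theta\in\Theta}\hat L_n(\theta)$ is strongly consistent: $\hat\theta_n\to\theta_0$ a.s. as $n\to\infty$.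
   Context: The innovations $(Z_t)_{t\in\mathbb Z}$ are iid real random variables with $\mathbb E[Z_0]=0$, $\mathbb E[Z_0^2]=1$. The observations are $X_t=\sigma_tZ_t$, where $h(\sigma_{t+1}^2)=\psi_t(h(\sigma_t^2),\theta_0)$ for all $t\in\mathbb Z$; here $h$ is a bijection from a subset of $\mathbb R^+$ onto a subset of $\mathbb R$, with inverse $\ell>0$ (the link function), and $\psi_t(x,\theta)=\psi(x,Z_t,\theta)$ depends on randomness only through $Z_t$ (the same function $\psi$ for all $t$). Inverted model: $\phi_t(x,\theta)$ is obtained from $\psi_t(x,\theta)$ by replacing $Z_t$ with $X_t/\sqrt{\ell(x)}$; it depends on randomness only through $X_t$, and $h(\sigma_{t+1}^2)=\phi_t(h(\sigma_t^2),\theta_0)$. Standing setting: $\Theta$ is a compact set of parameters in some $\mathbb R^d$, and $\mathcal K\subset\mathbb R$ is a set such that the random functions $(x,\theta)\mapsto\phi_t(x,\theta)$ restricted to $\mathcal K\times\Theta$ take values in $\mathcal K$. $\mathcal C_\Theta$ is the space of continuous functions from $\Theta$ to $\mathcal K$, and $\|\cdot\|_\Theta$ is the uniform norm over $\Theta$. The approximations are $\hat g_{t+1}(\theta)=\phi_t(\hat g_t(\theta),\theta)$, $t\ge0$, $\theta\in\Theta$, started at an arbitrary function $\hat g_0\in\mathcal C_\Theta$; it is assumed that the recursion produces functions $\hat g_t\in\mathcal C_\Theta$. For each $\theta\in\Theta$, $(g_t(\theta))_{t\in\mathbb Z}$ denotes the unique stationary solution of $g_{t+1}(\theta)=\phi_t(g_t(\theta),\theta)$,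 $t\in\mathbb Z$ (it does not depend on $\hat g_0$). Continuous invertibility on $\Theta$: $\|\hat g_t-g_t\|_\Theta\to0$ a.s. as $t\to\infty$, regardless of the initial function $\hat g_0\in\mathcal C_\Theta$. Quasi likelihood criterion: $2n\hat L_n(\theta)=\sum_{t=1}^n\big(X_t^2/\ell(\hat g_t(\theta))+\log(\ell(\hat g_t(\theta)))\big)$; $\hat\theta_n$ is a minimizer of $\hat L_n$ over $\Theta$. *)

theory Defs
  imports "HOL-Probability.Probability"
begin

text \<open>
  \<open>prob_space.indep_var\<close> requires both variables to have the same value type.
\<close>

definition indep_rvs ::
  "'a measure \<Rightarrow> 'b measure \<Rightarrow> ('a \<Rightarrow> 'b) \<Rightarrow> 'c measure \<Rightarrow> ('a \<Rightarrow> 'c) \<Rightarrow> bool" where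
  "indep_rvs N S U T V \<longleftrightarrow>
     prob_space.indep_set N (sets (vimage_algebra (space N) U S)) (sets (vimage_algebra (space N) V T))"

definition path_law :: "'a measure \<Rightarrow> (int \<Rightarrow> 'a \<Rightarrow> real) \<Rightarrow> (int \<Rightarrow> real) measure" where
  "path_law N Y = distr N (\<Pi>\<^sub>M t\<in>UNIV. borel) (\<lambda>\<omega> t. Y t \<omega>)"

definition strictly_stationary :: "'a measure \<Rightarrow> (int \<Rightarrow> 'a \<Rightarrow> real) \<Rightarrow> bool" where
  "strictly_stationary N Y \<longleftrightarrow> (\<forall>k. path_law N (\<lambda>t. Y (t + k)) = path_law N Y)"

text \<open>
  Stationary solutions, with values in \<open>S\<close>, of the stochastic recurrence equation
  \<open>u (Y\<^sub>t\<^sub>+\<^sub>1) = f (u (Y\<^sub>t)) \<xi>\<^sub>t\<close> for all integers \<open>t\<close>, driven by the noise \<open>\<xi>\<close>.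
\<close>

definition stationary_solution ::
  "'a measure \<Rightarrow> (int \<Rightarrow> 'a \<Rightarrow> real) \<Rightarrow> (real \<Rightarrow> real) \<Rightarrow> (real \<Rightarrow> real \<Rightarrow> real) \<Rightarrow> real set
     \<Rightarrow> (int \<Rightarrow> 'a \<Rightarrow> real) \<Rightarrow> bool" where
  "stationary_solution N \<xi> u f S Y \<longleftrightarrow>
     (\<forall>t. Y t \<in> borel_measurable N) \<and>
     (\<forall>t. AE \<omega> in N. Y t \<omega> \<in> S) \<and>
     (\<forall>t. AE \<omega> in N. u (Y (t + 1) \<omega>) = f (u (Y t \<omega>)) (\<xi> t \<omega>)) \<and>
     strictly_stationary N Y"

text \<open>
  Uniqueness is a property of the recursion, that is of \<open>u\<close>, \<open>f\<close>, \<open>S\<close> and the law of the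
  noise: on no probability space that carries a noise with this law are there two stationary
  solutions that are not almost surely equal.  The bound variable \<open>N\<close> ranges over measures on
  one fixed type only, but this type is the path space of the triples (noise, first solution,
  second solution), so that every joint law of such a triple is realised on it.  Uniqueness on
  the space \<open>M\<close> itself is included (pass to the joint law).
\<close>

definition unique_stationary_solution ::
  "'a measure \<Rightarrow> (int \<Rightarrow> 'a \<Rightarrow> real) \<Rightarrow> (real \<Rightarrow> real) \<Rightarrow> (real \<Rightarrow> real \<Rightarrow> real) \<Rightarrow> real set
     \<Rightarrow> (int \<Rightarrow> 'a \<Rightarrow> real) \<Rightarrow> bool" where
  "unique_stationary_solution M \<xi> u f S Y \<longleftrightarrow>
     stationary_solution M \<xi> u f S Y \<and>
     (\<forall>(N :: (int \<Rightarrow> real \<times> real \<times> real) measure) \<zeta> V W.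
        prob_space N \<and> (\<forall>t. \<zeta> t \<in> borel_measurable N) \<and> path_law N \<zeta> = path_law M \<xi> \<and>
        stationary_solution N \<zeta> u f S V \<and> stationary_solution N \<zeta> u f S W \<longrightarrow>
        (\<forall>t. AE \<omega> in N. V t \<omega> = W t \<omega>))"

text \<open>
  \<open>\<phi>\<^sub>t(x, \<theta>)\<close> is \<open>inverted_map \<psi> l x (X\<^sub>t) \<theta>\<close>.
\<close>

definition inverted_map ::
  "(real \<Rightarrow> real \<Rightarrow> 'p \<Rightarrow> real) \<Rightarrow> (real \<Rightarrow> real) \<Rightarrow> real \<Rightarrow> real \<Rightarrow> 'p \<Rightarrow> real" where
  "inverted_map \<psi> l x y \<theta> = \<psi> x (y / sqrt (l x)) \<theta>"

definition cont_maps :: "'p::topological_space set \<Rightarrow> real set \<Rightarrow> ('p \<Rightarrow> real) set" where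
  "cont_maps \<Theta> K = {f. continuous_on \<Theta> f \<and> f ` \<Theta> \<subseteq> K}"

text \<open>
  Extended-valued, so that the norm of a function unbounded on \<open>\<Theta>\<close> is infinite.
\<close>

definition unif_norm :: "'p set \<Rightarrow> ('p \<Rightarrow> real) \<Rightarrow> ennreal" where
  "unif_norm \<Theta> f = (SUP \<theta>\<in>\<Theta>. ennreal \<bar>f \<theta>\<bar>)"

primrec approx_vol ::
  "(real \<Rightarrow> real \<Rightarrow> 'p \<Rightarrow> real) \<Rightarrow> (int \<Rightarrow> real) \<Rightarrow> ('p \<Rightarrow> real) \<Rightarrow> nat \<Rightarrow> 'p \<Rightarrow> real" where
  "approx_vol \<phi> x g0 0 \<theta> = g0 \<theta>"
| "approx_vol \<phi> x g0 (Suc t) \<theta> = \<phi> (approx_vol \<phi> x g0 t \<theta>) (x (int t)) \<theta>"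

definition continuously_invertible ::
  "'a measure \<Rightarrow> 'p::topological_space set \<Rightarrow> real set \<Rightarrow> (real \<Rightarrow> real \<Rightarrow> 'p \<Rightarrow> real)
     \<Rightarrow> (int \<Rightarrow> 'a \<Rightarrow> real) \<Rightarrow> (int \<Rightarrow> 'p \<Rightarrow> 'a \<Rightarrow> real) \<Rightarrow> bool" where
  "continuously_invertible M \<Theta> K \<phi> X g \<longleftrightarrow>
     (\<forall>g0 \<in> cont_maps \<Theta> K. AE \<omega> in M.
        (\<lambda>t. unif_norm \<Theta> (\<lambda>\<theta>. approx_vol \<phi> (\<lambda>s. X s \<omega>) g0 t \<theta> - g (int t) \<theta> \<omega>))
          \<longlonglongrightarrow> 0)"

definition quasi_lik ::
  "(real \<Rightarrow> real) \<Rightarrow> (int \<Rightarrow> real) \<Rightarrow> (nat \<Rightarrow> 'p \<Rightarrow> real) \<Rightarrow> nat \<Rightarrow> 'p \<Rightarrow> real" where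
  "quasi_lik l x ghat n \<theta> =
     (\<Sum>t=1..n. (x (int t))\<^sup>2 / l (ghat t \<theta>) + ln (l (ghat t \<theta>))) / (2 * real n)"

end

theory Submission
  imports Defs
begin

text \<open>
  The proof compares the criterion at \<open>\<theta>\<close> with the criterion at \<open>\<theta>0\<close>. Put
  \<open>Y = \<sigma>\<^sub>0\<^sup>2 / l (g\<^sub>0 \<theta>)\<close>. If the approximations are replaced by the stationary solutions, the
  \<open>t\<close>-th summands differ by a shifted copy of \<open>Z\<^sub>0\<^sup>2 Y - ln Y - Z\<^sub>0\<^sup>2\<close>. The innovation \<open>Z\<^sub>0\<close> is independent
  of the past, on which \<open>Y\<close> depends, so this difference has mean \<open>E (Y - ln Y) - 1\<close>, possibly
  infinite. It is positive unless \<open>Y = 1\<close> almost surely, that is, unless \<open>\<theta> = \<theta>0\<close>. Four points need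
  an argument.

  \<^emph>\<open>Ergodicity.\<close> It comes from the uniqueness of the stationary solutions, by the idea of
  Yamada and Watanabe. Two solutions that are conditionally independent given the noise and have
  the joint law of noise and solution must coincide; hence the solution is a functional of the
  noise path, and uniqueness once more makes this functional commute with time shifts
  (\<open>solution_stationary_functional\<close>). The conditionally independent copies come from a
  representation of any joint law by independent uniform variables (\<open>noise_outsourcing\<close>). Applied to
  \<open>\<sigma>\<^sup>2\<close> with noise \<open>Z\<close> and then to \<open>g \<theta>\<close> with noise \<open>X\<close>, this turns everything into functionals of
  the shifted path of \<open>Z\<close>. The shift of an iid sequence is mixing, so invariant events are trivial,
  and with the maximal ergodic inequality the partial sums of a functional with positive mean tend
  to infinity (\<open>iid_positive_drift\<close>). This one-sided statement replaces the ergodic theorem.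

  \<^emph>\<open>Approximation.\<close> The squares \<open>X\<^sub>t\<^sup>2\<close> need not be integrable and no rate is known for
  \<open>ghat\<^sub>t - g\<^sub>t\<close>, so an additive bound on the error of \<open>X\<^sub>t\<^sup>2 / l\<close> would not be summable against
  \<open>X\<^sub>t\<^sup>2\<close>. However, \<open>ln l\<close> is Lipschitz, so \<open>l (ghat\<^sub>t) / l (g\<^sub>t)\<close> is close to \<open>1\<close>, and the error
  is a factor instead of a summand (\<open>contrast_step\<close>). A small loss in this factor does not affect
  the sign of the mean contrast. The integrable minorant needed for this
  is where \<open>l \<ge> m\<close> and the logarithmic moment of \<open>\<sigma>\<^sup>2\<close> enter (\<open>positive_contrast\<close>).

  \<^emph>\<open>Uniformity near a parameter.\<close> No continuity of \<open>\<theta> \<mapsto> g\<^sub>t \<theta>\<close> is assumed. But \<open>ghat\<^sub>t\<close> is continuous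
  and uniformly close to \<open>g\<^sub>t\<close> for large \<open>t\<close>, and by stationarity the oscillation of \<open>g\<^sub>0\<close> over a
  countable dense set of parameters has the law of that of \<open>g\<^sub>t\<close>; so it vanishes in the limit of
  small neighbourhoods (\<open>asymptotic_equicontinuity\<close>). Compactness then reduces the
  complement of a ball around \<open>\<theta>0\<close> to finitely many neighbourhoods (\<open>loss_separation\<close>).

  \<^emph>\<open>Independence of the innovation.\<close> The stationary \<open>g\<^sub>0 \<theta>\<close> is a functional of the whole noise
  path, but \<open>ghat\<^sub>n \<theta>\<close> and \<open>\<sigma>\<^sub>n\<^sup>2\<close> are functions of \<open>\<sigma>\<^sub>0\<^sup>2, Z\<^sub>0, \<dots>, Z\<^sub>n\<^sub>-\<^sub>1\<close>, hence independent of \<open>Z\<^sub>n\<close>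
  because \<open>\<sigma>\<^sup>2\<close> is non anticipative. Letting \<open>n\<close> tend to infinity and using stationarity transfers
  the factorisation of the mean to \<open>g\<^sub>0 \<theta>\<close> (\<open>innovation_identity\<close>).
\<close>

section \<open>Paths and shifts\<close>

abbreviation paths :: "(int \<Rightarrow> real) measure" where
  "paths \<equiv> (\<Pi>\<^sub>M t\<in>UNIV. borel)"

lemma space_paths [simp]: "space paths = UNIV"
  by (simp add: space_PiM PiE_UNIV_domain)

definition shift :: "int \<Rightarrow> (int \<Rightarrow> real) \<Rightarrow> int \<Rightarrow> real" where
  "shift k z = (\<lambda>t. z (t + k))"

lemma shift_measurable [measurable]: "shift k \<in> paths \<rightarrow>\<^sub>M paths"
  by (rule measurable_PiM_single') (auto simp: shift_def)

lemma shift_shift [simp]: "shift j (shift k z) = shift (j + k) z"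
  by (auto simp: shift_def algebra_simps)

lemma shift_0 [simp]: "shift 0 z = z"
  by (simp add: shift_def)

lemma path_measurable:
  assumes "\<And>t. Y t \<in> borel_measurable N"
  shows "(\<lambda>\<omega> t. Y t \<omega>) \<in> N \<rightarrow>\<^sub>M paths"
  by (rule measurable_PiM_single') (use assms in auto)

lemma strictly_stationary_iff:
  assumes Y: "\<And>t. Y t \<in> borel_measurable N"
  shows "strictly_stationary N Y \<longleftrightarrow> (\<forall>k. distr (path_law N Y) paths (shift k) = path_law N Y)"
proof -
  have "distr (path_law N Y) paths (shift k) = path_law N (\<lambda>t. Y (t + k))" for k
    unfolding path_law_def
    by (subst distr_distr) (auto intro!: path_measurable Y simp: comp_def shift_def)
  then show ?thesis by (simp add: strictly_stationary_def)
qed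

section \<open>A Borel coding of paths by real numbers\<close>

text \<open>
With digits \<open>0\<close> and \<open>1\<close> only, the digits after position \<open>n\<close> contribute at most \<open>1/2\<close> after scaling
by \<open>3 ^ n\<close>. So there is no carry, and every digit is a Borel function of the sum.
\<close>

lemma ternary_digit:
  fixes b :: "nat \<Rightarrow> bool"
  defines "y \<equiv> \<Sum>i. of_bool (b i) / 3 ^ i"
  shows "\<lfloor>3 ^ n * y\<rfloor> mod 3 = (1::int) \<longleftrightarrow> b n" and "(0::real) \<le> y" and "y \<le> 2"
proof -
  define a :: "nat \<Rightarrow> real" where "a i = of_bool (b i) / 3 ^ i" for i
  have geo: "(\<lambda>i. (1/3::real) ^ i) sums (3/2)" using geometric_sums[of "1/3::real"] by simp
  have bound: "of_bool (c i) / 3 ^ i \<le> (1/3::real) ^ i" for c i by (simp add: power_divide)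
  have summ: "summable (\<lambda>i. of_bool (c i) / 3 ^ i :: real)" for c
    by (rule summable_comparison_test_ev[OF _ sums_summable[OF geo]])
       (use bound in \<open>auto intro!: always_eventually\<close>)
  have up: "(\<Sum>i. of_bool (c i) / 3 ^ i :: real) \<le> 3/2" for c
    using suminf_le[OF bound[of c] summ[of c] sums_summable[OF geo]] sums_unique[OF geo] by simp
  have lo: "(0::real) \<le> (\<Sum>i. of_bool (c i) / 3 ^ i)" for c
    by (rule suminf_nonneg[OF summ]) simp
  show "0 \<le> y" unfolding y_def by (rule lo)
  show "y \<le> 2" unfolding y_def using up[of b] by simp
  \<comment> \<open>The digits before \<open>n\<close> contribute the multiple \<open>3 * k\<close> to \<open>3 ^ n * y\<close>, the others the rest \<open>r\<close>.\<close>
  define k :: int where "k = (\<Sum>i<n. of_bool (b i) * 3 ^ (n - i - 1))"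
  define r :: real where "r = (\<Sum>i. of_bool (b (i + n)) / 3 ^ i)"
  have "y = (\<Sum>i. a (i + n)) + (\<Sum>i<n. a i)"
    unfolding y_def a_def by (rule suminf_split_initial_segment[OF summ])
  moreover have "3 ^ n * (\<Sum>i. a (i + n)) = r"
    unfolding r_def a_def
    by (subst suminf_mult[symmetric], rule summable_ignore_initial_segment[OF summ])
       (simp add: power_add)
  moreover have "3 ^ n * (\<Sum>i<n. a i) = 3 * of_int k"
    unfolding k_def a_def sum_distrib_left of_int_sum
  proof (rule sum.cong)
    fix i assume "i \<in> {..<n}"
    then have "(3::real) ^ n = 3 * 3 ^ (n - i - 1) * 3 ^ i"
      by (simp flip: power_Suc power_add)
    then show "3 ^ n * (of_bool (b i) / 3 ^ i :: real) = 3 * of_int (of_bool (b i) * 3 ^ (n - i - 1))"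
      by simp
  qed simp
  ultimately have y: "3 ^ n * y = of_int (3 * k) + r" by (simp add: algebra_simps)
  define c where "c = (\<lambda>i. b (Suc i + n))"
  have "r = of_bool (b n) + (\<Sum>i. of_bool (c i) / 3 ^ i) / 3"
    unfolding r_def c_def
    using suminf_split_head[OF summ[of "\<lambda>i. b (i + n)"]] suminf_divide[OF summ[of "\<lambda>i. b (Suc i + n)"], of 3]
    by (simp add: mult.commute)
  then have "\<lfloor>r\<rfloor> = of_bool (b n)"
    using up[of c] lo[of c] by (intro floor_unique) auto
  then have "\<lfloor>3 ^ n * y\<rfloor> = 3 * k + of_bool (b n)" unfolding y by linarith
  then show "\<lfloor>3 ^ n * y\<rfloor> mod 3 = 1 \<longleftrightarrow> b n" by (auto simp: mod_add_eq)
qed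

text \<open>
The digits record the truth values of \<open>v t < q\<close> for all times \<open>t\<close> and rationals \<open>q\<close>; they determine
the path. Together with the decoder this embeds the path space into \<open>{0..2}\<close> as a Borel space, so
that a random path can be treated as a bounded random variable.
\<close>

definition path_encode :: "(int \<Rightarrow> real) \<Rightarrow> real" where
  "path_encode v = (\<Sum>i. of_bool (case from_nat i of (t :: int, q :: rat) \<Rightarrow> v t < of_rat q) / 3 ^ i)"

definition path_decode :: "real \<Rightarrow> int \<Rightarrow> real" where
  "path_decode y t = real_of_ereal (INF q :: rat.
     if \<lfloor>3 ^ to_nat (t, q) * y\<rfloor> mod 3 = 1 then ereal (of_rat q) else \<infinity>)"

lemma path_encode_range: "0 \<le> path_encode v" "path_encode v \<le> 2"
  unfolding path_encode_def by (rule ternary_digit)+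

lemma path_decode_encode: "path_decode (path_encode v) = v"
proof
  fix t
  have "\<lfloor>3 ^ to_nat (t, q) * path_encode v\<rfloor> mod 3 = 1 \<longleftrightarrow> v t < of_rat q" for q
    unfolding path_encode_def by (subst ternary_digit) simp
  moreover have "(INF q :: rat. if v t < of_rat q then ereal (of_rat q) else \<infinity>) = ereal (v t)"
  proof (rule antisym)
    show "(INF q :: rat. if v t < of_rat q then ereal (of_rat q) else \<infinity>) \<le> ereal (v t)"
    proof (rule dense_ge)
      fix x assume x: "ereal (v t) < x"
      then obtain s :: real where s: "ereal (v t) < ereal s" "ereal s < x"
        using ereal_dense2 by blast
      obtain q where q: "v t < of_rat q" "of_rat q < s" using of_rat_dense s(1) by auto
      have "(INF q :: rat. if v t < of_rat q then ereal (of_rat q) else \<infinity>) \<le> ereal (of_rat q)"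
        by (rule INF_lower2[of q]) (use q in auto)
      also have "\<dots> \<le> x" using q s by (meson ereal_less_eq(3) less_imp_le order_trans)
      finally show "(INF q :: rat. if v t < of_rat q then ereal (of_rat q) else \<infinity>) \<le> x" .
    qed
  qed (rule INF_greatest, simp)
  ultimately show "path_decode (path_encode v) t = v t"
    unfolding path_decode_def by simp
qed

lemma path_encode_measurable [measurable]: "path_encode \<in> borel_measurable paths"
  unfolding path_encode_def by (simp add: case_prod_beta) measurable

lemma path_decode_measurable [measurable]: "path_decode \<in> borel \<rightarrow>\<^sub>M paths"
proof (rule measurable_PiM_single')
  show "(\<lambda>y. path_decode y t) \<in> borel_measurable borel" for t
    unfolding path_decode_def by measurable
qed auto

section \<open>Representing a joint law by independent randomisation\<close>

text \<open>
On the set where \<open>g < f\<close> the two integrals agree, so \<open>f - g\<close> has integral zero there.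
\<close>

lemma AE_le_of_set_nn_integral_le:
  assumes f [measurable]: "f \<in> borel_measurable N" and g [measurable]: "g \<in> borel_measurable N"
    and fin: "integral\<^sup>N N g < \<infinity>"
    and le: "\<And>A. A \<in> sets N \<Longrightarrow> (\<integral>\<^sup>+x\<in>A. f x \<partial>N) \<le> (\<integral>\<^sup>+x\<in>A. g x \<partial>N)"
  shows "AE x in N. f x \<le> g x"
proof -
  define A where "A = {x \<in> space N. g x < f x}"
  have A [measurable]: "A \<in> sets N" unfolding A_def by measurable
  have "(\<integral>\<^sup>+x\<in>A. g x \<partial>N) \<le> integral\<^sup>N N g"
    by (intro nn_integral_mono) (auto split: split_indicator)
  then have fin': "(\<integral>\<^sup>+x\<in>A. g x \<partial>N) \<noteq> \<infinity>" using fin by (simp add: top.not_eq_extremum)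
  have "(\<integral>\<^sup>+x. f x * indicator A x - g x * indicator A x \<partial>N)
      = (\<integral>\<^sup>+x\<in>A. f x \<partial>N) - (\<integral>\<^sup>+x\<in>A. g x \<partial>N)"
    by (rule nn_integral_diff[OF _ _ fin']) (auto simp: A_def split: split_indicator)
  also have "\<dots> = 0" using le[OF A] by (simp add: diff_eq_0_iff_ennreal) (metis fin' infinity_ennreal_def top.not_eq_extremum order_le_less_trans)
  finally have "AE x in N. f x * indicator A x - g x * indicator A x = 0"
    by (subst (asm) nn_integral_0_iff_AE) auto
  then show ?thesis
    using AE_space by eventually_elim (auto simp: A_def diff_eq_0_iff_ennreal split: split_indicator_asm)
qed

text \<open>
For a fixed first component \<open>A\<close>, both sides are finite measures in the second component, and these
are determined by their upper tails.
\<close>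

lemma joint_law_eqI:
  fixes J J' :: "('x \<times> real) measure"
  assumes sets [measurable_cong]: "sets J = sets (N \<Otimes>\<^sub>M borel)" "sets J' = sets (N \<Otimes>\<^sub>M borel)"
    and fin: "prob_space J" "prob_space J'"
    and eq: "\<And>A y. A \<in> sets N \<Longrightarrow> emeasure J (A \<times> {y<..}) = emeasure J' (A \<times> {y<..})"
  shows "J = J'"
proof -
  interpret J: prob_space J by fact
  interpret J': prob_space J' by fact
  have space: "space J = space N \<times> UNIV" "space J' = space N \<times> UNIV"
    using sets_eq_imp_space_eq[OF sets(1)] sets_eq_imp_space_eq[OF sets(2)]
    by (auto simp: space_pair_measure)
  have rect: "emeasure J (A \<times> B) = emeasure J' (A \<times> B)" if A: "A \<in> sets N" and B: "B \<in> sets borel" for A B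
  proof -
    define m where "m J = distr (density J (indicator (A \<times> UNIV))) borel snd" for J :: "('x \<times> real) measure"
    have m: "emeasure (m J) B = emeasure J (A \<times> B)"
      if [measurable_cong]: "sets J = sets (N \<Otimes>\<^sub>M borel)" and [measurable]: "B \<in> sets borel" for J B
    proof -
      have [measurable]: "A \<times> UNIV \<in> sets J" "A \<times> B \<in> sets J" using A that by auto
      have "space J = space N \<times> UNIV" using sets_eq_imp_space_eq[OF that(1)] by (simp add: space_pair_measure)
      then have "A \<times> UNIV \<inter> (snd -` B \<inter> space J) = A \<times> B"
        using sets.sets_into_space[OF A] by auto
      then show ?thesis
        by (simp add: m_def emeasure_distr emeasure_density flip: indicator_inter_arith)
    qed
    have "m J = m J'"
    proof (rule measure_eqI_lessThan)
      show "emeasure (m J) {y<..} < \<infinity>" for y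
        by (subst m) (auto simp: sets J.emeasure_eq_measure)
      show "emeasure (m J) {y<..} = emeasure (m J') {y<..}" for y
        using eq[OF A] by (simp add: m sets)
    qed (auto simp: m_def)
    then show ?thesis using m sets B by metis
  qed
  show ?thesis
  proof (rule measure_eqI_generator_eq[OF Int_stable_pair_measure_generator[of N borel],
      where \<Omega> = "space N \<times> UNIV" and A = "\<lambda>_. space N \<times> UNIV"])
    show "{a \<times> b |a b. a \<in> sets N \<and> b \<in> sets (borel::real measure)} \<subseteq> Pow (space N \<times> UNIV)"
      using sets.sets_into_space by fastforce
    show "sets J = sigma_sets (space N \<times> UNIV) {a \<times> b |a b. a \<in> sets N \<and> b \<in> sets borel}"
      "sets J' = sigma_sets (space N \<times> UNIV) {a \<times> b |a b. a \<in> sets N \<and> b \<in> sets borel}"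
      using sets by (simp_all add: sets_pair_measure)
    show "range (\<lambda>_. space N \<times> UNIV) \<subseteq> {a \<times> b |a b. a \<in> sets N \<and> b \<in> sets (borel::real measure)}"
      by (auto intro!: exI[of _ "space N"])
  qed (auto simp: rect)
qed

context prob_space begin

text \<open>
The Radon--Nikodym density of \<open>A \<mapsto> P (C \<inter> {X \<in> A})\<close> with respect to the law of \<open>X\<close> is the conditional
probability of \<open>C\<close> as a function of the value of \<open>X\<close>.
\<close>

lemma conditional_probability_exists:
  assumes X [measurable]: "X \<in> M \<rightarrow>\<^sub>M N" and C: "C \<in> sets M"
  shows "\<exists>f \<in> borel_measurable N. \<forall>A\<in>sets N.
    (\<integral>\<^sup>+x\<in>A. f x \<partial>distr M N X) = emeasure M {\<omega>\<in>C. X \<omega> \<in> A}"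
proof -
  define L where "L = distr M N X"
  define R where "R = distr (density M (indicator C)) N X"
  interpret L: prob_space L unfolding L_def by (rule prob_space_distr) simp
  have R: "emeasure R A = emeasure M {\<omega>\<in>C. X \<omega> \<in> A}" if [measurable]: "A \<in> sets N" for A
  proof -
    have "emeasure R A = emeasure M (C \<inter> (X -` A \<inter> space M))"
      using C by (simp add: R_def emeasure_distr emeasure_density flip: indicator_inter_arith)
    also have "C \<inter> (X -` A \<inter> space M) = {\<omega>\<in>C. X \<omega> \<in> A}"
      using sets.sets_into_space[OF C] by auto
    finally show ?thesis .
  qed
  have "absolutely_continuous L R"
    unfolding absolutely_continuous_def null_sets_def
  proof safe
    fix A assume "A \<in> sets L" and z: "emeasure L A = 0"
    then have A [measurable]: "A \<in> sets N" by (simp add: L_def)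
    have "emeasure R A \<le> emeasure L A"
      unfolding R[OF A] L_def by (subst emeasure_distr) (use sets.sets_into_space[OF C] in \<open>auto intro!: emeasure_mono\<close>)
    with z show "emeasure R A = 0" by simp
    show "A \<in> sets R" using A by (simp add: R_def)
  qed
  then obtain f where f: "f \<in> borel_measurable L" "density L f = R"
    using L.Radon_Nikodym by (metis L_def R_def sets_distr)
  show ?thesis
  proof (intro bexI ballI)
    show "f \<in> borel_measurable N" using f(1) by (simp add: L_def)
    fix A assume A: "A \<in> sets N"
    then have "emeasure (density L f) A = (\<integral>\<^sup>+x\<in>A. f x \<partial>L)"
      by (intro emeasure_density f(1)) (simp add: L_def)
    then show "(\<integral>\<^sup>+x\<in>A. f x \<partial>distr M N X) = emeasure M {\<omega>\<in>C. X \<omega> \<in> A}"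
      using R[OF A] f(2) by (simp add: L_def)
  qed
qed

text \<open>
Inverse transform sampling with parameters: \<open>\<Gamma> (x, \<cdot>)\<close> is a quantile function of the conditional law of
\<open>U\<close> given \<open>X = x\<close>. Only the conditional survival probabilities \<open>S q\<close> at rational levels \<open>q\<close> are used;
they are monotone in \<open>q\<close> outside a common null set, and no regular conditional distribution has to be
constructed. Boundedness of \<open>U\<close> makes the supremum that defines \<open>\<Gamma>\<close> a real number.
\<close>

lemma noise_outsourcing_real:
  fixes U :: "'a \<Rightarrow> real"
  assumes X [measurable]: "X \<in> M \<rightarrow>\<^sub>M N" and U [measurable]: "U \<in> borel_measurable M"
    and U_range: "\<And>\<omega>. 0 \<le> U \<omega>" "\<And>\<omega>. U \<omega> \<le> 2"
  defines "I \<equiv> uniform_measure lborel {0<..<1::real}"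
  shows "\<exists>\<Gamma> \<in> borel_measurable (N \<Otimes>\<^sub>M borel).
    distr M (N \<Otimes>\<^sub>M borel) (\<lambda>\<omega>. (X \<omega>, U \<omega>))
    = distr (distr M N X \<Otimes>\<^sub>M I) (N \<Otimes>\<^sub>M borel) (\<lambda>(x, u). (x, \<Gamma> (x, u)))"
proof -
  define L where "L = distr M N X"
  interpret L: prob_space L unfolding L_def by (rule prob_space_distr) simp
  interpret I: prob_space I unfolding I_def by (rule prob_space_uniform_measure) auto
  have sL [measurable_cong, simp]: "sets L = sets N" "space L = space N" by (auto simp: L_def)
  have sI [measurable_cong, simp]: "sets I = sets borel" "space I = UNIV" by (auto simp: I_def)
  interpret LI: pair_prob_space L I ..
  have "\<forall>q. \<exists>f. f \<in> borel_measurable N \<and> (\<forall>A\<in>sets N.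
    (\<integral>\<^sup>+x\<in>A. f x \<partial>L) = emeasure M {\<omega>\<in>{\<omega>\<in>space M. q < U \<omega>}. X \<omega> \<in> A})"
  proof
    fix q
    have C: "{\<omega>\<in>space M. q < U \<omega>} \<in> sets M" by measurable
    show "\<exists>f. f \<in> borel_measurable N \<and> (\<forall>A\<in>sets N.
      (\<integral>\<^sup>+x\<in>A. f x \<partial>L) = emeasure M {\<omega>\<in>{\<omega>\<in>space M. q < U \<omega>}. X \<omega> \<in> A})"
      using conditional_probability_exists[OF X C] unfolding L_def by blast
  qed
  from choice[OF this] obtain S :: "real \<Rightarrow> 'b \<Rightarrow> ennreal"
    where S [measurable]: "\<And>q. S q \<in> borel_measurable N"
      and S_int: "\<And>q A. A \<in> sets N \<Longrightarrow>
        (\<integral>\<^sup>+x\<in>A. S q x \<partial>L) = emeasure M {\<omega>\<in>{\<omega>\<in>space M. q < U \<omega>}. X \<omega> \<in> A}"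
    by blast
  have S_anti: "AE x in L. S r x \<le> S q x" if "q \<le> r" for q r
  proof (rule AE_le_of_set_nn_integral_le)
    have "integral\<^sup>N L (S q) = (\<integral>\<^sup>+x\<in>space N. S q x \<partial>L)"
      by (intro nn_integral_cong) simp
    also have "\<dots> < \<infinity>" unfolding S_int[OF sets.top] by (simp add: less_top[symmetric])
    finally show "integral\<^sup>N L (S q) < \<infinity>" .
    show "(\<integral>\<^sup>+x\<in>A. S r x \<partial>L) \<le> (\<integral>\<^sup>+x\<in>A. S q x \<partial>L)" if "A \<in> sets L" for A
      using that \<open>q \<le> r\<close> by (auto simp: S_int intro!: emeasure_mono)
  qed auto
  have S_le1: "AE x in L. S q x \<le> 1" for q
  proof (rule AE_le_of_set_nn_integral_le)
    show "(\<integral>\<^sup>+x. 1 \<partial>L) < \<infinity>" using L.emeasure_space_1 by simp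
    show "(\<integral>\<^sup>+x\<in>A. S q x \<partial>L) \<le> (\<integral>\<^sup>+x\<in>A. 1 \<partial>L)" if "A \<in> sets L" for A
    proof -
      have "(\<integral>\<^sup>+x\<in>A. 1 \<partial>L) = emeasure M (X -` A \<inter> space M)"
        using that by (simp add: L_def emeasure_distr)
      then show ?thesis using that by (auto simp: S_int intro!: emeasure_mono)
    qed
  qed auto
  \<comment> \<open>The level \<open>0\<close> belongs to \<open>Q\<close>, which gives \<open>\<Gamma> \<ge> 0\<close>; the level \<open>2\<close> bounds \<open>U\<close>.\<close>
  define Q where "Q = \<rat> \<inter> {0..2::real}"
  have Q: "countable Q" "Q \<noteq> {}" unfolding Q_def by (auto intro: countable_rat)
  have AE_Q: "AE x in L. (\<forall>q\<in>Q. S q x \<le> 1) \<and> (\<forall>q\<in>Q. \<forall>r\<in>Q. q \<le> r \<longrightarrow> S r x \<le> S q x)"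
    using S_anti S_le1 by (simp add: AE_ball_countable[OF Q(1)])
  define \<Gamma> where "\<Gamma> = (\<lambda>(x, u). SUP q\<in>Q. if ennreal u < S q x then q else 0)"
  have bdd: "bdd_above ((\<lambda>q. if ennreal u < S q x then q else 0) ` Q)" for x u
    by (rule bdd_aboveI[of _ 2]) (auto simp: Q_def)
  have \<Gamma> [measurable]: "\<Gamma> \<in> borel_measurable (N \<Otimes>\<^sub>M borel)"
    unfolding \<Gamma>_def case_prod_beta
    by (rule borel_measurable_cSUP[OF Q(1)]) (use bdd in auto)
  have \<Gamma>_gt: "y < \<Gamma> (x, u) \<longleftrightarrow> (\<exists>q\<in>Q. y < q \<and> ennreal u < S q x)" if "0 \<le> y" for x y u
    unfolding \<Gamma>_def prod.case less_cSUP_iff[OF Q(2) bdd] using that by force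
  have \<Gamma>_nn: "0 \<le> \<Gamma> (x, u)" for x u
  proof -
    have "0 \<in> Q" by (simp add: Q_def)
    from cSUP_upper[OF this bdd] show ?thesis by (simp add: \<Gamma>_def)
  qed
  have law_gt: "emeasure (L \<Otimes>\<^sub>M I) {(x, u). x \<in> A \<and> y < \<Gamma> (x, u)}
    = emeasure M {\<omega>\<in>{\<omega>\<in>space M. y < U \<omega>}. X \<omega> \<in> A}" if A [measurable]: "A \<in> sets N" for A y
  proof -
    have sA: "A \<subseteq> space N" using A by (rule sets.sets_into_space)
    have meas: "{(x, u). x \<in> A \<and> y < \<Gamma> (x, u)} \<in> sets (L \<Otimes>\<^sub>M I)"
    proof -
      have "{(x, u). x \<in> A \<and> y < \<Gamma> (x, u)} = {p\<in>space (L \<Otimes>\<^sub>M I). fst p \<in> A \<and> y < \<Gamma> p}"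
        using sA by (auto simp: space_pair_measure)
      also have "\<dots> \<in> sets (L \<Otimes>\<^sub>M I)" by measurable
      finally show ?thesis .
    qed
    have slice: "emeasure (L \<Otimes>\<^sub>M I) {(x, u). x \<in> A \<and> y < \<Gamma> (x, u)}
      = (\<integral>\<^sup>+x\<in>A. emeasure I {u. y < \<Gamma> (x, u)} \<partial>L)"
      unfolding I.emeasure_pair_measure_alt[OF meas]
      by (intro nn_integral_cong) (auto split: split_indicator simp: vimage_def)
    show ?thesis
    proof (cases "0 \<le> y")
      case False
      have "emeasure I UNIV = 1" using I.emeasure_space_1 by simp
      moreover have "y < \<Gamma> (x, u)" for x u using \<Gamma>_nn[of x u] False by linarith
      moreover have "y < U \<omega>" for \<omega> using U_range(1)[of \<omega>] False by linarith
      moreover have "X -` A \<inter> space M = {\<omega>\<in>space M. X \<omega> \<in> A}" by auto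
      ultimately show ?thesis
        unfolding slice by (simp add: L_def emeasure_distr)
    next
      case y0: True
      show ?thesis
      proof (cases "y < 2")
        case False
        have "\<not> y < \<Gamma> (x, u)" for x u
          unfolding \<Gamma>_gt[OF y0] using False by (auto simp: Q_def)
        moreover have "\<not> y < U \<omega>" for \<omega> using U_range(2)[of \<omega>] False by linarith
        ultimately show ?thesis unfolding slice by simp
      next
        case y2: True
        \<comment> \<open>Monotone convergence needs a sequence: rational levels that decrease to \<open>y\<close>.\<close>
        obtain q :: "nat \<Rightarrow> real" where q: "\<And>n. q n \<in> Q" "\<And>n. y < q n" "decseq q" "q \<longlonglongrightarrow> y"
        proof -
          have ex: "\<exists>x. x \<in> Q \<and> y < x \<and> x < b" if "y < b" for b
          proof -
            have "y < min 2 b" using y2 that by simp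
            then obtain c where "c \<in> \<rat>" "y < c" "c < min 2 b"
              using Rats_dense_in_real by blast
            then show ?thesis using y0 by (auto simp: Q_def)
          qed
          have "\<exists>f. \<forall>n. (f n \<in> Q \<and> y < f n \<and> f n < y + 1 / real (Suc n)) \<and> f (Suc n) \<le> f n"
          proof (rule dependent_nat_choice)
            show "\<exists>x. x \<in> Q \<and> y < x \<and> x < y + 1 / real (Suc 0)" by (rule ex) simp
            fix x n assume "x \<in> Q \<and> y < x \<and> x < y + 1 / real (Suc n)"
            then show "\<exists>z. (z \<in> Q \<and> y < z \<and> z < y + 1 / real (Suc (Suc n))) \<and> z \<le> x"
              using ex[of "min x (y + 1 / real (Suc (Suc n)))"] by auto
          qed
          then obtain f where f: "\<And>n. f n \<in> Q" "\<And>n. y < f n" "\<And>n. f n < y + 1 / real (Suc n)"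
            "\<And>n. f (Suc n) \<le> f n" by blast
          have "(\<lambda>n. y + 1 / real (Suc n)) \<longlonglongrightarrow> y"
            using tendsto_add[OF tendsto_const LIMSEQ_inverse_real_of_nat, of y] by (simp add: field_simps)
          then have "f \<longlonglongrightarrow> y"
            by (rule tendsto_sandwich[OF _ _ tendsto_const, rotated -1])
               (use f in \<open>auto intro!: always_eventually less_imp_le\<close>)
          with f that show ?thesis by (metis decseq_Suc_iff)
        qed
        have iff: "(\<exists>r\<in>Q. y < r \<and> ennreal u < S r x) \<longleftrightarrow> ennreal u < (SUP n. S (q n) x)"
          if x: "\<forall>q\<in>Q. \<forall>r\<in>Q. q \<le> r \<longrightarrow> S r x \<le> S q x" for x u
        proof
          assume "\<exists>r\<in>Q. y < r \<and> ennreal u < S r x"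
          then obtain r where r: "r \<in> Q" "y < r" "ennreal u < S r x" by auto
          obtain n where "q n < r" using order_tendstoD(2)[OF q(4) r(2)] by (auto simp: eventually_sequentially)
          then have "S r x \<le> S (q n) x" using x r q by auto
          then show "ennreal u < (SUP n. S (q n) x)"
            using r(3) by (auto simp: less_SUP_iff intro: order_less_le_trans)
        qed (use q in \<open>auto simp: less_SUP_iff\<close>)
        have "(\<integral>\<^sup>+x\<in>A. emeasure I {u. y < \<Gamma> (x, u)} \<partial>L) = (\<integral>\<^sup>+x\<in>A. (SUP n. S (q n) x) \<partial>L)"
        proof (intro nn_integral_cong_AE, use AE_Q in eventually_elim)
          fix x assume x: "(\<forall>q\<in>Q. S q x \<le> 1) \<and> (\<forall>q\<in>Q. \<forall>r\<in>Q. q \<le> r \<longrightarrow> S r x \<le> S q x)"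
          define s where "s = (SUP n. S (q n) x)"
          have s1: "s \<le> 1" unfolding s_def using x q by (auto intro!: SUP_least)
          then obtain p where p: "s = ennreal p" "0 \<le> p" "p \<le> 1"
            by (cases s) (auto simp: ennreal_le_1 top_unique)
          have "emeasure I {u. y < \<Gamma> (x, u)} = emeasure I {u. ennreal u < s}"
            unfolding \<Gamma>_gt[OF y0] s_def using iff x by simp
          also have "\<dots> = emeasure lborel ({0<..<1} \<inter> {u. ennreal u < s})"
            unfolding I_def by (subst emeasure_uniform_measure) (auto simp: divide_ennreal_def)
          also have "{0<..<1} \<inter> {u. ennreal u < s} = {0<..<p}"
            using p by (auto simp: ennreal_less_iff)
          also have "emeasure lborel {0<..<p} = s" using p by simp
          finally show "emeasure I {u. y < \<Gamma> (x, u)} * indicator A x = (SUP n. S (q n) x) * indicator A x"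
            by (simp add: s_def)
        qed
        also have "\<dots> = (\<integral>\<^sup>+x. (SUP n. S (q n) x * indicator A x) \<partial>L)"
          by (intro nn_integral_cong) (simp add: SUP_mult_right_ennreal)
        also have "\<dots> = (SUP n. \<integral>\<^sup>+x\<in>A. S (q n) x \<partial>L)"
        proof (rule nn_integral_monotone_convergence_SUP_AE)
          show "AE x in L. S (q n) x * indicator A x \<le> S (q (Suc n)) x * indicator A x" for n
            using AE_Q by eventually_elim (use q decseqD[OF q(3), of n "Suc n"] in \<open>auto split: split_indicator\<close>)
        qed simp
        also have "\<dots> = (SUP n. emeasure M {\<omega>\<in>{\<omega>\<in>space M. q n < U \<omega>}. X \<omega> \<in> A})"
          by (simp add: S_int)
        also have "\<dots> = emeasure M (\<Union>n. {\<omega>\<in>{\<omega>\<in>space M. q n < U \<omega>}. X \<omega> \<in> A})"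
          using decseqD[OF q(3)] by (intro SUP_emeasure_incseq) (auto simp: incseq_def intro: order_le_less_trans)
        also have "(\<Union>n. {\<omega>\<in>{\<omega>\<in>space M. q n < U \<omega>}. X \<omega> \<in> A}) = {\<omega>\<in>{\<omega>\<in>space M. y < U \<omega>}. X \<omega> \<in> A}"
        proof -
          have "\<exists>n. q n < U \<omega>" if "y < U \<omega>" for \<omega>
            using order_tendstoD(2)[OF q(4) that] by (auto simp: eventually_sequentially)
          then show ?thesis using q(2) by (auto intro: less_trans)
        qed
        finally show ?thesis unfolding slice .
      qed
    qed
  qed
  have "distr M (N \<Otimes>\<^sub>M borel) (\<lambda>\<omega>. (X \<omega>, U \<omega>))
    = distr (L \<Otimes>\<^sub>M I) (N \<Otimes>\<^sub>M borel) (\<lambda>(x, u). (x, \<Gamma> (x, u)))"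
  proof (rule joint_law_eqI)
    fix A and y :: real assume A: "A \<in> sets N"
    then have sA: "A \<subseteq> space N" by (rule sets.sets_into_space)
    have "emeasure (distr M (N \<Otimes>\<^sub>M borel) (\<lambda>\<omega>. (X \<omega>, U \<omega>))) (A \<times> {y<..})
        = emeasure M {\<omega>\<in>{\<omega>\<in>space M. y < U \<omega>}. X \<omega> \<in> A}"
      using A by (subst emeasure_distr) (auto intro!: arg_cong[where f = "emeasure M"])
    moreover have "emeasure (distr (L \<Otimes>\<^sub>M I) (N \<Otimes>\<^sub>M borel) (\<lambda>(x, u). (x, \<Gamma> (x, u)))) (A \<times> {y<..})
        = emeasure (L \<Otimes>\<^sub>M I) {(x, u). x \<in> A \<and> y < \<Gamma> (x, u)}"
      using A sA by (subst emeasure_distr)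
        (auto simp: space_pair_measure intro!: arg_cong[where f = "emeasure (L \<Otimes>\<^sub>M I)"])
    ultimately show "emeasure (distr M (N \<Otimes>\<^sub>M borel) (\<lambda>\<omega>. (X \<omega>, U \<omega>))) (A \<times> {y<..})
      = emeasure (distr (L \<Otimes>\<^sub>M I) (N \<Otimes>\<^sub>M borel) (\<lambda>(x, u). (x, \<Gamma> (x, u)))) (A \<times> {y<..})"
      using law_gt[OF A] by simp
  qed (auto intro!: prob_space.prob_space_distr prob_space_axioms LI.prob_space_axioms)
  with \<Gamma> show ?thesis unfolding L_def by blast
qed

text \<open>
The real case applied to the code of the path \<open>Y\<close>, followed by decoding.
\<close>

lemma noise_outsourcing:
  assumes X [measurable]: "X \<in> M \<rightarrow>\<^sub>M N" and Y [measurable]: "Y \<in> M \<rightarrow>\<^sub>M paths"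
  defines "I \<equiv> uniform_measure lborel {0<..<1::real}"
  shows "\<exists>\<Gamma> \<in> N \<Otimes>\<^sub>M borel \<rightarrow>\<^sub>M paths.
    distr M (N \<Otimes>\<^sub>M paths) (\<lambda>\<omega>. (X \<omega>, Y \<omega>))
    = distr (distr M N X \<Otimes>\<^sub>M I) (N \<Otimes>\<^sub>M paths) (\<lambda>(x, u). (x, \<Gamma> (x, u)))"
proof -
  have sI [measurable_cong]: "sets I = sets borel" by (simp add: I_def)
  obtain G where G [measurable]: "G \<in> borel_measurable (N \<Otimes>\<^sub>M borel)"
    and eq: "distr M (N \<Otimes>\<^sub>M borel) (\<lambda>\<omega>. (X \<omega>, path_encode (Y \<omega>)))
      = distr (distr M N X \<Otimes>\<^sub>M I) (N \<Otimes>\<^sub>M borel) (\<lambda>(x, u). (x, G (x, u)))"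
    using noise_outsourcing_real[OF X, of "\<lambda>\<omega>. path_encode (Y \<omega>)"]
    unfolding I_def by (auto simp: path_encode_range)
  let ?dec = "\<lambda>(x, u). (x, path_decode u)"
  have "distr M (N \<Otimes>\<^sub>M paths) (\<lambda>\<omega>. (X \<omega>, Y \<omega>))
      = distr (distr M (N \<Otimes>\<^sub>M borel) (\<lambda>\<omega>. (X \<omega>, path_encode (Y \<omega>)))) (N \<Otimes>\<^sub>M paths) ?dec"
    by (subst distr_distr) (auto simp: comp_def path_decode_encode)
  also have "\<dots> = distr (distr M N X \<Otimes>\<^sub>M I) (N \<Otimes>\<^sub>M paths) (\<lambda>(x, u). (x, path_decode (G (x, u))))"
    unfolding eq by (subst distr_distr) (auto simp: comp_def split_beta')
  finally show ?thesis
    by (intro bexI[of _ "\<lambda>p. path_decode (G p)"]) auto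
qed

end

section \<open>A unique stationary solution is a functional of the noise\<close>

definition recursion_graph :: "(real \<Rightarrow> real) \<Rightarrow> (real \<Rightarrow> real \<Rightarrow> real) \<Rightarrow> real set \<Rightarrow> (real \<times> real \<times> real) set" where
  "recursion_graph u f S = {(x, y, z). x \<in> S \<and> y \<in> S \<and> u y = f (u x) z}"

text \<open>
Measurability of the recursion graph makes "the recursion holds almost surely" a statement about the
joint law of noise and solution. The property can therefore be moved between probability spaces.
\<close>

lemma stationary_solution_joint_law:
  assumes R: "recursion_graph u f S \<in> sets borel"
    and \<xi> [measurable]: "\<And>t. \<xi> t \<in> borel_measurable P" and Y [measurable]: "\<And>t. Y t \<in> borel_measurable P"
    and \<xi>' [measurable]: "\<And>t. \<xi>' t \<in> borel_measurable P'" and Y' [measurable]: "\<And>t. Y' t \<in> borel_measurable P'"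
    and eq: "distr P (paths \<Otimes>\<^sub>M paths) (\<lambda>\<omega>. (\<lambda>t. \<xi> t \<omega>, \<lambda>t. Y t \<omega>))
      = distr P' (paths \<Otimes>\<^sub>M paths) (\<lambda>\<omega>. (\<lambda>t. \<xi>' t \<omega>, \<lambda>t. Y' t \<omega>))"
    and sol: "stationary_solution P \<xi> u f S Y"
  shows "stationary_solution P' \<xi>' u f S Y'"
proof -
  have [measurable]: "(\<lambda>\<omega>. (\<lambda>t. \<xi> t \<omega>, \<lambda>t. Y t \<omega>)) \<in> P \<rightarrow>\<^sub>M paths \<Otimes>\<^sub>M paths"
    "(\<lambda>\<omega>. (\<lambda>t. \<xi>' t \<omega>, \<lambda>t. Y' t \<omega>)) \<in> P' \<rightarrow>\<^sub>M paths \<Otimes>\<^sub>M paths"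
    by (auto intro!: measurable_Pair path_measurable)
  have tr: "(AE \<omega> in P. (\<lambda>t. \<xi> t \<omega>, \<lambda>t. Y t \<omega>) \<in> A) \<longleftrightarrow> (AE \<omega> in P'. (\<lambda>t. \<xi>' t \<omega>, \<lambda>t. Y' t \<omega>) \<in> A)"
    if [measurable]: "A \<in> sets (paths \<Otimes>\<^sub>M paths)" for A
  proof -
    have "(AE \<omega> in P. (\<lambda>t. \<xi> t \<omega>, \<lambda>t. Y t \<omega>) \<in> A)
      \<longleftrightarrow> (AE p in distr P (paths \<Otimes>\<^sub>M paths) (\<lambda>\<omega>. (\<lambda>t. \<xi> t \<omega>, \<lambda>t. Y t \<omega>)). p \<in> A)"
      by (subst AE_distr_iff) auto
    also have "\<dots> \<longleftrightarrow> (AE \<omega> in P'. (\<lambda>t. \<xi>' t \<omega>, \<lambda>t. Y' t \<omega>) \<in> A)"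
      unfolding eq by (subst AE_distr_iff) auto
    finally show ?thesis .
  qed
  have S_P: "AE \<omega> in P. Y t \<omega> \<in> S" and eq_P: "AE \<omega> in P. u (Y (t + 1) \<omega>) = f (u (Y t \<omega>)) (\<xi> t \<omega>)"
    and st: "strictly_stationary P Y" for t
    using sol by (auto simp: stationary_solution_def)
  have R_P': "AE \<omega> in P'. (Y' t \<omega>, Y' (t + 1) \<omega>, \<xi>' t \<omega>) \<in> recursion_graph u f S" for t
  proof -
    define A where "A = (\<lambda>p. (snd p t, snd p (t + 1), fst p t)) -` recursion_graph u f S \<inter> space (paths \<Otimes>\<^sub>M paths)"
    have A: "A \<in> sets (paths \<Otimes>\<^sub>M paths)" unfolding A_def
      by (rule measurable_sets[OF _ R]) measurable
    have "AE \<omega> in P. (\<lambda>t. \<xi> t \<omega>, \<lambda>t. Y t \<omega>) \<in> A"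
      using S_P[of t] S_P[of "t + 1"] eq_P[of t]
      by eventually_elim (auto simp: A_def recursion_graph_def space_pair_measure)
    then have "AE \<omega> in P'. (\<lambda>t. \<xi>' t \<omega>, \<lambda>t. Y' t \<omega>) \<in> A" unfolding tr[OF A] .
    then show ?thesis by eventually_elim (simp add: A_def)
  qed
  have "path_law P Y = distr (distr P (paths \<Otimes>\<^sub>M paths) (\<lambda>\<omega>. (\<lambda>t. \<xi> t \<omega>, \<lambda>t. Y t \<omega>))) paths snd"
    unfolding path_law_def by (subst distr_distr) (auto simp: comp_def)
  also have "\<dots> = path_law P' Y'"
    unfolding path_law_def eq by (subst distr_distr) (auto simp: comp_def)
  finally have "path_law P Y = path_law P' Y'" .
  then have "strictly_stationary P' Y'"
    using st by (simp add: strictly_stationary_iff)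
  moreover have "AE \<omega> in P'. Y' t \<omega> \<in> S" "AE \<omega> in P'. u (Y' (t + 1) \<omega>) = f (u (Y' t \<omega>)) (\<xi>' t \<omega>)" for t
    using R_P'[of t] by (eventually_elim, simp add: recursion_graph_def)+
  ultimately show ?thesis by (auto simp: stationary_solution_def)
qed

text \<open>
Every triple of noise and two solutions has a copy with the same joint law on the path space over
which the definition of uniqueness quantifies.
\<close>

lemma unique_on_every_space:
  assumes R: "recursion_graph u f S \<in> sets borel"
    and uniq: "unique_stationary_solution M \<xi> u f S Y"
    and P: "prob_space P" and \<zeta> [measurable]: "\<And>t. \<zeta> t \<in> borel_measurable P"
    and law: "path_law P \<zeta> = path_law M \<xi>"
    and V: "stationary_solution P \<zeta> u f S V" and W: "stationary_solution P \<zeta> u f S W"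
  shows "AE \<omega> in P. V t \<omega> = W t \<omega>"
proof -
  interpret P: prob_space P by fact
  have [measurable]: "V t \<in> borel_measurable P" "W t \<in> borel_measurable P" for t
    using V W by (auto simp: stationary_solution_def)
  let ?T = "(\<Pi>\<^sub>M t\<in>UNIV. borel) :: (int \<Rightarrow> real \<times> real \<times> real) measure"
  define j where "j \<omega> = (\<lambda>t. (\<zeta> t \<omega>, V t \<omega>, W t \<omega>))" for \<omega>
  have j [measurable]: "j \<in> P \<rightarrow>\<^sub>M ?T"
  proof (rule measurable_PiM_single')
    show "(\<lambda>\<omega>. j \<omega> t) \<in> borel_measurable P" for t unfolding j_def by measurable
  qed auto
  define N where "N = distr P ?T j"
  interpret N: prob_space N unfolding N_def by (rule P.prob_space_distr) simp
  have coord: "(\<lambda>p. F (p t)) \<in> borel_measurable N" if F: "F \<in> borel_measurable borel" for F :: "real \<times> real \<times> real \<Rightarrow> real" and t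
    unfolding N_def by (simp, rule measurable_compose[OF measurable_component_singleton[of t UNIV "\<lambda>_. borel"] F]) simp
  define z v w :: "int \<Rightarrow> (int \<Rightarrow> real \<times> real \<times> real) \<Rightarrow> real"
    where "z t p = fst (p t)" and "v t p = fst (snd (p t))" and "w t p = snd (snd (p t))" for t p
  have F: "fst \<in> borel_measurable (borel :: (real \<times> real \<times> real) measure)"
    "(\<lambda>x. fst (snd x)) \<in> borel_measurable (borel :: (real \<times> real \<times> real) measure)"
    "(\<lambda>x. snd (snd x)) \<in> borel_measurable (borel :: (real \<times> real \<times> real) measure)"
    by (auto simp: borel_prod[symmetric])
  have zN [measurable]: "z t \<in> borel_measurable N" "v t \<in> borel_measurable N" "w t \<in> borel_measurable N" for t
    using coord[OF F(1)] coord[OF F(2)] coord[OF F(3)] by (auto simp: z_def[abs_def] v_def[abs_def] w_def[abs_def])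
  have zT [measurable]: "z t \<in> borel_measurable ?T" "v t \<in> borel_measurable ?T" "w t \<in> borel_measurable ?T" for t
    using zN by (simp_all add: N_def)
  have m: "(\<lambda>p. (\<lambda>t. z t p, \<lambda>t. v t p)) \<in> ?T \<rightarrow>\<^sub>M paths \<Otimes>\<^sub>M paths"
    "(\<lambda>p. (\<lambda>t. z t p, \<lambda>t. w t p)) \<in> ?T \<rightarrow>\<^sub>M paths \<Otimes>\<^sub>M paths"
    "(\<lambda>p. (\<lambda>t. z t p)) \<in> ?T \<rightarrow>\<^sub>M paths"
    by (auto intro!: measurable_Pair path_measurable)
  have jz: "z t (j \<omega>) = \<zeta> t \<omega>" "v t (j \<omega>) = V t \<omega>" "w t (j \<omega>) = W t \<omega>" for t \<omega>
    by (auto simp: z_def v_def w_def j_def)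
  have solv: "stationary_solution N z u f S v"
    by (rule stationary_solution_joint_law[OF R _ _ _ _ _ V])
       (auto simp: N_def distr_distr[OF m(1) j] comp_def jz)
  have solw: "stationary_solution N z u f S w"
    by (rule stationary_solution_joint_law[OF R _ _ _ _ _ W])
       (auto simp: N_def distr_distr[OF m(2) j] comp_def jz)
  have "path_law N z = path_law M \<xi>"
    unfolding law[symmetric] by (simp add: path_law_def N_def distr_distr[OF m(3) j] comp_def jz)
  then have "AE p in N. v t p = w t p"
    using uniq solv solw N.prob_space_axioms zN(1) unfolding unique_stationary_solution_def by blast
  then show ?thesis unfolding N_def by (subst (asm) AE_distr_iff) (auto simp: jz)
qed

text \<open>
The argument of Yamada and Watanabe. Let \<open>u\<close> and \<open>u'\<close> be independent uniform variables, independent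
of a noise \<open>z\<close>. Then \<open>\<Gamma> (z, u)\<close> and \<open>\<Gamma> (z, u')\<close> both solve the recursion with noise \<open>z\<close>, hence agree
almost surely. Freezing one of the uniform variables at a suitable value \<open>b\<close> shows that \<open>\<Gamma> (z, u)\<close> does
not depend on \<open>u\<close>.
\<close>

lemma solution_functional_of_noise:
  assumes R: "recursion_graph u f S \<in> sets borel"
    and M: "prob_space M" and \<xi> [measurable]: "\<And>t. \<xi> t \<in> borel_measurable M"
    and uniq: "unique_stationary_solution M \<xi> u f S Y"
  shows "\<exists>H \<in> paths \<rightarrow>\<^sub>M paths. AE \<omega> in M. (\<lambda>t. Y t \<omega>) = H (\<lambda>t. \<xi> t \<omega>)"
proof -
  interpret M: prob_space M by fact
  define I where "I = uniform_measure lborel {0<..<1::real}"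
  interpret I: prob_space I unfolding I_def by (rule prob_space_uniform_measure) auto
  have sI [measurable_cong]: "sets I = sets borel" by (simp add: I_def)
  have sol: "stationary_solution M \<xi> u f S Y" using uniq by (simp add: unique_stationary_solution_def)
  then have [measurable]: "Y t \<in> borel_measurable M" for t by (simp add: stationary_solution_def)
  have \<xi>p [measurable]: "(\<lambda>\<omega> t. \<xi> t \<omega>) \<in> M \<rightarrow>\<^sub>M paths" and Yp [measurable]: "(\<lambda>\<omega> t. Y t \<omega>) \<in> M \<rightarrow>\<^sub>M paths"
    by (auto intro!: path_measurable)
  define L where "L = path_law M \<xi>"
  interpret L: prob_space L unfolding L_def path_law_def by (rule M.prob_space_distr) simp
  have sL [measurable_cong, simp]: "sets L = sets paths" by (simp add: L_def path_law_def)
  obtain \<Gamma> where \<Gamma> [measurable]: "\<Gamma> \<in> paths \<Otimes>\<^sub>M borel \<rightarrow>\<^sub>M paths"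
    and joint: "distr M (paths \<Otimes>\<^sub>M paths) (\<lambda>\<omega>. (\<lambda>t. \<xi> t \<omega>, \<lambda>t. Y t \<omega>))
      = distr (L \<Otimes>\<^sub>M I) (paths \<Otimes>\<^sub>M paths) (\<lambda>(x, u). (x, \<Gamma> (x, u)))"
    using M.noise_outsourcing[OF \<xi>p Yp] unfolding L_def path_law_def I_def by blast
  interpret LI: pair_prob_space L I ..
  interpret ILI: pair_prob_space I "L \<Otimes>\<^sub>M I" ..
  \<comment> \<open>The second uniform variable comes first, so that Fubini can freeze it.\<close>
  define P where "P = I \<Otimes>\<^sub>M (L \<Otimes>\<^sub>M I)"
  have sP [measurable_cong]: "sets P = sets (borel \<Otimes>\<^sub>M (paths \<Otimes>\<^sub>M borel))"
    unfolding P_def by (intro sets_pair_measure_cong sL sI)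
  interpret P: prob_space P unfolding P_def by (rule ILI.prob_space_axioms)
  have c: "(\<lambda>p. p t) \<in> borel_measurable paths" for t :: int by measurable
  have m: "(\<lambda>p. \<Gamma> p t) \<in> borel_measurable (paths \<Otimes>\<^sub>M borel)" for t
    by (rule measurable_compose[OF \<Gamma> c])
  define V W where "V t p = \<Gamma> (snd p) t" and "W t p = \<Gamma> (fst (snd p), fst p) t"
    for t :: int and p :: "real \<times> (int \<Rightarrow> real) \<times> real"
  have [measurable]: "V t \<in> borel_measurable P" "W t \<in> borel_measurable P" for t
    unfolding V_def[abs_def] W_def[abs_def] by (rule measurable_compose[OF _ m], measurable)+
  have fs: "(\<lambda>p. fst (snd p) t) \<in> borel_measurable P" for t
    by (rule measurable_compose[OF _ c]) measurable
  have YM: "Y t \<in> borel_measurable M" for t by fact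
  have VW: "V t \<in> borel_measurable P" "W t \<in> borel_measurable P" for t by fact+
  have law_V: "distr P (L \<Otimes>\<^sub>M I) snd = L \<Otimes>\<^sub>M I"
  proof (rule measure_eqI)
    fix A assume "A \<in> sets (distr P (L \<Otimes>\<^sub>M I) snd)"
    then have A: "A \<in> sets (L \<Otimes>\<^sub>M I)" by simp
    then have "emeasure (distr P (L \<Otimes>\<^sub>M I) snd) A = emeasure P (space I \<times> A)"
      using sets.sets_into_space[OF A]
      by (subst emeasure_distr) (auto simp: P_def space_pair_measure intro!: arg_cong2[where f = emeasure])
    also have "\<dots> = emeasure (L \<Otimes>\<^sub>M I) A"
      unfolding P_def using A by (subst LI.emeasure_pair_measure_Times) (auto simp: I.emeasure_space_1)
    finally show "emeasure (distr P (L \<Otimes>\<^sub>M I) snd) A = emeasure (L \<Otimes>\<^sub>M I) A" .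
  qed simp
  have law_W: "L \<Otimes>\<^sub>M I = distr P (L \<Otimes>\<^sub>M I) (\<lambda>p. (fst (snd p), fst p))"
  proof (rule pair_measure_eqI)
    fix A B assume A [measurable]: "A \<in> sets L" and B [measurable]: "B \<in> sets I"
    have AB: "A \<times> B \<in> sets (L \<Otimes>\<^sub>M I)" using A B by (rule pair_measureI)
    have "(\<lambda>p. (fst (snd p), fst p)) \<in> P \<rightarrow>\<^sub>M L \<Otimes>\<^sub>M I" by measurable
    note emeasure_distr[OF this AB]
    also have "emeasure P ((\<lambda>p. (fst (snd p), fst p)) -` (A \<times> B) \<inter> space P) = emeasure P (B \<times> (A \<times> space I))"
      using sets.sets_into_space[OF A] sets.sets_into_space[OF B]
      by (auto simp: P_def space_pair_measure intro!: arg_cong2[where f = emeasure])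
    also have "\<dots> = emeasure I B * (emeasure L A * emeasure I (space I))"
    proof -
      have "space I \<in> sets I" by (rule sets.top)
      with A B show ?thesis unfolding P_def
        using LI.emeasure_pair_measure_Times[OF B pair_measureI[of A L "space I" I]]
          I.emeasure_pair_measure_Times[of A L "space I"] by metis
    qed
    finally show "emeasure L A * emeasure I B
      = emeasure (distr P (L \<Otimes>\<^sub>M I) (\<lambda>p. (fst (snd p), fst p))) (A \<times> B)"
      by (simp add: I.emeasure_space_1 mult.commute)
  qed (auto intro: L.sigma_finite_measure_axioms I.sigma_finite_measure_axioms)
  have mP [measurable]: "(\<lambda>p. (fst (snd p), fst p)) \<in> P \<rightarrow>\<^sub>M L \<Otimes>\<^sub>M I" "snd \<in> P \<rightarrow>\<^sub>M L \<Otimes>\<^sub>M I"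
    by measurable
  have g [measurable]: "(\<lambda>(x, u). (x, \<Gamma> (x, u))) \<in> L \<Otimes>\<^sub>M I \<rightarrow>\<^sub>M paths \<Otimes>\<^sub>M paths"
    by measurable
  have sol_V: "stationary_solution P (\<lambda>t p. fst (snd p) t) u f S V"
  proof (rule stationary_solution_joint_law[OF R \<xi> YM fs VW(1) _ sol])
    show "distr M (paths \<Otimes>\<^sub>M paths) (\<lambda>\<omega>. (\<lambda>t. \<xi> t \<omega>, \<lambda>t. Y t \<omega>))
      = distr P (paths \<Otimes>\<^sub>M paths) (\<lambda>\<omega>. (\<lambda>t. fst (snd \<omega>) t, \<lambda>t. V t \<omega>))"
    proof -
      have "distr (L \<Otimes>\<^sub>M I) (paths \<Otimes>\<^sub>M paths) (\<lambda>(x, u). (x, \<Gamma> (x, u)))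
        = distr (distr P (L \<Otimes>\<^sub>M I) snd) (paths \<Otimes>\<^sub>M paths) (\<lambda>(x, u). (x, \<Gamma> (x, u)))"
        by (simp only: law_V)
      also have "\<dots> = distr P (paths \<Otimes>\<^sub>M paths) ((\<lambda>(x, u). (x, \<Gamma> (x, u))) \<circ> snd)"
        by (rule distr_distr[OF g mP(2)])
      also have "(\<lambda>(x, u). (x, \<Gamma> (x, u))) \<circ> snd = (\<lambda>\<omega>. (\<lambda>t. fst (snd \<omega>) t, \<lambda>t. V t \<omega>))"
        by (simp add: fun_eq_iff V_def split_beta')
      finally show ?thesis unfolding joint .
    qed
  qed
  have sol_W: "stationary_solution P (\<lambda>t p. fst (snd p) t) u f S W"
  proof (rule stationary_solution_joint_law[OF R \<xi> YM fs VW(2) _ sol])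
    show "distr M (paths \<Otimes>\<^sub>M paths) (\<lambda>\<omega>. (\<lambda>t. \<xi> t \<omega>, \<lambda>t. Y t \<omega>))
      = distr P (paths \<Otimes>\<^sub>M paths) (\<lambda>\<omega>. (\<lambda>t. fst (snd \<omega>) t, \<lambda>t. W t \<omega>))"
    proof -
      have "distr (L \<Otimes>\<^sub>M I) (paths \<Otimes>\<^sub>M paths) (\<lambda>(x, u). (x, \<Gamma> (x, u)))
        = distr (distr P (L \<Otimes>\<^sub>M I) (\<lambda>p. (fst (snd p), fst p))) (paths \<Otimes>\<^sub>M paths) (\<lambda>(x, u). (x, \<Gamma> (x, u)))"
        by (simp only: law_W[symmetric])
      also have "\<dots> = distr P (paths \<Otimes>\<^sub>M paths) ((\<lambda>(x, u). (x, \<Gamma> (x, u))) \<circ> (\<lambda>p. (fst (snd p), fst p)))"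
        by (rule distr_distr[OF g mP(1)])
      also have "(\<lambda>(x, u). (x, \<Gamma> (x, u))) \<circ> (\<lambda>p. (fst (snd p), fst p)) = (\<lambda>\<omega>. (\<lambda>t. fst (snd \<omega>) t, \<lambda>t. W t \<omega>))"
        by (simp add: fun_eq_iff W_def split_beta')
      finally show ?thesis unfolding joint .
    qed
  qed
  have "path_law P (\<lambda>t p. fst (snd p) t) = distr P L (fst \<circ> snd)"
    unfolding path_law_def by (rule distr_cong) (simp_all add: sL)
  also have "\<dots> = distr (distr P (L \<Otimes>\<^sub>M I) snd) L fst"
    by (rule distr_distr[symmetric, OF _ mP(2)]) simp
  also have "\<dots> = path_law M \<xi>" unfolding law_V I.distr_pair_fst by (simp add: L_def)
  finally have "AE p in P. V t p = W t p" for t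
    by (intro unique_on_every_space[OF R uniq P.prob_space_axioms fs _ sol_V sol_W])
  then have "AE p in P. \<forall>t. V t p = W t p" by (intro AE_all_countable[THEN iffD2] allI)
  then have "AE p in P. \<Gamma> (snd p) = \<Gamma> (fst (snd p), fst p)"
    by (rule AE_mp) (simp add: V_def W_def fun_eq_iff)
  then have "AE b in I. AE p in L \<Otimes>\<^sub>M I. \<Gamma> p = \<Gamma> (fst p, b)"
    unfolding P_def by (drule_tac ILI.AE_pair) (simp only: fst_conv snd_conv)
  from eventually_happens'[OF I.ae_filter_bot this]
  obtain b where b: "AE p in L \<Otimes>\<^sub>M I. \<Gamma> p = \<Gamma> (fst p, b)" ..
  define H where "H z = \<Gamma> (z, b)" for z
  have H [measurable]: "H \<in> paths \<rightarrow>\<^sub>M paths" unfolding H_def by measurable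
  have Ht: "(\<lambda>z. H z t) \<in> borel_measurable paths" for t by (rule measurable_compose[OF H c])
  have "AE \<omega> in M. \<forall>t. Y t \<omega> = H (\<lambda>t. \<xi> t \<omega>) t"
  proof (rule AE_all_countable[THEN iffD2], rule allI)
    fix t
    have "(\<lambda>p. snd p t) \<in> borel_measurable (paths \<Otimes>\<^sub>M paths)"
      by (rule measurable_compose[OF measurable_snd c])
    moreover have "(\<lambda>p. H (fst p) t) \<in> borel_measurable (paths \<Otimes>\<^sub>M paths)"
      by (rule measurable_compose[OF measurable_fst Ht])
    ultimately have meas: "{p \<in> space (paths \<Otimes>\<^sub>M paths). snd p t = H (fst p) t} \<in> sets (paths \<Otimes>\<^sub>M paths)"
      by (rule borel_measurable_eq)
    have "AE p in L \<Otimes>\<^sub>M I. \<Gamma> p t = H (fst p) t"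
      using b by (rule AE_mp) (simp add: H_def)
    moreover have "(AE \<omega> in M. Y t \<omega> = H (\<lambda>t. \<xi> t \<omega>) t)
      \<longleftrightarrow> (AE p in distr M (paths \<Otimes>\<^sub>M paths) (\<lambda>\<omega>. (\<lambda>t. \<xi> t \<omega>, \<lambda>t. Y t \<omega>)). snd p t = H (fst p) t)"
      by (subst AE_distr_iff[OF measurable_Pair[OF \<xi>p Yp] meas]) simp
    moreover have "(AE p in distr M (paths \<Otimes>\<^sub>M paths) (\<lambda>\<omega>. (\<lambda>t. \<xi> t \<omega>, \<lambda>t. Y t \<omega>)). snd p t = H (fst p) t)
      \<longleftrightarrow> (AE p in L \<Otimes>\<^sub>M I. \<Gamma> p t = H (fst p) t)"
      unfolding joint by (subst AE_distr_iff[OF g meas]) (simp add: split_beta')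
    ultimately show "AE \<omega> in M. Y t \<omega> = H (\<lambda>t. \<xi> t \<omega>) t"
      by blast
  qed
  then have "AE \<omega> in M. (\<lambda>t. Y t \<omega>) = H (\<lambda>t. \<xi> t \<omega>)"
    by (rule AE_mp) (simp add: fun_eq_iff)
  with H show ?thesis by blast
qed

text \<open>
Applying the functional to the noise shifted by \<open>k\<close> and shifting the result back gives another
stationary solution for the original noise. By uniqueness it is the original one, so the value at
time \<open>k\<close> is the value at time \<open>0\<close> computed from the shifted noise.
\<close>

lemma solution_stationary_functional:
  assumes R: "recursion_graph u f S \<in> sets borel"
    and M: "prob_space M" and \<xi> [measurable]: "\<And>t. \<xi> t \<in> borel_measurable M"
    and stat: "strictly_stationary M \<xi>"
    and uniq: "unique_stationary_solution M \<xi> u f S Y"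
  shows "\<exists>H \<in> borel_measurable paths. \<forall>t. AE \<omega> in M. Y t \<omega> = H (shift t (\<lambda>s. \<xi> s \<omega>))"
proof -
  obtain H where H [measurable]: "H \<in> paths \<rightarrow>\<^sub>M paths"
    and YH: "AE \<omega> in M. (\<lambda>t. Y t \<omega>) = H (\<lambda>t. \<xi> t \<omega>)"
    using solution_functional_of_noise[OF R M \<xi> uniq] by blast
  have sol: "stationary_solution M \<xi> u f S Y" using uniq by (simp add: unique_stationary_solution_def)
  then have Y [measurable]: "Y t \<in> borel_measurable M" for t by (simp add: stationary_solution_def)
  have \<xi>p [measurable]: "(\<lambda>\<omega> t. \<xi> t \<omega>) \<in> M \<rightarrow>\<^sub>M paths" and Yp [measurable]: "(\<lambda>\<omega> t. Y t \<omega>) \<in> M \<rightarrow>\<^sub>M paths"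
    by (auto intro!: path_measurable)
  have c [measurable]: "(\<lambda>p. p t) \<in> borel_measurable paths" for t :: int by measurable
  have Ht [measurable]: "(\<lambda>z. H z t) \<in> borel_measurable paths" for t by (rule measurable_compose[OF H c])
  have sLk: "distr (path_law M \<xi>) paths (shift k) = path_law M \<xi>" for k
    using stat by (simp add: strictly_stationary_iff)
  have key: "AE \<omega> in M. Y k \<omega> = H (shift k (\<lambda>s. \<xi> s \<omega>)) 0" for k
  proof -
    \<comment> \<open>The solution for the noise shifted by \<open>k\<close>, shifted back.\<close>
    define W where "W t \<omega> = H (shift k (\<lambda>s. \<xi> s \<omega>)) (t - k)" for t \<omega>
    have W [measurable]: "W t \<in> borel_measurable M" for t
      unfolding W_def[abs_def] by measurable
    have "distr M (paths \<Otimes>\<^sub>M paths) (\<lambda>\<omega>. (\<lambda>t. \<xi> t \<omega>, \<lambda>t. Y t \<omega>))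
      = distr M (paths \<Otimes>\<^sub>M paths) (\<lambda>\<omega>. (\<lambda>t. \<xi> t \<omega>, H (\<lambda>t. \<xi> t \<omega>)))"
      by (rule distr_cong_AE) (use YH in \<open>auto elim!: eventually_mono\<close>)
    also have "\<dots> = distr (path_law M \<xi>) (paths \<Otimes>\<^sub>M paths) (\<lambda>z. (z, H z))"
      unfolding path_law_def by (subst distr_distr) (auto simp: comp_def)
    also have "\<dots> = distr M (paths \<Otimes>\<^sub>M paths) (\<lambda>\<omega>. (shift k (\<lambda>t. \<xi> t \<omega>), H (shift k (\<lambda>t. \<xi> t \<omega>))))"
      by (subst sLk[of k, symmetric]) (simp add: path_law_def distr_distr comp_def)
    finally have 1: "distr M (paths \<Otimes>\<^sub>M paths) (\<lambda>\<omega>. (\<lambda>t. \<xi> t \<omega>, \<lambda>t. Y t \<omega>))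
      = distr M (paths \<Otimes>\<^sub>M paths) (\<lambda>\<omega>. (shift k (\<lambda>t. \<xi> t \<omega>), H (shift k (\<lambda>t. \<xi> t \<omega>))))" .
    have sol': "stationary_solution M (\<lambda>t. \<xi> (t + k)) u f S (\<lambda>t. W (t + k))"
      by (rule stationary_solution_joint_law[OF R _ _ _ _ _ sol])
         (auto simp: 1 W_def shift_def)
    have "stationary_solution M \<xi> u f S W"
    proof -
      have "AE \<omega> in M. W (s + k) \<omega> \<in> S"
        "AE \<omega> in M. u (W (s + 1 + k) \<omega>) = f (u (W (s + k) \<omega>)) (\<xi> (s + k) \<omega>)" for s
        using sol' by (auto simp: stationary_solution_def)
      from this(1)[of "t - k" for t] this(2)[of "t - k" for t] have "AE \<omega> in M. W t \<omega> \<in> S"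
        "AE \<omega> in M. u (W (t + 1) \<omega>) = f (u (W t \<omega>)) (\<xi> t \<omega>)" for t
        by (simp_all add: diff_add_eq)
      moreover have "path_law M (\<lambda>t. W (t + j)) = path_law M W" for j
      proof -
        have "path_law M (\<lambda>t. W (t + i + k)) = path_law M (\<lambda>t. W (t + k))" for i
          using sol' unfolding stationary_solution_def strictly_stationary_def by blast
        from this[of "j - k"] this[of "- k"] show ?thesis by (simp add: algebra_simps)
      qed
      ultimately show ?thesis using W by (auto simp: stationary_solution_def strictly_stationary_def)
    qed
    from unique_on_every_space[OF R uniq M \<xi> refl sol this, of k]
    show ?thesis by (simp add: W_def)
  qed
  then show ?thesis by (intro bexI[of _ "\<lambda>z. H z 0"]) auto
qed

section \<open>Ergodicity of the Bernoulli shift\<close>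

text \<open>
The sets \<open>A\<close> with the asserted limit form a Dynkin system. For disjoint unions the limit and the sum
are exchanged with the dominating series \<open>\<Sum>i. prob (A i)\<close>.
\<close>

lemma (in prob_space) asymptotic_independence_sigma:
  assumes G: "Int_stable G" "G \<subseteq> Pow (space M)" "sets M = sigma_sets (space M) G"
    and C: "\<And>n. C n \<in> events" "(\<lambda>n. prob (C n)) \<longlonglongrightarrow> c"
    and basic: "\<And>A. A \<in> G \<Longrightarrow> (\<lambda>n. prob (A \<inter> C n)) \<longlonglongrightarrow> prob A * c"
    and A: "A \<in> events"
  shows "(\<lambda>n. prob (A \<inter> C n)) \<longlonglongrightarrow> prob A * c"
proof -
  from A have "A \<in> sigma_sets (space M) G" by (simp add: G(3))
  from G(1,2) this show ?thesis
  proof (induction rule: sigma_sets_induct_disjoint)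
    case (basic A)
    then show ?case by (rule assms(6))
  next
    case empty
    show ?case by simp
  next
    case (compl A)
    then have [measurable]: "A \<in> events" by (simp add: G(3))
    have "prob ((space M - A) \<inter> C n) = prob (C n) - prob (A \<inter> C n)" for n
    proof -
      have "(space M - A) \<inter> C n = C n - A" using sets.sets_into_space[OF C(1)] by auto
      then show ?thesis using finite_measure_Diff'[of "C n" A] C(1) by (simp add: Int_commute)
    qed
    moreover have "(\<lambda>n. prob (C n) - prob (A \<inter> C n)) \<longlonglongrightarrow> c - prob A * c"
      by (intro tendsto_diff C(2) compl)
    moreover have "prob (space M - A) * c = c - prob A * c"
      by (simp add: prob_compl algebra_simps)
    ultimately show ?case by simp
  next
    case (union A)
    then have ev: "range A \<subseteq> events" "A i \<in> events" for i by (auto simp: G(3))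
    have sum: "(\<lambda>i. prob (A i)) sums prob (\<Union>i. A i)"
      by (rule finite_measure_UNION[OF ev(1) union(1)])
    have sumC: "(\<lambda>i. prob (A i \<inter> C n)) sums prob ((\<Union>i. A i) \<inter> C n)" for n
    proof -
      have "(\<lambda>i. prob (A i \<inter> C n)) sums prob (\<Union>i. A i \<inter> C n)"
        using ev C(1) union(1) by (intro finite_measure_UNION) (auto simp: disjoint_family_on_def, blast)
      then show ?thesis by (simp add: UN_simps)
    qed
    have "(\<lambda>n. \<Sum>i. prob (A i \<inter> C n)) \<longlonglongrightarrow> (\<Sum>i. prob (A i) * c)"
    proof (rule tannerys_theorem[THEN conjunct2, THEN conjunct2])
      show "\<forall>\<^sub>F (k, n) in sequentially \<times>\<^sub>F sequentially. norm (prob (A k \<inter> C n)) \<le> prob (A k)"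
        using ev C(1) by (auto intro!: always_eventually finite_measure_mono)
    qed (use union sums_summable[OF sum] in auto)
    moreover have "(\<Sum>i. prob (A i) * c) = prob (\<Union>i. A i) * c"
      using sums_unique[OF sums_mult2[OF sum]] by simp
    ultimately show ?case using sums_unique[OF sumC] by simp
  qed
qed

context
  fixes \<nu> :: "real measure"
  assumes \<nu>: "prob_space \<nu>" "sets \<nu> = sets borel"
begin

abbreviation "iid \<equiv> \<Pi>\<^sub>M t\<in>(UNIV :: int set). \<nu>"

lemma sets_iid: "sets iid = sets paths"
  by (intro sets_PiM_cong refl \<nu>)

lemma space_iid [simp]: "space iid = UNIV"
  using sets_eq_imp_space_eq[OF sets_iid] by simp

lemma prob_space_iid: "prob_space iid"
  by (intro prob_space_PiM \<nu>)

lemma shift_iid: "shift k \<in> iid \<rightarrow>\<^sub>M iid"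
  using shift_measurable sets_iid by (simp cong: measurable_cong_sets)

lemma distr_shift_iid: "distr iid iid (shift k) = iid"
proof -
  have "distr iid iid (\<lambda>\<omega>. \<lambda>n\<in>UNIV. \<omega> (n + k)) = iid"
    by (rule distr_PiM_reindex) (auto intro: \<nu> simp: inj_on_def)
  then show ?thesis by (simp add: shift_def[abs_def] restrict_def)
qed

lemma measure_iid_cylinder:
  assumes "finite J" "\<And>j. j \<in> J \<Longrightarrow> E j \<in> sets borel"
  shows "measure iid {z. \<forall>j\<in>J. z j \<in> E j} = (\<Prod>j\<in>J. measure \<nu> (E j))"
proof -
  interpret product_prob_space "\<lambda>_::int. \<nu>" UNIV
    using \<nu> by (simp add: product_prob_space_def product_prob_space_axioms_def product_sigma_finite_def prob_space_imp_sigma_finite)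
  have "emeasure iid {z\<in>space iid. \<forall>j\<in>J. z j \<in> E j} = (\<Prod>j\<in>J. emeasure \<nu> (E j))"
    by (rule emeasure_PiM_Collect) (use assms \<nu> in auto)
  then show ?thesis
    unfolding emeasure_eq_measure M.emeasure_eq_measure
    by (simp add: prod_ennreal measure_nonneg prod_nonneg)
qed

text \<open>
For large \<open>n\<close> the two cylinders depend on disjoint sets of coordinates, so the equality is exact.
\<close>

lemma cylinder_mixing:
  assumes "finite J" "\<And>j. j \<in> J \<Longrightarrow> E j \<in> sets borel"
    and "finite K" "\<And>j. j \<in> K \<Longrightarrow> F j \<in> sets borel"
  shows "(\<lambda>n. measure iid ({z. \<forall>j\<in>J. z j \<in> E j} \<inter> shift (int n) -` {z. \<forall>j\<in>K. z j \<in> F j}))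
    \<longlonglongrightarrow> measure iid {z. \<forall>j\<in>J. z j \<in> E j} * measure iid {z. \<forall>j\<in>K. z j \<in> F j}"
proof (rule tendsto_eventually)
  obtain b where b: "\<And>j. j \<in> J \<union> K \<Longrightarrow> \<bar>j\<bar> \<le> b"
  proof -
    assume r: "\<And>b. (\<And>j. j \<in> J \<union> K \<Longrightarrow> \<bar>j\<bar> \<le> b) \<Longrightarrow> thesis"
    show thesis
      by (rule r[of "\<Sum>j\<in>J\<union>K. \<bar>j\<bar>"]) (use assms in \<open>auto intro!: member_le_sum\<close>)
  qed
  show "\<forall>\<^sub>F n in sequentially. measure iid ({z. \<forall>j\<in>J. z j \<in> E j} \<inter> shift (int n) -` {z. \<forall>j\<in>K. z j \<in> F j})
    = measure iid {z. \<forall>j\<in>J. z j \<in> E j} * measure iid {z. \<forall>j\<in>K. z j \<in> F j}"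
    unfolding eventually_sequentially
  proof (intro exI allI impI)
    fix n assume n: "nat (2 * b + 1) \<le> n"
    define K' where "K' = (\<lambda>j. j + int n) ` K"
    have disj: "J \<inter> K' = {}"
    proof -
      have False if "j \<in> J" "k \<in> K" "j = k + int n" for j k
        using b[of j] b[of k] that n by auto
      then show ?thesis unfolding K'_def by auto
    qed
    define E' where "E' j = (if j \<in> J then E j else F (j - int n))" for j
    have E'J: "E' j = E j" if "j \<in> J" for j using that by (simp add: E'_def)
    have E'K: "E' (j + int n) = F j" if "j \<in> K" for j using that disj by (auto simp: E'_def K'_def)
    have "{z. \<forall>j\<in>J. z j \<in> E j} \<inter> shift (int n) -` {z. \<forall>j\<in>K. z j \<in> F j} = {z. \<forall>j\<in>J\<union>K'. z j \<in> E' j}"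
      by (auto simp: shift_def E'J E'K ball_Un ball_simps K'_def)
    also have "measure iid \<dots> = (\<Prod>j\<in>J\<union>K'. measure \<nu> (E' j))"
      using assms by (intro measure_iid_cylinder) (auto simp: K'_def E'_def)
    also have "\<dots> = (\<Prod>j\<in>J. measure \<nu> (E' j)) * (\<Prod>j\<in>K'. measure \<nu> (E' j))"
      using disj assms by (intro prod.union_disjoint) (auto simp: K'_def)
    also have "(\<Prod>j\<in>J. measure \<nu> (E' j)) = (\<Prod>j\<in>J. measure \<nu> (E j))"
      by (intro prod.cong) (auto simp: E'_def)
    also have "(\<Prod>j\<in>K'. measure \<nu> (E' j)) = (\<Prod>j\<in>K. measure \<nu> (F j))"
      unfolding K'_def by (subst prod.reindex) (auto simp: E'K inj_on_def intro!: prod.cong)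
    finally show "measure iid ({z. \<forall>j\<in>J. z j \<in> E j} \<inter> shift (int n) -` {z. \<forall>j\<in>K. z j \<in> F j})
      = measure iid {z. \<forall>j\<in>J. z j \<in> E j} * measure iid {z. \<forall>j\<in>K. z j \<in> F j}"
      using assms by (simp add: measure_iid_cylinder)
  qed
qed

text \<open>
The Dynkin argument is used twice: first \<open>B\<close> is a cylinder and \<open>A\<close> becomes arbitrary, then, after
the shift has been moved to the other set by invariance, \<open>B\<close> becomes arbitrary.
\<close>

lemma shift_mixing:
  assumes A: "A \<in> sets iid" and B: "B \<in> sets iid"
  shows "(\<lambda>n. measure iid (A \<inter> shift (int n) -` B)) \<longlonglongrightarrow> measure iid A * measure iid B"
proof -
  interpret prob_space iid by (rule prob_space_iid)
  define G where "G = prod_algebra (UNIV :: int set) (\<lambda>_. \<nu>)"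
  have sp\<nu>: "space \<nu> = UNIV" using sets_eq_imp_space_eq[OF \<nu>(2)] by simp
  have G: "Int_stable G" "G \<subseteq> Pow (space iid)" "sets iid = sigma_sets (space iid) G"
    unfolding G_def by (auto simp: Int_stable_prod_algebra sets_PiM sp\<nu>)
  have cyl: "\<exists>J E. finite J \<and> (\<forall>j\<in>J. E j \<in> sets borel) \<and> A = {z. \<forall>j\<in>J. z j \<in> E j}" if A: "A \<in> G" for A
  proof -
    from A[unfolded G_def] obtain J E where J: "A = prod_emb UNIV (\<lambda>_. \<nu>) J (\<Pi>\<^sub>E j\<in>J. E j)"
      "finite J" "\<And>i. i \<in> J \<Longrightarrow> E i \<in> sets \<nu>"
      by (rule prod_algebraE) auto
    then have "A = {z. \<forall>j\<in>J. z j \<in> E j}"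
      by (auto simp: prod_emb_def sp\<nu> PiE_iff)
    with J \<nu>(2) show ?thesis by (intro exI[of _ J] exI[of _ E]) simp
  qed
  have pres: "prob (shift k -` B) = prob B" "shift k -` B \<in> events" if "B \<in> events" for k B
  proof -
    show "shift k -` B \<in> events" using measurable_sets[OF shift_iid that, of k] by simp
    have "prob B = measure (distr iid iid (shift k)) B" by (simp add: distr_shift_iid)
    also have "\<dots> = prob (shift k -` B)" using measure_distr[OF shift_iid that, of k] by simp
    finally show "prob (shift k -` B) = prob B" ..
  qed
  have GE: "A \<in> events" if "A \<in> G" for A using that by (simp add: G(3) sigma_sets.Basic)
  have half: "(\<lambda>n. prob (A \<inter> shift (int n) -` B)) \<longlonglongrightarrow> prob A * prob B" if A: "A \<in> events" and B: "B \<in> G" for A B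
  proof (rule asymptotic_independence_sigma[OF G _ _ _ A])
    show "(\<lambda>n. prob (A \<inter> shift (int n) -` B)) \<longlonglongrightarrow> prob A * prob B" if "A \<in> G" for A
    proof -
      from cyl[OF that] obtain J E
        where "finite J" "\<forall>j\<in>J. E j \<in> sets borel" "A = {z. \<forall>j\<in>J. z j \<in> E j}" by (elim exE conjE)
      moreover from cyl[OF B] obtain K F
        where "finite K" "\<forall>j\<in>K. F j \<in> sets borel" "B = {z. \<forall>j\<in>K. z j \<in> F j}" by (elim exE conjE)
      ultimately show ?thesis using cylinder_mixing[of J E K F] by simp
    qed
  qed (use pres GE[OF B] in auto)
  \<comment> \<open>Invariance of the measure moves the shift from one set to the other.\<close>
  have flip: "prob (shift (- int n) -` A \<inter> B) = prob (A \<inter> shift (int n) -` B)" if "A \<in> events" "B \<in> events" for A B n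
  proof -
    have "shift (int n) -` (shift (- int n) -` A \<inter> B) = A \<inter> shift (int n) -` B" by auto
    then show ?thesis using pres[of "shift (- int n) -` A \<inter> B" "int n"] pres that by (metis sets.Int)
  qed
  have "(\<lambda>n. prob (B \<inter> shift (- int n) -` A)) \<longlonglongrightarrow> prob B * prob A"
  proof (rule asymptotic_independence_sigma[OF G _ _ _ B])
    show "(\<lambda>n. prob (B \<inter> shift (- int n) -` A)) \<longlonglongrightarrow> prob B * prob A" if "B \<in> G" for B
      using half[OF A that] flip[OF A GE[OF that]] by (simp add: Int_commute mult.commute)
  qed (use pres A in auto)
  then show ?thesis using flip[OF A B] by (simp add: Int_commute mult.commute)
qed

text \<open>
Mixing of an invariant set with itself gives \<open>p = p\<^sup>2\<close>.
\<close>

lemma shift_zero_one: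
  assumes A: "A \<in> sets iid" and inv: "shift 1 -` A = A"
  shows "measure iid A = 0 \<or> measure iid A = 1"
proof -
  have "shift (int n) -` A = A" for n
  proof (induction n)
    case (Suc n)
    have "shift (int (Suc n)) -` A = shift 1 -` (shift (int n) -` A)" by (auto simp: add.commute)
    then show ?case using Suc inv by simp
  qed simp
  then have "(\<lambda>n. measure iid A) \<longlonglongrightarrow> measure iid A * measure iid A"
    using shift_mixing[OF A A] by simp
  then have "measure iid A * 1 = measure iid A * measure iid A"
    by (simp add: LIMSEQ_const_iff)
  then show ?thesis by simp
qed

end

text \<open>
The maximum of \<open>\<Sum>k<j. f ((T ^^ k) x)\<close> over \<open>j \<le> n\<close>. The recursion splits off the first summand,
which is the identity that the maximal ergodic inequality rests on.
\<close>

primrec max_birkhoff_sum :: "('b \<Rightarrow> 'b) \<Rightarrow> ('b \<Rightarrow> real) \<Rightarrow> nat \<Rightarrow> 'b \<Rightarrow> real" where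
  "max_birkhoff_sum T f 0 x = 0"
| "max_birkhoff_sum T f (Suc n) x = max 0 (f x + max_birkhoff_sum T f n (T x))"

text \<open>
Where the maximum \<open>m (Suc n)\<close> is positive, \<open>f\<close> is at least \<open>m (Suc n) - m (Suc n) \<circ> T\<close>; elsewhere this
difference is not positive. It has mean zero because \<open>T\<close> preserves the measure.
\<close>

lemma (in prob_space) maximal_ergodic:
  fixes f :: "'a \<Rightarrow> real"
  assumes T: "T \<in> M \<rightarrow>\<^sub>M M" "distr M M T = M" and f: "integrable M f"
    and pos: "AE x in M. \<exists>n. 0 < (\<Sum>k<n. f ((T ^^ k) x))"
  shows "0 \<le> integral\<^sup>L M f"
proof -
  define m where "m = max_birkhoff_sum T f"
  note [measurable] = T(1) borel_measurable_integrable[OF f]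
  have comp: "integrable M (\<lambda>x. g (T x))" "integral\<^sup>L M (\<lambda>x. g (T x)) = integral\<^sup>L M g"
    if g: "integrable M g" for g :: "'a \<Rightarrow> real"
    using integrable_distr[OF T(1), of g] integral_distr[OF T(1), of g] g by (simp_all add: T(2))
  have int: "integrable M (m n)" for n
  proof (induction n)
    case (Suc n)
    have "m (Suc n) = (\<lambda>x. max 0 (f x + m n (T x)))" by (simp add: m_def fun_eq_iff)
    with f comp(1)[OF Suc] show ?case by simp
  qed (simp add: m_def)
  note [measurable] = borel_measurable_integrable[OF int]
  have nn: "0 \<le> m n x" for n x by (cases n) (auto simp: m_def)
  have mono: "m n x \<le> m (Suc n) x" for n x
  proof (induction n arbitrary: x)
    case (Suc n)
    from this[of "T x"] show ?case unfolding m_def max_birkhoff_sum.simps by linarith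
  qed (simp add: m_def)
  have sum_le: "(\<Sum>k<n. f ((T ^^ k) x)) \<le> m n x" for n x
  proof (induction n arbitrary: x)
    case (Suc n)
    have "(\<Sum>k<Suc n. f ((T ^^ k) x)) = f x + (\<Sum>k<n. f ((T ^^ k) (T x)))"
      by (subst sum.lessThan_Suc_shift) (simp add: funpow_swap1)
    also have "\<dots> \<le> m (Suc n) x" using Suc[of "T x"] by (simp add: m_def)
    finally show ?case .
  qed (simp add: m_def)
  have step: "0 \<le> (\<integral>x. f x * indicator {x\<in>space M. 0 < m (Suc n) x} x \<partial>M)" for n
  proof -
    have "m (Suc n) x - m (Suc n) (T x) \<le> f x * indicator {x\<in>space M. 0 < m (Suc n) x} x" if "x \<in> space M" for x
      using mono[of n "T x"] nn[of "Suc n" x] nn[of "Suc n" "T x"] that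
      by (auto simp: m_def split: split_indicator)
    then have "(\<integral>x. m (Suc n) x - m (Suc n) (T x) \<partial>M) \<le> (\<integral>x. f x * indicator {x\<in>space M. 0 < m (Suc n) x} x \<partial>M)"
      by (intro integral_mono Bochner_Integration.integrable_diff int comp integrable_real_mult_indicator f) auto
    moreover have "(\<integral>x. m (Suc n) x - m (Suc n) (T x) \<partial>M) = 0"
      using comp[OF int[of "Suc n"]] int[of "Suc n"] by simp
    ultimately show ?thesis by simp
  qed
  have lim: "(\<lambda>n. \<integral>x. f x * indicator {x\<in>space M. 0 < m (Suc n) x} x \<partial>M) \<longlonglongrightarrow> integral\<^sup>L M f"
  proof (rule integral_dominated_convergence[where w = "\<lambda>x. \<bar>f x\<bar>"])
    show "AE x in M. (\<lambda>n. f x * indicator {x\<in>space M. 0 < m (Suc n) x} x) \<longlonglongrightarrow> f x"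
      using pos AE_space
    proof eventually_elim
      case (elim x)
      then obtain n where "0 < m n x" using sum_le order_less_le_trans by blast
      moreover have "incseq (\<lambda>n. m n x)" using mono by (rule incseq_SucI)
      ultimately have "0 < m (Suc k) x" if "n \<le> k" for k
        using that incseqD[of "\<lambda>n. m n x" n "Suc k"] by simp
      then have "\<forall>\<^sub>F k in sequentially. f x * indicator {x\<in>space M. 0 < m (Suc k) x} x = f x"
        unfolding eventually_sequentially using elim(2) by (intro exI[of _ n]) auto
      then show ?case by (rule tendsto_eventually)
    qed
  qed (use f in \<open>auto split: split_indicator\<close>)
  show ?thesis by (rule LIMSEQ_le_const[OF lim]) (use step in auto)
qed

text \<open>
After subtraction of half its mean, \<open>w\<close> still has positive mean. The event that the partial sums are
unbounded below is invariant. If it had probability one, the maximal inequality for the negated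
function would contradict the positive mean. So the centred sums are bounded below, and the
subtracted constant contributes a positive linear term.
\<close>

lemma iid_positive_drift:
  fixes w :: "(int \<Rightarrow> real) \<Rightarrow> real"
  assumes \<nu>: "prob_space \<nu>" "sets \<nu> = sets (borel :: real measure)"
    and w: "integrable (iid \<nu>) w" and pos: "0 < integral\<^sup>L (iid \<nu>) w"
  shows "AE z in iid \<nu>. filterlim (\<lambda>n. \<Sum>k<n. w (shift (int k) z)) at_top sequentially"
proof -
  interpret prob_space "iid \<nu>" by (rule prob_space_iid[OF \<nu>])
  have [measurable_cong]: "sets (iid \<nu>) = sets paths" by (rule sets_iid[OF \<nu>])
  note [measurable] = borel_measurable_integrable[OF w]
  define c where "c = integral\<^sup>L (iid \<nu>) w / 2"
  define f where "f z = w z - c" for z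
  have f: "integrable (iid \<nu>) f" "integral\<^sup>L (iid \<nu>) f = c"
  proof -
    show "integrable (iid \<nu>) f" unfolding f_def[abs_def] using w by simp
    have "integral\<^sup>L (iid \<nu>) f = integral\<^sup>L (iid \<nu>) w - c"
      unfolding f_def[abs_def] using w by (subst Bochner_Integration.integral_diff) (auto simp: prob_space)
    then show "integral\<^sup>L (iid \<nu>) f = c" by (simp add: c_def)
  qed
  have pow: "(shift 1 ^^ k) z = shift (int k) z" for k z
    by (induction k) (auto simp: add.commute)
  define S where "S n z = (\<Sum>k<n. f (shift (int k) z))" for n z
  have [measurable]: "f \<in> borel_measurable paths"
    using borel_measurable_integrable[OF f(1)] by (simp cong: measurable_cong_sets)
  have S [measurable]: "S n \<in> borel_measurable paths" for n
    unfolding S_def[abs_def] by measurable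
  \<comment> \<open>Dropping the first summand changes every partial sum by the same amount, so \<open>A\<close> is invariant.\<close>
  define A where "A = {z. \<forall>K::nat. \<exists>n. S n z < - real K}"
  have "A = {z\<in>space paths. \<forall>K::nat. \<exists>n. S n z < - real K}" by (simp add: A_def)
  also have "\<dots> \<in> sets paths" by measurable
  finally have A: "A \<in> sets (iid \<nu>)" by (simp add: sets_iid[OF \<nu>])
  have S_shift: "S (Suc n) z = f z + S n (shift 1 z)" for n z
    unfolding S_def by (subst sum.lessThan_Suc_shift) (simp add: add.commute)
  have "shift 1 z \<in> A \<longleftrightarrow> z \<in> A" for z
  proof
    assume z: "shift 1 z \<in> A"
    show "z \<in> A" unfolding A_def
    proof safe
      fix K :: nat
      obtain K' :: nat where K': "real K + \<bar>f z\<bar> \<le> real K'" using real_arch_simple by blast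
      from z obtain n where "S n (shift 1 z) < - real K'" by (auto simp: A_def)
      with K' S_shift[of n z] show "\<exists>n. S n z < - real K" by (intro exI[of _ "Suc n"]) linarith
    qed
  next
    assume z: "z \<in> A"
    show "shift 1 z \<in> A" unfolding A_def
    proof safe
      fix K :: nat
      obtain K' :: nat where K': "real K + \<bar>f z\<bar> \<le> real K'" using real_arch_simple by blast
      from z obtain n where n: "S n z < - real K'" by (auto simp: A_def)
      then obtain k where k: "n = Suc k" by (cases n) (auto simp: S_def)
      show "\<exists>n. S n (shift 1 z) < - real K"
        using K' S_shift[of k z] n[unfolded k] by (intro exI[of _ k]) linarith
    qed
  qed
  then have "prob A = 0 \<or> prob A = 1"
    by (intro shift_zero_one[OF \<nu> A]) auto
  moreover have "prob A \<noteq> 1"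
  proof
    assume "prob A = 1"
    then have "AE z in iid \<nu>. z \<in> A" using A by (simp add: AE_prob_1)
    then have "AE z in iid \<nu>. \<exists>n. 0 < (\<Sum>k<n. - f ((shift 1 ^^ k) z))"
    proof (rule AE_mp, intro AE_I2 impI)
      fix z assume "z \<in> A"
      then obtain n where "S n z < - real 0" unfolding A_def by blast
      then show "\<exists>n. 0 < (\<Sum>k<n. - f ((shift 1 ^^ k) z))"
        by (intro exI[of _ n]) (simp add: S_def pow sum_negf)
    qed
    then have "0 \<le> integral\<^sup>L (iid \<nu>) (\<lambda>z. - f z)"
      by (intro maximal_ergodic[OF shift_iid[OF \<nu>] distr_shift_iid[OF \<nu>]] Bochner_Integration.integrable_minus f)
    then show False using f pos by (simp add: c_def)
  qed
  ultimately have "AE z in iid \<nu>. z \<notin> A"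
    using A by (simp add: prob_eq_0)
  then show ?thesis
  proof (rule AE_mp, intro AE_I2 impI)
    fix z assume "z \<notin> A"
    then obtain K :: nat where K: "\<And>n. - real K \<le> S n z" unfolding A_def by (auto simp: not_less)
    have "(\<Sum>k<n. w (shift (int k) z)) = S n z + real n * c" for n
      by (simp add: S_def f_def sum_subtractf)
    then have le: "- real K + real n * c \<le> (\<Sum>k<n. w (shift (int k) z))" for n using K[of n] by simp
    have c: "0 < c" using pos by (simp add: c_def)
    have "filterlim (\<lambda>n. - real K + real n * c) at_top sequentially"
      by (intro filterlim_tendsto_add_at_top[OF tendsto_const] filterlim_at_top_mult_tendsto_pos[OF tendsto_const c] filterlim_real_sequentially)
    then show "filterlim (\<lambda>n. \<Sum>k<n. w (shift (int k) z)) at_top sequentially"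
      by (rule filterlim_at_top_mono) (use le in \<open>auto intro!: always_eventually\<close>)
  qed
qed

section \<open>Functionals of the noise\<close>

lemma (in prob_space) path_law_iid:
  assumes indep: "indep_vars (\<lambda>_. borel) Z UNIV"
    and ident: "\<And>t. distr M borel (Z t) = distr M borel (Z (0::int))"
  shows "path_law M Z = iid (distr M borel (Z 0))"
proof -
  have rv: "random_variable borel (Z i)" for i using indep by (simp add: indep_vars_def)
  have "distr M paths (\<lambda>x. \<lambda>i\<in>UNIV. Z i x) = (\<Pi>\<^sub>M i\<in>UNIV. distr M borel (Z i))"
    by (rule indep_vars_iff_distr_eq_PiM'[THEN iffD1, OF _ rv indep]) simp
  also have "\<dots> = iid (distr M borel (Z 0))" by (intro PiM_cong refl ident)
  finally show ?thesis by (simp add: path_law_def restrict_def)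
qed

lemma path_law_factor:
  assumes [measurable]: "\<And>t. \<xi> t \<in> borel_measurable M" "\<And>t. Y t \<in> borel_measurable M" "F \<in> borel_measurable paths"
    and F: "\<And>t. AE \<omega> in M. Y t \<omega> = F (shift t (\<lambda>s. \<xi> s \<omega>))"
  shows "path_law M Y = distr (path_law M \<xi>) paths (\<lambda>z t. F (shift t z))"
proof -
  have [measurable]: "(\<lambda>\<omega> s. \<xi> s \<omega>) \<in> M \<rightarrow>\<^sub>M paths" by (rule path_measurable) measurable
  have [measurable]: "(\<lambda>z t. F (shift t z)) \<in> paths \<rightarrow>\<^sub>M paths" by (rule path_measurable) measurable
  have "AE \<omega> in M. \<forall>t. Y t \<omega> = F (shift t (\<lambda>s. \<xi> s \<omega>))"
    by (intro AE_all_countable[THEN iffD2] allI F)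
  then have "AE \<omega> in M. (\<lambda>t. Y t \<omega>) = (\<lambda>t. F (shift t (\<lambda>s. \<xi> s \<omega>)))"
    by (rule AE_mp) (simp add: fun_eq_iff)
  then have "path_law M Y = distr M paths (\<lambda>\<omega> t. F (shift t (\<lambda>s. \<xi> s \<omega>)))"
    unfolding path_law_def by (intro distr_cong_AE path_measurable) auto
  also have "\<dots> = distr (path_law M \<xi>) paths (\<lambda>z t. F (shift t z))"
    unfolding path_law_def by (subst distr_distr) (auto simp: comp_def)
  finally show ?thesis .
qed

lemma strictly_stationary_factor:
  assumes meas: "\<And>t. \<xi> t \<in> borel_measurable M" "\<And>t. Y t \<in> borel_measurable M" "F \<in> borel_measurable paths"
    and st: "strictly_stationary M \<xi>"
    and F: "\<And>t. AE \<omega> in M. Y t \<omega> = F (shift t (\<lambda>s. \<xi> s \<omega>))"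
  shows "strictly_stationary M Y"
  unfolding strictly_stationary_def
proof
  fix k
  have "AE \<omega> in M. Y (t + k) \<omega> = F (shift t (\<lambda>s. \<xi> (s + k) \<omega>))" for t
    using F[of "t + k"] by (rule AE_mp) (simp add: shift_def ac_simps)
  then have "path_law M (\<lambda>t. Y (t + k)) = distr (path_law M (\<lambda>t. \<xi> (t + k))) paths (\<lambda>z t. F (shift t z))"
    by (intro path_law_factor meas)
  also have "\<dots> = path_law M Y"
    using st path_law_factor[OF meas F] by (simp add: strictly_stationary_def)
  finally show "path_law M (\<lambda>t. Y (t + k)) = path_law M Y" .
qed

section \<open>Positive mean contrast\<close>

text \<open>
With \<open>y = s / v\<close> the two integrands increase with \<open>N\<close> to \<open>y\<close> and \<open>- ln y\<close>, and \<open>y - ln y \<ge> 1\<close> with equality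
only for \<open>y = 1\<close>. The truncation keeps every integral finite although \<open>y\<close> and \<open>ln v\<close> need not be
integrable; the bounds \<open>m \<le> v\<close> and the logarithmic moment of \<open>s\<close> control \<open>- ln y\<close> from below.
\<close>

lemma (in prob_space) log_contrast_gt_one:
  fixes s v :: "'a \<Rightarrow> real"
  assumes [measurable]: "s \<in> borel_measurable M" "v \<in> borel_measurable M"
    and s: "AE x in M. 0 < s x" and m: "0 < m" and v: "AE x in M. m \<le> v x"
    and log: "integrable M (\<lambda>x. max 0 (ln (s x)))"
    and differ: "\<not> (AE x in M. v x = s x)"
  shows "\<And>N::nat. integrable M (\<lambda>x. min (real N) (ln (v x) - ln (s x)))"
    and "\<And>N::nat. integrable M (\<lambda>x. min (s x) (real N) / v x)"
    and "\<exists>N::nat. 1 < (\<integral>x. min (s x) (real N) / v x \<partial>M) + (\<integral>x. min (real N) (ln (v x) - ln (s x)) \<partial>M)"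
proof -
  show b: "integrable M (\<lambda>x. min (real N) (ln (v x) - ln (s x)))" for N
  proof (rule Bochner_Integration.integrable_bound)
    show "integrable M (\<lambda>x. (real N + \<bar>ln m\<bar>) + max 0 (ln (s x)))"
      using log by simp
    show "AE x in M. norm (min (real N) (ln (v x) - ln (s x))) \<le> norm (real N + \<bar>ln m\<bar> + max 0 (ln (s x)))"
      using s v
    proof eventually_elim
      case (elim x)
      then have "ln m \<le> ln (v x)" using m by simp
      then show ?case by (auto simp: abs_if)
    qed
  qed measurable
  show a: "integrable M (\<lambda>x. min (s x) (real N) / v x)" for N
  proof (rule integrable_const_bound)
    show "AE x in M. norm (min (s x) (real N) / v x) \<le> real N / m"
      using s v by eventually_elim (use m in \<open>auto intro!: frac_le\<close>)
  qed measurable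
  define f where "f N x = min (s x) (real N) / v x + min (real N) (ln (v x) - ln (s x))" for N x
  define u where "u x = s x / v x + (ln (v x) - ln (s x))" for x
  have f: "integrable M (f N)" "integral\<^sup>L M (f N)
    = (\<integral>x. min (s x) (real N) / v x \<partial>M) + (\<integral>x. min (real N) (ln (v x) - ln (s x)) \<partial>M)" for N
    unfolding f_def using a b by auto
  have mono: "AE x in M. mono (\<lambda>N. f N x)"
    using s v
  proof eventually_elim
    case (elim x)
    show ?case
    proof (rule monoI)
      fix i j :: nat assume "i \<le> j"
      then have "min (s x) (real i) / v x \<le> min (s x) (real j) / v x"
        using elim m by (intro divide_right_mono) auto
      with \<open>i \<le> j\<close> show "f i x \<le> f j x" unfolding f_def by (intro add_mono) auto
    qed
  qed
  have lim: "AE x in M. (\<lambda>N. f N x) \<longlonglongrightarrow> u x"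
  proof (intro AE_I2 tendsto_eventually)
    fix x
    have "\<forall>\<^sub>F N in sequentially. max (s x) (ln (v x) - ln (s x)) \<le> real N"
      using eventually_ge_at_top[of "nat \<lceil>max (s x) (ln (v x) - ln (s x))\<rceil>"]
      by eventually_elim linarith
    then show "\<forall>\<^sub>F N in sequentially. f N x = u x"
      by eventually_elim (simp add: f_def u_def min_def)
  qed
  have "\<exists>N. 1 < integral\<^sup>L M (f N)"
  proof (rule ccontr)
    assume "\<not> ?thesis"
    then have le: "integral\<^sup>L M (f N) \<le> 1" for N by (simp add: not_less)
    have "incseq (\<lambda>N. integral\<^sup>L M (f N))"
      using mono by (intro incseq_SucI integral_mono_AE f) (auto simp: mono_def)
    then obtain L where L: "(\<lambda>N. integral\<^sup>L M (f N)) \<longlonglongrightarrow> L" using incseq_convergent le by metis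
    then have L1: "L \<le> 1" by (rule LIMSEQ_le_const2) (use le in auto)
    have um: "u \<in> borel_measurable M" unfolding u_def[abs_def] by measurable
    have u: "integrable M u" "integral\<^sup>L M u = L"
      using integrable_monotone_convergence[OF f(1) mono lim L um]
        integral_monotone_convergence[OF f(1) mono lim L um] by auto
    have y: "AE x in M. 0 \<le> u x - 1 \<and> (u x - 1 = 0 \<longrightarrow> v x = s x)"
      using s v
    proof eventually_elim
      case (elim x)
      then have v: "0 < v x" using m by simp
      define y where "y = s x / v x"
      have y: "0 < y" using elim v by (simp add: y_def)
      have ux: "u x = y - ln y" using elim v by (simp add: u_def y_def ln_div)
      have "y = 1" if "u x - 1 = 0" using ln_eq_minus_one[OF y] that ux by simp
      then show ?case using ln_le_minus_one[OF y] ux v by (auto simp: y_def)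
    qed
    have "integral\<^sup>L M (\<lambda>x. u x - 1) = L - 1" using u by (simp add: prob_space)
    moreover have "0 \<le> integral\<^sup>L M (\<lambda>x. u x - 1)" by (rule integral_nonneg_AE) (use y in auto)
    ultimately have "integral\<^sup>L M (\<lambda>x. u x - 1) = 0" using L1 by simp
    then have "AE x in M. u x - 1 = 0"
      using y u by (subst (asm) integral_nonneg_eq_0_iff_AE) auto
    with y have "AE x in M. v x = s x" by eventually_elim auto
    with differ show False ..
  qed
  then show "\<exists>N::nat. 1 < (\<integral>x. min (s x) (real N) / v x \<partial>M) + (\<integral>x. min (real N) (ln (v x) - ln (s x)) \<partial>M)"
    by (simp add: f(2))
qed

text \<open>
The function \<open>w\<close> is an integrable minorant of the contrast near a parameter. Here \<open>U\<close> is the squared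
innovation, \<open>A \<eta> k\<close> is the event that the relevant quantity oscillates by at most \<open>\<eta>\<close> over the \<open>k\<close>-th
neighbourhood, and \<open>C\<close> is the Lipschitz constant of \<open>ln l\<close>. Off that event only the crude
lower bound \<open>ln m - max 0 (ln s)\<close> is available. The parameters are chosen in the order \<open>N\<close>, \<open>\<eta>\<close>, \<open>k\<close>.
\<close>

lemma (in prob_space) positive_contrast:
  fixes s v U :: "'a \<Rightarrow> real" and A :: "real \<Rightarrow> nat \<Rightarrow> 'a set"
  assumes [measurable]: "s \<in> borel_measurable M" "v \<in> borel_measurable M"
    and s: "AE x in M. 0 < s x" and m: "0 < m" and v: "AE x in M. m \<le> v x"
    and log: "integrable M (\<lambda>x. max 0 (ln (s x)))"
    and differ: "\<not> (AE x in M. v x = s x)"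
    and U: "integrable M U" "integral\<^sup>L M U = 1"
    and U_indep: "\<And>N::nat. integrable M (\<lambda>x. U x * (min (s x) (real N) / v x))"
      "\<And>N::nat. (\<integral>x. U x * (min (s x) (real N) / v x) \<partial>M) = (\<integral>x. min (s x) (real N) / v x \<partial>M)"
    and A [measurable]: "\<And>\<eta> k. A \<eta> k \<in> events" and inc: "\<And>\<eta>. incseq (A \<eta>)"
    and A_full: "\<And>\<eta>. 0 < \<eta> \<Longrightarrow> AE x in M. x \<in> (\<Union>k. A \<eta> k)"
  shows "\<exists>\<eta> k N. 0 < \<eta> \<and> (let w = (\<lambda>x. (if x \<in> A \<eta> k
      then exp (- 2 * C * \<eta>) * (U x * (min (s x) (real N) / v x)) + min (real N) (ln (v x) - ln (s x))
      else ln m - max 0 (ln (s x))) - (3 * C * \<eta> + exp (C * \<eta>) * U x))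
    in integrable M w \<and> 0 < integral\<^sup>L M w)"
proof -
  note logc = log_contrast_gt_one[OF assms(1,2) s m v log differ]
  obtain N :: nat where N: "1 < (\<integral>x. min (s x) (real N) / v x \<partial>M) + (\<integral>x. min (real N) (ln (v x) - ln (s x)) \<partial>M)"
    using logc(3) by blast
  define a where "a x = U x * (min (s x) (real N) / v x)" for x
  define b where "b x = min (real N) (ln (v x) - ln (s x))" for x
  have a: "integrable M a" and b: "integrable M b" using U_indep logc by (auto simp: a_def[abs_def] b_def[abs_def])
  define \<alpha> \<beta> where "\<alpha> = integral\<^sup>L M a" and "\<beta> = integral\<^sup>L M b"
  have pos: "0 < \<alpha> + \<beta> - 1" using N U_indep(2) by (simp add: \<alpha>_def \<beta>_def a_def[abs_def] b_def[abs_def])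
  \<comment> \<open>For \<open>\<eta> \<rightarrow> 0\<close> the mean of the minorant on the good event tends to \<open>\<alpha> + \<beta> - 1\<close>.\<close>
  have "((\<lambda>\<eta>. exp (- 2 * C * \<eta>) * \<alpha> + \<beta> - (3 * C * \<eta> + exp (C * \<eta>))) \<longlongrightarrow>
      exp (- 2 * C * 0) * \<alpha> + \<beta> - (3 * C * 0 + exp (C * 0))) (at_right 0)"
    by (intro tendsto_intros)
  then have "((\<lambda>\<eta>. exp (- 2 * C * \<eta>) * \<alpha> + \<beta> - (3 * C * \<eta> + exp (C * \<eta>))) \<longlongrightarrow> \<alpha> + \<beta> - 1) (at_right 0)"
    by simp
  from order_tendstoD(1)[OF this pos]
  have "\<forall>\<^sub>F \<eta> in at_right 0. 0 < \<eta> \<and> 0 < exp (- 2 * C * \<eta>) * \<alpha> + \<beta> - (3 * C * \<eta> + exp (C * \<eta>))"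
    using eventually_at_right_less[of "0::real"] by eventually_elim auto
  then obtain \<eta> where \<eta>: "0 < \<eta>" "0 < exp (- 2 * C * \<eta>) * \<alpha> + \<beta> - (3 * C * \<eta> + exp (C * \<eta>))"
    using eventually_happens'[of "at_right (0::real)"] by (auto simp: trivial_limit_at_right_real)
  define P where "P x = exp (- 2 * C * \<eta>) * a x + b x" for x
  define Q where "Q x = ln m - max 0 (ln (s x))" for x
  have P: "integrable M P" "integral\<^sup>L M P = exp (- 2 * C * \<eta>) * \<alpha> + \<beta>"
    unfolding P_def[abs_def] \<alpha>_def \<beta>_def using a b by auto
  have Q: "integrable M Q" unfolding Q_def[abs_def] using log by simp
  note [measurable] = borel_measurable_integrable[OF P(1)] borel_measurable_integrable[OF Q]
  define R where "R k x = (if x \<in> A \<eta> k then P x else Q x)" for k x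
  have R: "integrable M (R k)" for k
  proof (rule Bochner_Integration.integrable_bound)
    show "integrable M (\<lambda>x. \<bar>P x\<bar> + \<bar>Q x\<bar>)" using P Q by auto
  qed (auto simp: R_def[abs_def])
  have "(\<lambda>k. integral\<^sup>L M (R k)) \<longlonglongrightarrow> integral\<^sup>L M P"
  proof (rule integral_dominated_convergence[where w = "\<lambda>x. \<bar>P x\<bar> + \<bar>Q x\<bar>"])
    show "AE x in M. (\<lambda>k. R k x) \<longlonglongrightarrow> P x"
      using A_full[OF \<eta>(1)]
    proof eventually_elim
      case (elim x)
      then obtain k where k: "x \<in> A \<eta> k" by auto
      have "\<forall>\<^sub>F i in sequentially. R i x = P x"
        using eventually_ge_at_top[of k]
        by eventually_elim (use k incseqD[OF inc] in \<open>auto simp: R_def\<close>)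
      then show ?case by (rule tendsto_eventually)
    qed
  qed (use P Q R in \<open>auto simp: R_def\<close>)
  moreover have "3 * C * \<eta> + exp (C * \<eta>) < integral\<^sup>L M P" using \<eta> P by simp
  ultimately obtain k where k: "3 * C * \<eta> + exp (C * \<eta>) < integral\<^sup>L M (R k)"
    using order_tendstoD(1) by (metis eventually_sequentially order_refl)
  have "integrable M (\<lambda>x. R k x - (3 * C * \<eta> + exp (C * \<eta>) * U x))"
    "integral\<^sup>L M (\<lambda>x. R k x - (3 * C * \<eta> + exp (C * \<eta>) * U x)) = integral\<^sup>L M (R k) - (3 * C * \<eta> + exp (C * \<eta>))"
    using R U by (auto simp: prob_space)
  with k \<eta>(1) show ?thesis
    unfolding R_def P_def Q_def a_def b_def Let_def by (intro exI[of _ \<eta>] exI[of _ k] exI[of _ N]) auto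
qed

text \<open>
The left-hand side is the minorant of \<open>positive_contrast\<close>. An error of size \<open>\<delta>\<close> in the argument of \<open>l\<close>
changes \<open>1 / l\<close> only by a factor between \<open>exp (- C * \<delta>)\<close> and \<open>exp (C * \<delta>)\<close>. At the true parameter the quotient
\<open>s * u / l g0\<close> is \<open>u\<close>, which is why the upper bound involves the squared innovation only.
\<close>

lemma contrast_step:
  fixes l :: "real \<Rightarrow> real"
  assumes lip: "\<And>x y. x \<in> K \<Longrightarrow> y \<in> K \<Longrightarrow> \<bar>ln (l x) - ln (l y)\<bar> \<le> C * \<bar>x - y\<bar>" and C: "0 \<le> C"
    and m: "0 < m" "\<And>x. m \<le> l x"
    and u: "0 \<le> u" and s: "0 < s" "l g0 = s" and K: "x \<in> K" "x0 \<in> K" "g0 \<in> K" "g1 \<in> K"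
    and x0: "\<bar>x0 - g0\<bar> \<le> \<eta>" and x: "A \<Longrightarrow> \<bar>x - g1\<bar> \<le> 2 * \<eta>" and N: "0 \<le> N"
  shows "(if A then exp (- 2 * C * \<eta>) * (u * (min s N / l g1)) + min N (ln (l g1) - ln s) else ln m - max 0 (ln s))
      - (3 * C * \<eta> + exp (C * \<eta>) * u)
    \<le> (s * u / l x + ln (l x)) - (s * u / l x0 + ln (l x0))"
proof -
  have lpos: "0 < l y" for y using m(1) m(2)[of y] by simp
  have near: "exp (- b) / l z \<le> 1 / l y" "ln (l z) - b \<le> ln (l y)"
    if "y \<in> K" "z \<in> K" "C * \<bar>y - z\<bar> \<le> b" for y z b
  proof -
    have a: "\<bar>ln (l y) - ln (l z)\<bar> \<le> b" using lip[OF that(1,2)] that(3) by linarith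
    then show "ln (l z) - b \<le> ln (l y)" by linarith
    have "ln (l y) \<le> ln (l z) + b" using a by linarith
    then have "exp (ln (l y)) \<le> exp (ln (l z) + b)" by simp
    then have "l y \<le> l z * exp b" using lpos by (simp add: exp_add)
    then show "exp (- b) / l z \<le> 1 / l y" using lpos[of y] lpos[of z] by (simp add: exp_minus field_simps)
  qed
  have C0: "C * \<bar>g0 - x0\<bar> \<le> C * \<eta>" using x0 C by (intro mult_left_mono) auto
  have up1: "1 / l x0 \<le> exp (C * \<eta>) / s"
    using near(1)[OF K(3,2) C0] s lpos[of x0] by (simp add: exp_minus field_simps)
  have "s * u / l x0 = s * u * (1 / l x0)" by simp
  also have "\<dots> \<le> s * u * (exp (C * \<eta>) / s)" using s u by (intro mult_left_mono up1) simp
  also have "\<dots> = exp (C * \<eta>) * u" using s by simp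
  finally have up: "s * u / l x0 + ln (l x0) \<le> exp (C * \<eta>) * u + (ln s + C * \<eta>)"
    using near(2)[OF K(3,2) C0] s by simp
  have C\<eta>: "0 \<le> C * \<eta>" using C0 C by (rule order_trans[OF mult_nonneg_nonneg, rotated 2]) simp
  show ?thesis
  proof (cases A)
    case True
    have "C * \<bar>x - g1\<bar> \<le> C * (2 * \<eta>)" using x[OF True] C by (rule mult_left_mono)
    then have Cx: "C * \<bar>x - g1\<bar> \<le> 2 * C * \<eta>" by simp
    have "exp (- 2 * C * \<eta>) * (u * (min s N / l g1)) = (u * min s N) * (exp (- (2 * C * \<eta>)) / l g1)" by simp
    also have "\<dots> \<le> (u * s) * (1 / l x)"
      using near(1)[OF K(1,4) Cx] u s N lpos[of g1] by (intro mult_mono) auto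
    finally have "exp (- 2 * C * \<eta>) * (u * (min s N / l g1)) \<le> s * u / l x" by (simp add: mult.commute)
    moreover have "min N (ln (l g1) - ln s) \<le> ln (l g1) - ln s" by simp
    ultimately show ?thesis using near(2)[OF K(1,4) Cx] up True by simp
  next
    case False
    have "0 \<le> s * u / l x" using s u lpos[of x] by simp
    moreover have "ln m \<le> ln (l x)" using m(1) m(2)[of x] by simp
    moreover have "ln s \<le> max 0 (ln s)" by simp
    ultimately have "ln m - max 0 (ln s) + ln s \<le> s * u / l x + ln (l x)" by linarith
    then show ?thesis using up C\<eta> False by simp
  qed
qed

text \<open>
The finitely many summands before \<open>T\<close> cost a constant that is uniform over \<open>B\<close>.
\<close>

lemma sum_eventually_pos:
  fixes w :: "nat \<Rightarrow> real" and d :: "nat \<Rightarrow> 'b \<Rightarrow> real"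
  assumes w: "filterlim (\<lambda>n. \<Sum>k<n. w k) at_top sequentially"
    and lower: "\<And>t b. b \<in> B \<Longrightarrow> e t \<le> d t b" and ev: "\<And>t b. T \<le> t \<Longrightarrow> b \<in> B \<Longrightarrow> w t \<le> d t b"
  shows "\<forall>\<^sub>F n in sequentially. \<forall>b\<in>B. 0 < (\<Sum>t = 1..n. d t b)"
proof -
  define R where "R = \<bar>w 0\<bar> + (\<Sum>t<T. \<bar>w t\<bar> + \<bar>e t\<bar>)"
  have "\<forall>\<^sub>F n in sequentially. R + 1 \<le> (\<Sum>k<n. w k)"
    using w by (simp add: filterlim_at_top)
  then have "\<forall>\<^sub>F n in sequentially. R + 1 \<le> (\<Sum>k<Suc n. w k)"
    by (subst eventually_sequentially_Suc)
  then show ?thesis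
  proof eventually_elim
    case (elim n)
    show ?case
    proof
      fix b assume b: "b \<in> B"
      have "w t - (if t < T then \<bar>w t\<bar> + \<bar>e t\<bar> else 0) \<le> d t b" for t
        using lower[OF b, of t] ev[OF _ b, of t] by (cases "t < T") auto
      then have "(\<Sum>t = 1..n. w t) - (\<Sum>t = 1..n. if t < T then \<bar>w t\<bar> + \<bar>e t\<bar> else 0) \<le> (\<Sum>t = 1..n. d t b)"
        unfolding sum_subtractf[symmetric] by (intro sum_mono)
      moreover have "(\<Sum>t = 1..n. if t < T then \<bar>w t\<bar> + \<bar>e t\<bar> else 0) \<le> (\<Sum>t<T. \<bar>w t\<bar> + \<bar>e t\<bar>)"
        unfolding sum.inter_filter[symmetric, OF finite_atLeastAtMost] by (rule sum_mono2) auto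
      moreover have "(\<Sum>k<Suc n. w k) = w 0 + (\<Sum>t = 1..n. w t)"
        by (simp add: lessThan_Suc_atMost atMost_atLeast0 sum.atLeast_Suc_atMost)
      ultimately show "0 < (\<Sum>t = 1..n. d t b)" using elim unfolding R_def by linarith
    qed
  qed
qed

section \<open>Measurability of the recursions\<close>

lemma borel_measurable_extend:
  assumes "S \<in> sets borel" "f \<in> borel_measurable (restrict_space borel S)"
  shows "(\<lambda>x. if x \<in> S then f x else c) \<in> borel_measurable borel"
  using assms by (subst (asm) measurable_restrict_space_iff[of S borel c borel f]) auto

lemma borel_measurable_extend_fst:
  fixes S :: "real set" and F :: "real \<times> real \<Rightarrow> real"
  assumes S [measurable]: "S \<in> sets borel" and F: "F \<in> borel_measurable (restrict_space borel S \<Otimes>\<^sub>M borel)"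
  shows "(\<lambda>p. if fst p \<in> S then F p else c) \<in> borel_measurable (borel \<Otimes>\<^sub>M borel)"
proof -
  define \<Omega> where "\<Omega> = {p :: real \<times> real. fst p \<in> S}"
  have "\<Omega> = fst -` S \<inter> space (borel \<Otimes>\<^sub>M borel)" by (auto simp: \<Omega>_def space_pair_measure)
  then have \<Omega>: "\<Omega> \<in> sets (borel \<Otimes>\<^sub>M borel)" using S by (simp add: measurable_sets[OF measurable_fst])
  have "(\<lambda>p. p) \<in> restrict_space (borel \<Otimes>\<^sub>M borel) \<Omega> \<rightarrow>\<^sub>M restrict_space borel S \<Otimes>\<^sub>M borel"
  proof (rule measurable_pair)
    show "fst \<circ> (\<lambda>p. p) \<in> restrict_space (borel \<Otimes>\<^sub>M borel) \<Omega> \<rightarrow>\<^sub>M restrict_space borel S"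
      unfolding comp_def
      by (intro measurable_restrict_space3 measurable_fst) (auto simp: \<Omega>_def)
    show "snd \<circ> (\<lambda>p. p) \<in> restrict_space (borel \<Otimes>\<^sub>M borel) \<Omega> \<rightarrow>\<^sub>M borel"
      unfolding comp_def by (intro measurable_restrict_space1 measurable_snd)
  qed
  from measurable_compose[OF this F]
  have "F \<in> borel_measurable (restrict_space (borel \<Otimes>\<^sub>M borel) \<Omega>)" .
  then have "(\<lambda>p. if p \<in> \<Omega> then F p else c) \<in> borel_measurable (borel \<Otimes>\<^sub>M borel)"
    using \<Omega> by (subst (asm) measurable_restrict_space_iff[of \<Omega> _ c]) auto
  then show ?thesis by (simp add: \<Omega>_def)
qed

text \<open>
Extended by constants off \<open>S\<close>, both sides of the recursion are globally Borel.
\<close>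

lemma recursion_graph_measurable:
  assumes S [measurable]: "S \<in> sets borel" and u: "u \<in> borel_measurable (restrict_space borel S)"
    and f: "(\<lambda>(x, z). f (u x) z) \<in> borel_measurable (restrict_space borel S \<Otimes>\<^sub>M borel)"
  shows "recursion_graph u f S \<in> sets borel"
proof -
  define u' where "u' x = (if x \<in> S then u x else 0)" for x
  define F where "F p = (if fst p \<in> S then f (u (fst p)) (snd p) else 0)" for p
  have [measurable]: "u' \<in> borel_measurable borel"
    unfolding u'_def[abs_def] by (rule borel_measurable_extend[OF S u])
  have [measurable]: "F \<in> borel_measurable (borel \<Otimes>\<^sub>M borel)"
  proof -
    have "F = (\<lambda>p. if fst p \<in> S then (\<lambda>(x, z). f (u x) z) p else 0)"
      by (simp add: fun_eq_iff F_def split_beta)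
    then show ?thesis using borel_measurable_extend_fst[OF S f, of 0] by (simp only:)
  qed
  have "recursion_graph u f S = {p \<in> space (borel \<Otimes>\<^sub>M borel \<Otimes>\<^sub>M borel).
      fst p \<in> S \<and> fst (snd p) \<in> S \<and> u' (fst (snd p)) = F (fst p, snd (snd p))}"
    by (auto simp: recursion_graph_def u'_def F_def space_pair_measure)
  also have "\<dots> \<in> sets (borel \<Otimes>\<^sub>M borel \<Otimes>\<^sub>M borel)" by measurable
  finally show ?thesis unfolding borel_prod .
qed

section \<open>The state is independent of the next innovation\<close>

primrec driven_state :: "('s \<Rightarrow> real \<Rightarrow> 's) \<Rightarrow> 's \<Rightarrow> (int \<Rightarrow> real) \<Rightarrow> nat \<Rightarrow> 's" where
  "driven_state \<Phi> v z 0 = v"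
| "driven_state \<Phi> v z (Suc n) = \<Phi> (driven_state \<Phi> v z n) (z (int n))"

text \<open>
The index \<open>- 1\<close> is used for the initial state, so that it precedes the innovations \<open>Z 0, Z 1, \<dots>\<close>.
\<close>

lemma (in prob_space) indep_initial_state_noise:
  assumes Z: "indep_vars (\<lambda>_. borel) Z (UNIV :: int set)"
    and s: "(s :: 'a \<Rightarrow> real) \<in> borel_measurable M"
    and ind: "indep_rvs M borel s (\<Pi>\<^sub>M i\<in>{0..}. borel) (\<lambda>\<omega>. \<lambda>i\<in>{0..}. Z i \<omega>)"
  shows "indep_vars (\<lambda>_. borel) (\<lambda>i. if i = - 1 then s else Z i) {- 1..}"
proof -
  have Zm: "Z i \<in> borel_measurable M" for i using Z by (auto simp: indep_vars_def)
  define Q where "Q i = (if i = - 1 then s else Z i)" for i :: int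
  have "indep_sets (\<lambda>i. {Q i -` A \<inter> space M |A. A \<in> sets borel}) {- 1..}"
  proof (rule indep_setsI)
    show "{Q i -` A \<inter> space M |A. A \<in> sets borel} \<subseteq> events" for i
      using s Zm by (auto simp: Q_def)
    fix B and J :: "int set"
    assume J: "J \<noteq> {}" "J \<subseteq> {- 1..}" "finite J" and "\<forall>j\<in>J. B j \<in> {Q j -` A \<inter> space M |A. A \<in> sets borel}"
    then obtain A where A: "\<And>j. j \<in> J \<Longrightarrow> A j \<in> sets borel" "\<And>j. j \<in> J \<Longrightarrow> B j = Q j -` A j \<inter> space M"
      by (simp only: mem_Collect_eq) metis
    define J' where "J' = J - {- 1}"
    have J': "finite J'" "J' \<subseteq> {0..}" using J by (auto simp: J'_def)
    have BJ': "B j = Z j -` A j \<inter> space M" if "j \<in> J'" for j using A(2)[of j] that by (auto simp: J'_def Q_def)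
    have prodZ: "prob (space M \<inter> (\<Inter>j\<in>J'. B j)) = (\<Prod>j\<in>J'. prob (B j))"
    proof (cases "J' = {}")
      case False
      have "prob (\<Inter>j\<in>J'. Z j -` A j \<inter> space M) = (\<Prod>j\<in>J'. prob (Z j -` A j \<inter> space M))"
        using A J' False by (intro indep_varsD[OF Z]) (auto simp: J'_def)
      moreover have "space M \<inter> (\<Inter>j\<in>J'. B j) = (\<Inter>j\<in>J'. Z j -` A j \<inter> space M)"
        using False BJ' by auto
      ultimately show ?thesis using BJ' by simp
    qed (simp add: prob_space)
    show "prob (\<Inter>j\<in>J. B j) = (\<Prod>j\<in>J. prob (B j))"
    proof (cases "- 1 \<in> J")
      case False
      then have "J' = J" by (auto simp: J'_def)
      moreover have "space M \<inter> (\<Inter>j\<in>J. B j) = (\<Inter>j\<in>J. B j)" using J A(2) by auto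
      ultimately show ?thesis using prodZ by simp
    next
      case True
      then have JJ: "J = insert (- 1) J'" "- 1 \<notin> J'" by (auto simp: J'_def)
      have B0: "B (- 1) = s -` A (- 1) \<inter> space M" using A(2)[OF True] by (simp add: Q_def)
      have "B (- 1) \<in> sets (vimage_algebra (space M) s borel)"
        unfolding B0 using A(1)[OF True] by (rule in_vimage_algebra)
      moreover have "space M \<inter> (\<Inter>j\<in>J'. B j) \<in> sets (vimage_algebra (space M) (\<lambda>\<omega>. \<lambda>i\<in>{0..}. Z i \<omega>) (\<Pi>\<^sub>M i\<in>{0..}. borel))"
      proof -
        have "{p \<in> space (\<Pi>\<^sub>M i\<in>{0..}. borel). \<forall>j\<in>J'. p j \<in> A j} \<in> sets (\<Pi>\<^sub>M i\<in>{0..}. borel)"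
        proof (rule sets.sets_Collect_finite_All[OF _ J'(1)])
          fix j assume j: "j \<in> J'"
          then have "(\<lambda>p. p j) \<in> (\<Pi>\<^sub>M i\<in>{0..}. borel) \<rightarrow>\<^sub>M borel" using J' by (intro measurable_component_singleton) auto
          from measurable_sets[OF this A(1)[of j]] j JJ
          show "{p \<in> space (\<Pi>\<^sub>M i\<in>{0..}. borel). p j \<in> A j} \<in> sets (\<Pi>\<^sub>M i\<in>{0..}. borel)"
            by (auto simp: vimage_def Int_def conj_commute)
        qed
        from in_vimage_algebra[OF this, of "\<lambda>\<omega>. \<lambda>i\<in>{0..}. Z i \<omega>" "space M"]
        show ?thesis
        proof (rule back_subst[where P = "\<lambda>X. X \<in> _"])
          show "(\<lambda>\<omega>. \<lambda>i\<in>{0..}. Z i \<omega>) -` {p \<in> space (\<Pi>\<^sub>M i\<in>{0..}. borel). \<forall>j\<in>J'. p j \<in> A j} \<inter> space M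
            = space M \<inter> (\<Inter>j\<in>J'. B j)"
            using J' BJ' by (auto simp: space_PiM subset_iff)
        qed
      qed
      ultimately have "prob (B (- 1) \<inter> (space M \<inter> (\<Inter>j\<in>J'. B j))) = prob (B (- 1)) * prob (space M \<inter> (\<Inter>j\<in>J'. B j))"
        using ind unfolding indep_rvs_def by (intro indep_setD)
      moreover have "(\<Inter>j\<in>J. B j) = B (- 1) \<inter> (space M \<inter> (\<Inter>j\<in>J'. B j))" using B0 JJ by auto
      ultimately show ?thesis using prodZ JJ J'(1) by simp
    qed
  qed
  then show ?thesis
    unfolding indep_vars_def2 Q_def using s Zm by auto
qed

text \<open>
The state at time \<open>n\<close> is a function of the initial state and of \<open>Z 0, \<dots>, Z (n - 1)\<close>. Independence is
stated for a real function \<open>f\<close> of the state since \<open>indep_var\<close> relates variables of one value type.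
\<close>

lemma (in prob_space) driven_state_indep_noise:
  fixes \<Phi> :: "real \<times> real \<Rightarrow> real \<Rightarrow> real \<times> real"
  assumes Z: "indep_vars (\<lambda>_. borel) Z (UNIV :: int set)"
    and s: "(s :: 'a \<Rightarrow> real) \<in> borel_measurable M"
    and ind: "indep_rvs M borel s (\<Pi>\<^sub>M i\<in>{0..}. borel) (\<lambda>\<omega>. \<lambda>i\<in>{0..}. Z i \<omega>)"
    and \<Phi>: "(\<lambda>(v, z). \<Phi> v z) \<in> (borel \<Otimes>\<^sub>M borel) \<Otimes>\<^sub>M borel \<rightarrow>\<^sub>M borel \<Otimes>\<^sub>M borel"
    and f: "f \<in> borel_measurable (borel \<Otimes>\<^sub>M borel)"
  shows "indep_var borel (\<lambda>\<omega>. f (driven_state \<Phi> (c, s \<omega>) (\<lambda>t. Z t \<omega>) n) :: real) borel (Z (int n))"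
proof -
  define Q where "Q i = (if i = - 1 then s else Z i)" for i :: int
  define V where "V k q = driven_state \<Phi> (c, q (- 1)) q k" for k and q :: "int \<Rightarrow> real"
  have V: "V k \<in> (\<Pi>\<^sub>M i\<in>{- 1..<int n}. borel) \<rightarrow>\<^sub>M borel \<Otimes>\<^sub>M borel" if "k \<le> n" for k
    using that
  proof (induction k)
    case 0
    have "(\<lambda>q. (c, q (- 1))) \<in> (\<Pi>\<^sub>M i\<in>{- 1..<int n}. borel) \<rightarrow>\<^sub>M borel \<Otimes>\<^sub>M borel"
      by (intro measurable_Pair measurable_const measurable_component_singleton) auto
    then show ?case by (simp add: V_def[abs_def])
  next
    case (Suc k)
    have "(\<lambda>q. (V k q, q (int k))) \<in> (\<Pi>\<^sub>M i\<in>{- 1..<int n}. borel) \<rightarrow>\<^sub>M (borel \<Otimes>\<^sub>M borel) \<Otimes>\<^sub>M borel"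
      using Suc by (intro measurable_Pair measurable_component_singleton) auto
    from measurable_compose[OF this \<Phi>] show ?case by (simp add: V_def[abs_def])
  qed
  have "indep_vars (\<lambda>_. borel) Q {- 1..}"
    unfolding Q_def[abs_def] by (rule indep_initial_state_noise[OF Z s ind])
  then have "indep_var (\<Pi>\<^sub>M i\<in>{- 1..<int n}. borel) (\<lambda>\<omega>. restrict (\<lambda>i. Q i \<omega>) {- 1..<int n})
      (\<Pi>\<^sub>M i\<in>{int n}. borel) (\<lambda>\<omega>. restrict (\<lambda>i. Q i \<omega>) {int n})"
    by (rule indep_var_restrict) auto
  from indep_var_compose[OF this measurable_compose[OF V[OF order_refl] f] measurable_component_singleton[of "int n"]]
  have "indep_var borel ((\<lambda>q. f (V n q)) \<circ> (\<lambda>\<omega>. restrict (\<lambda>i. Q i \<omega>) {- 1..<int n}))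
      borel ((\<lambda>q. q (int n)) \<circ> (\<lambda>\<omega>. restrict (\<lambda>i. Q i \<omega>) {int n}))" by simp
  moreover have "driven_state \<Phi> v (restrict (\<lambda>i. Q i \<omega>) {- 1..<int n}) k = driven_state \<Phi> v (\<lambda>t. Z t \<omega>) k"
    if "k \<le> n" for k v \<omega>
    using that by (induction k) (auto simp: Q_def)
  ultimately show ?thesis by (simp add: comp_def V_def Q_def)
qed

text \<open>
The weights \<open>U n\<close> are not bounded, but identically distributed and hence uniformly integrable:
splitting at a level \<open>R\<close>, the part below \<open>R\<close> is controlled by bounded convergence of \<open>\<alpha> n - \<beta> n\<close> and
the part above by a tail \<open>r R\<close> that is the same for all \<open>n\<close>.
\<close>

lemma (in prob_space) weighted_mean_limit:
  fixes U \<alpha> \<beta> :: "nat \<Rightarrow> 'a \<Rightarrow> real"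
  assumes U: "\<And>n. integrable M (U n)" "\<And>n x. 0 \<le> U n x" "\<And>n. distr M borel (U n) = distr M borel (U 0)"
    and [measurable]: "\<And>n. \<alpha> n \<in> borel_measurable M" "\<And>n. \<beta> n \<in> borel_measurable M"
    and bd: "\<And>n. AE x in M. \<bar>\<alpha> n x\<bar> \<le> B" "\<And>n. AE x in M. \<bar>\<beta> n x\<bar> \<le> B"
    and lim: "AE x in M. (\<lambda>n. \<alpha> n x - \<beta> n x) \<longlonglongrightarrow> 0"
    and eq: "\<And>n. (\<integral>x. U n x * \<beta> n x \<partial>M) = integral\<^sup>L M (\<beta> n)"
    and pq: "\<And>n. (\<integral>x. U n x * \<alpha> n x \<partial>M) = p" "\<And>n. integral\<^sup>L M (\<alpha> n) = q"
  shows "p = q"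
proof -
  have Um [measurable]: "U n \<in> borel_measurable M" for n using U(1) by auto
  define d where "d n x = \<bar>\<alpha> n x - \<beta> n x\<bar>" for n x
  have dm [measurable]: "d n \<in> borel_measurable M" for n unfolding d_def[abs_def] by measurable
  have B0: "0 \<le> B"
  proof -
    have "AE x in M. 0 \<le> B" using bd(1)[of 0] by eventually_elim auto
    then show ?thesis by simp
  qed
  have dB: "AE x in M. d n x \<le> 2 * B" for n
    using bd(1)[of n] bd(2)[of n] by eventually_elim (auto simp: d_def)
  have int: "integrable M (\<alpha> n)" "integrable M (\<beta> n)" for n
    using bd by (auto intro!: integrable_const_bound[of _ B])
  have id: "integrable M (d n)" for n using int unfolding d_def[abs_def] by auto
  have iU: "integrable M (\<lambda>x. U n x * f x)" if "AE x in M. \<bar>f x\<bar> \<le> b" "f \<in> borel_measurable M" for n f b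
  proof (rule Bochner_Integration.integrable_bound)
    show "integrable M (\<lambda>x. b * U n x)" using U by simp
    show "AE x in M. norm (U n x * f x) \<le> norm (b * U n x)"
      using that(1)
    proof eventually_elim
      case (elim x)
      then have "U n x * \<bar>f x\<bar> \<le> U n x * b" by (intro mult_left_mono U)
      moreover have "0 \<le> b" using elim by linarith
      ultimately show ?case using U(2)[of n x] by (simp add: abs_mult mult.commute)
    qed
    show "(\<lambda>x. U n x * f x) \<in> borel_measurable M" using that(2) by measurable
  qed
  define r where "r R = (\<integral>x. max 0 (U 0 x - R) \<partial>M)" for R
  have tail: "(\<integral>x. max 0 (U n x - R) \<partial>M) = r R" for n R
  proof -
    have "(\<integral>x. max 0 (U n x - R) \<partial>M) = (\<integral>y. max 0 (y - R) \<partial>distr M borel (U n))"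
      by (subst integral_distr) auto
    also have "\<dots> = r R" unfolding U(3)[of n] r_def by (subst integral_distr) auto
    finally show ?thesis .
  qed
  have it: "integrable M (\<lambda>x. max 0 (U n x - R))" for n R using U by simp
  have dlim: "(\<lambda>n. integral\<^sup>L M (d n)) \<longlonglongrightarrow> integral\<^sup>L M (\<lambda>_. 0)"
  proof (rule integral_dominated_convergence[where w = "\<lambda>_. 2 * B"])
    show "AE x in M. (\<lambda>n. d n x) \<longlonglongrightarrow> 0"
      using lim by eventually_elim (simp add: d_def tendsto_rabs_zero_iff)
    show "AE x in M. norm (d n x) \<le> 2 * B" for n using dB[of n] by eventually_elim (simp add: d_def)
  qed auto
  have le: "\<bar>p - q\<bar> \<le> (R + 1) * integral\<^sup>L M (d n) + 2 * B * r R" if R: "0 \<le> R" for R n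
  proof -
    have iUa: "integrable M (\<lambda>x. U n x * \<alpha> n x)" "integrable M (\<lambda>x. U n x * \<beta> n x)" "integrable M (\<lambda>x. U n x * d n x)"
      using bd dB by (auto intro!: iU simp: d_def)
    have "p - q = (\<integral>x. U n x * (\<alpha> n x - \<beta> n x) - (\<alpha> n x - \<beta> n x) \<partial>M)"
      using iUa int pq[of n] eq[of n] by (simp add: right_diff_distrib)
    also have "\<bar>\<dots>\<bar> \<le> (\<integral>x. \<bar>U n x * (\<alpha> n x - \<beta> n x) - (\<alpha> n x - \<beta> n x)\<bar> \<partial>M)"
      by (rule integral_abs_bound)
    also have "\<dots> \<le> (\<integral>x. U n x * d n x + d n x \<partial>M)"
    proof (rule integral_mono)
      show "\<bar>U n x * (\<alpha> n x - \<beta> n x) - (\<alpha> n x - \<beta> n x)\<bar> \<le> U n x * d n x + d n x" for x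
        using U(2)[of n x] abs_triangle_ineq4[of "U n x * (\<alpha> n x - \<beta> n x)" "\<alpha> n x - \<beta> n x"]
        by (simp add: d_def abs_mult)
      show "integrable M (\<lambda>x. \<bar>U n x * (\<alpha> n x - \<beta> n x) - (\<alpha> n x - \<beta> n x)\<bar>)"
        using iUa int by (auto simp: right_diff_distrib)
    qed (use iUa id in auto)
    also have "\<dots> \<le> (\<integral>x. (R + 1) * d n x + 2 * B * max 0 (U n x - R) \<partial>M)"
    proof (rule integral_mono_AE)
      show "AE x in M. U n x * d n x + d n x \<le> (R + 1) * d n x + 2 * B * max 0 (U n x - R)"
        using dB[of n]
      proof eventually_elim
        case (elim x)
        have "(U n x - R) * d n x \<le> max 0 (U n x - R) * d n x"
          by (intro mult_right_mono) (auto simp: d_def)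
        also have "\<dots> \<le> max 0 (U n x - R) * (2 * B)" using elim by (intro mult_left_mono) auto
        finally show ?case by (simp add: algebra_simps)
      qed
    qed (use iUa id it in auto)
    also have "\<dots> = (R + 1) * integral\<^sup>L M (d n) + 2 * B * r R"
      using id it by (simp add: tail)
    finally show ?thesis .
  qed
  have le': "\<bar>p - q\<bar> \<le> 2 * B * r R" if R: "0 \<le> R" for R
  proof (rule LIMSEQ_le_const)
    show "(\<lambda>n. (R + 1) * integral\<^sup>L M (d n) + 2 * B * r R) \<longlonglongrightarrow> 2 * B * r R"
      using tendsto_add[OF tendsto_mult_left[OF dlim, of "R + 1"] tendsto_const[of "2 * B * r R"]] by simp
  qed (use le[OF R] in auto)
  have "(\<lambda>k. r (real k)) \<longlonglongrightarrow> integral\<^sup>L M (\<lambda>_. 0)"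
    unfolding r_def
  proof (rule integral_dominated_convergence[where w = "\<lambda>x. U 0 x"])
    show "AE x in M. (\<lambda>k. max 0 (U 0 x - real k)) \<longlonglongrightarrow> 0"
    proof (intro AE_I2 tendsto_eventually)
      fix x
      show "\<forall>\<^sub>F k in sequentially. max 0 (U 0 x - real k) = 0"
        using eventually_ge_at_top[of "nat \<lceil>U 0 x\<rceil>"] by eventually_elim linarith
    qed
    show "AE x in M. norm (max 0 (U 0 x - real k)) \<le> U 0 x" for k using U(2)[of 0] by (auto simp: max_def)
  qed (use U(1) in auto)
  then have "(\<lambda>k. 2 * B * r (real k)) \<longlonglongrightarrow> 2 * B * 0" by (intro tendsto_mult_left) simp
  then have "\<bar>p - q\<bar> \<le> 2 * B * 0"
    by (rule LIMSEQ_le_const) (use le' in auto)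
  then show ?thesis by simp
qed

section \<open>Models driven through their noise path\<close>

text \<open>
The volatility and the stationary solutions as functionals \<open>H\<close> and \<open>G \<theta>\<close> of the shifted noise path.
All stationarity and ergodicity statements can then be made on the path space, whose measure is the
product measure of the law of one innovation.
\<close>

locale stationary_factor_model = prob_space M for M :: "'a measure" +
  fixes Z s2 :: "int \<Rightarrow> 'a \<Rightarrow> real" and g :: "int \<Rightarrow> 'p \<Rightarrow> 'a \<Rightarrow> real"
    and H :: "(int \<Rightarrow> real) \<Rightarrow> real" and G :: "'p \<Rightarrow> (int \<Rightarrow> real) \<Rightarrow> real"
    and K :: "real set" and \<Theta> :: "'p set"
  assumes Z_indep: "indep_vars (\<lambda>_. borel) Z UNIV"
    and Z_ident: "\<And>t. distr M borel (Z t) = distr M borel (Z 0)"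
    and Z_var: "integrable M (\<lambda>\<omega>. (Z 0 \<omega>)\<^sup>2)" "(LINT \<omega>|M. (Z 0 \<omega>)\<^sup>2) = 1"
    and H_measurable [measurable]: "H \<in> borel_measurable paths"
    and G_measurable: "\<And>\<theta>. \<theta> \<in> \<Theta> \<Longrightarrow> G \<theta> \<in> borel_measurable paths"
    and s2_measurable [measurable]: "\<And>t. s2 t \<in> borel_measurable M"
    and g_measurable: "\<And>\<theta> t. \<theta> \<in> \<Theta> \<Longrightarrow> g t \<theta> \<in> borel_measurable M"
    and s2_factor: "\<And>t. AE \<omega> in M. s2 t \<omega> = H (shift t (\<lambda>s. Z s \<omega>))"
    and g_factor: "\<And>\<theta> t. \<theta> \<in> \<Theta> \<Longrightarrow> AE \<omega> in M. g t \<theta> \<omega> = G \<theta> (shift t (\<lambda>s. Z s \<omega>))"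
    and s2_pos: "\<And>t. AE \<omega> in M. 0 < s2 t \<omega>"
    and g_in_K: "\<And>\<theta> t. \<theta> \<in> \<Theta> \<Longrightarrow> AE \<omega> in M. g t \<theta> \<omega> \<in> K"
begin

abbreviation "noise_path \<omega> \<equiv> (\<lambda>s. Z s \<omega>)"
abbreviation "\<nu> \<equiv> distr M borel (Z 0)"

lemma Z_measurable [measurable]: "Z t \<in> borel_measurable M"
  using Z_indep by (simp add: indep_vars_def)

lemma noise_law: "prob_space \<nu>" "sets \<nu> = sets borel"
  by (auto intro: prob_space_distr)

lemma noise_path_measurable [measurable]: "noise_path \<in> M \<rightarrow>\<^sub>M paths"
  by (rule path_measurable) measurable

lemma distr_path: "distr M paths (\<lambda>\<omega>. shift t (noise_path \<omega>)) = iid \<nu>"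
proof -
  have 1: "distr M paths noise_path = iid \<nu>"
    using path_law_iid[OF Z_indep Z_ident] by (simp add: path_law_def)
  have "distr M paths (\<lambda>\<omega>. shift t (noise_path \<omega>)) = distr (distr M paths noise_path) paths (shift t)"
    by (subst distr_distr) (auto simp: comp_def)
  also have "\<dots> = distr (iid \<nu>) (iid \<nu>) (shift t)"
    unfolding 1 by (intro distr_cong refl sets_iid[OF noise_law, symmetric])
  finally show ?thesis by (simp add: distr_shift_iid[OF noise_law])
qed

lemma shift_path_measurable [measurable]: "(\<lambda>\<omega>. shift t (noise_path \<omega>)) \<in> M \<rightarrow>\<^sub>M paths"
  by measurable

lemma AE_shift_path:
  assumes "AE z in iid \<nu>. P z" shows "AE \<omega> in M. P (shift t (noise_path \<omega>))"
proof -
  have "AE z in distr M paths (\<lambda>\<omega>. shift t (noise_path \<omega>)). P z" unfolding distr_path by (rule assms)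
  then show ?thesis by (rule AE_distrD[OF shift_path_measurable])
qed

lemma AE_pathI:
  assumes "AE \<omega> in M. P (shift t (noise_path \<omega>))" "{z\<in>space paths. P z} \<in> sets paths"
  shows "AE z in iid \<nu>. P z"
  unfolding distr_path[of t, symmetric] using assms by (subst AE_distr_iff) auto

lemma integral_path:
  assumes "f \<in> borel_measurable paths"
  shows "integral\<^sup>L (iid \<nu>) f = (\<integral>\<omega>. (f (shift t (noise_path \<omega>)) :: real) \<partial>M)"
    "integrable (iid \<nu>) f \<longleftrightarrow> integrable M (\<lambda>\<omega>. f (shift t (noise_path \<omega>)))"
  unfolding distr_path[of t, symmetric] using assms
  by (auto simp: integral_distr integrable_distr_eq)

text \<open>
The approximation \<open>gh\<close> and the volatility form a state that is independent of the next innovation, and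
\<open>E (Z\<^sub>n\<^sup>2) = 1\<close>. So the identity holds at time \<open>n\<close> with \<open>gh n\<close> in the place of \<open>g n \<theta>\<close>. The error vanishes
as \<open>n\<close> grows, while the two sides for \<open>g n \<theta>\<close> do not depend on \<open>n\<close>. Truncation at \<open>N\<close> makes the factor
of \<open>Z\<^sub>n\<^sup>2\<close> bounded and Lipschitz in \<open>g n \<theta>\<close>.
\<close>

lemma innovation_identity:
  fixes \<Phi> :: "real \<times> real \<Rightarrow> real \<Rightarrow> real \<times> real" and gh :: "nat \<Rightarrow> 'a \<Rightarrow> real" and N :: nat
  assumes \<theta>: "\<theta> \<in> \<Theta>"
    and ind: "indep_rvs M borel (s2 0) (\<Pi>\<^sub>M i\<in>{0..}. borel) (\<lambda>\<omega>. \<lambda>i\<in>{0..}. Z i \<omega>)"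
    and \<Phi>: "(\<lambda>(v, z). \<Phi> v z) \<in> (borel \<Otimes>\<^sub>M borel) \<Otimes>\<^sub>M borel \<rightarrow>\<^sub>M borel \<Otimes>\<^sub>M borel"
    and state: "\<And>n. AE \<omega> in M. driven_state \<Phi> (c, s2 0 \<omega>) (noise_path \<omega>) n = (gh n \<omega>, s2 (int n) \<omega>)"
    and l [measurable]: "l \<in> borel_measurable borel" and m: "0 < m" "\<And>x. m \<le> l x"
    and lip: "\<And>x y. x \<in> K \<Longrightarrow> y \<in> K \<Longrightarrow> \<bar>1 / l x - 1 / l y\<bar> \<le> C * \<bar>x - y\<bar>"
    and gh_K: "\<And>n. AE \<omega> in M. gh n \<omega> \<in> K"
    and conv: "AE \<omega> in M. (\<lambda>n. g (int n) \<theta> \<omega> - gh n \<omega>) \<longlonglongrightarrow> 0"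
  shows "(\<integral>\<omega>. (Z 0 \<omega>)\<^sup>2 * (min (s2 0 \<omega>) (real N) / l (g 0 \<theta> \<omega>)) \<partial>M)
    = (\<integral>\<omega>. min (s2 0 \<omega>) (real N) / l (g 0 \<theta> \<omega>) \<partial>M)"
proof -
  have [measurable]: "g t \<theta> \<in> borel_measurable M" for t by (rule g_measurable[OF \<theta>])
  have [measurable]: "G \<theta> \<in> borel_measurable paths" by (rule G_measurable[OF \<theta>])
  have lpos: "0 < l x" for x using m(1) m(2)[of x] by simp
  define F where "F p = min (snd p) (real N) / l (fst p)" for p :: "real \<times> real"
  have F [measurable]: "F \<in> borel_measurable (borel \<Otimes>\<^sub>M borel)" unfolding F_def[abs_def] by measurable
  define V where "V n \<omega> = driven_state \<Phi> (c, s2 0 \<omega>) (noise_path \<omega>) n" for n \<omega>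
  define U where "U n \<omega> = (Z (int n) \<omega>)\<^sup>2" for n \<omega>
  define \<alpha> where "\<alpha> n \<omega> = F (g (int n) \<theta> \<omega>, s2 (int n) \<omega>)" for n \<omega>
  define \<beta> where "\<beta> n \<omega> = F (V n \<omega>)" for n \<omega>
  have \<beta>_eq: "AE \<omega> in M. \<beta> n \<omega> = F (gh n \<omega>, s2 (int n) \<omega>)" for n
    using state[of n] by eventually_elim (simp add: \<beta>_def V_def)
  have F_bd: "\<bar>F (x, s)\<bar> \<le> real N / m" if "0 < s" for x s
    using that m(1) m(2)[of x] lpos[of x] by (auto simp: F_def abs_of_pos intro!: frac_le)
  have law_U: "distr M borel (U n) = distr \<nu> borel (\<lambda>x. x\<^sup>2)" for n
    unfolding U_def[abs_def] Z_ident[of "int n", symmetric] by (subst distr_distr) (auto simp: comp_def)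
  have U_int: "integrable M (U n)" "integral\<^sup>L M (U n) = 1" for n
  proof -
    have "integrable M (\<lambda>\<omega>. (Z (int n) \<omega>)\<^sup>2) \<longleftrightarrow> integrable (distr M borel (Z (int n))) (\<lambda>x. x\<^sup>2)"
      "(LINT \<omega>|M. (Z (int n) \<omega>)\<^sup>2) = (LINT x|distr M borel (Z (int n)). x\<^sup>2)"
      by (auto simp: integrable_distr_eq integral_distr)
    moreover have "integrable M (\<lambda>\<omega>. (Z 0 \<omega>)\<^sup>2) \<longleftrightarrow> integrable (distr M borel (Z 0)) (\<lambda>x. x\<^sup>2)"
      "(LINT \<omega>|M. (Z 0 \<omega>)\<^sup>2) = (LINT x|distr M borel (Z 0). x\<^sup>2)"
      by (auto simp: integrable_distr_eq integral_distr)
    ultimately show "integrable M (U n)" "integral\<^sup>L M (U n) = 1"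
      using Z_var unfolding U_def[abs_def] Z_ident[of "int n"] by simp_all
  qed
  have ind_n: "indep_var borel (\<beta> n) borel (Z (int n))" for n
    unfolding \<beta>_def[abs_def] V_def by (rule driven_state_indep_noise[OF Z_indep s2_measurable ind \<Phi> F])
  have \<beta>m [measurable]: "\<beta> n \<in> borel_measurable M" for n
    using ind_n[of n] by (rule indep_var_rv1)
  have \<alpha>m [measurable]: "\<alpha> n \<in> borel_measurable M" for n unfolding \<alpha>_def[abs_def] by measurable
  have bd: "AE \<omega> in M. \<bar>\<alpha> n \<omega>\<bar> \<le> real N / m" "AE \<omega> in M. \<bar>\<beta> n \<omega>\<bar> \<le> real N / m" for n
  proof -
    show "AE \<omega> in M. \<bar>\<alpha> n \<omega>\<bar> \<le> real N / m"
      using s2_pos[of "int n"] by eventually_elim (simp add: \<alpha>_def F_bd)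
    show "AE \<omega> in M. \<bar>\<beta> n \<omega>\<bar> \<le> real N / m"
      using s2_pos[of "int n"] \<beta>_eq[of n] by eventually_elim (simp add: F_bd)
  qed
  define p where "p = (\<integral>z. (z 0)\<^sup>2 * F (G \<theta> z, H z) \<partial>iid \<nu>)"
  define q where "q = (\<integral>z. F (G \<theta> z, H z) \<partial>iid \<nu>)"
  have pq: "(\<integral>\<omega>. U n \<omega> * \<alpha> n \<omega> \<partial>M) = p" "integral\<^sup>L M (\<alpha> n) = q" for n
  proof -
    have fac: "AE \<omega> in M. \<alpha> n \<omega> = F (G \<theta> (shift (int n) (noise_path \<omega>)), H (shift (int n) (noise_path \<omega>)))"
      using s2_factor[of "int n"] g_factor[OF \<theta>, of "int n"] by eventually_elim (simp add: \<alpha>_def)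
    have Un: "U n \<omega> = (shift (int n) (noise_path \<omega>) 0)\<^sup>2" for \<omega> by (simp add: U_def shift_def)
    have [measurable]: "U n \<in> borel_measurable M" unfolding U_def[abs_def] by measurable
    show "(\<integral>\<omega>. U n \<omega> * \<alpha> n \<omega> \<partial>M) = p"
      unfolding p_def
    proof (subst integral_path(1)[where t = "int n"])
      show "(\<integral>\<omega>. U n \<omega> * \<alpha> n \<omega> \<partial>M) = (\<integral>\<omega>. (shift (int n) (noise_path \<omega>) 0)\<^sup>2 *
        F (G \<theta> (shift (int n) (noise_path \<omega>)), H (shift (int n) (noise_path \<omega>))) \<partial>M)"
        by (rule integral_cong_AE, measurable) (use fac in \<open>eventually_elim, simp add: Un\<close>)
    qed measurable
    show "integral\<^sup>L M (\<alpha> n) = q"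
      unfolding q_def
    proof (subst integral_path(1)[where t = "int n"])
      show "integral\<^sup>L M (\<alpha> n) = (\<integral>\<omega>. F (G \<theta> (shift (int n) (noise_path \<omega>)), H (shift (int n) (noise_path \<omega>))) \<partial>M)"
        by (rule integral_cong_AE, measurable) (use fac in \<open>eventually_elim, simp\<close>)
    qed measurable
  qed
  have "p = q"
  proof (rule weighted_mean_limit[of U \<alpha> \<beta> "real N / m" p q])
    show "distr M borel (U n) = distr M borel (U 0)" for n by (simp add: law_U)
    show "AE \<omega> in M. (\<lambda>n. \<alpha> n \<omega> - \<beta> n \<omega>) \<longlonglongrightarrow> 0"
    proof -
      have "AE \<omega> in M. \<forall>n. \<bar>\<alpha> n \<omega> - \<beta> n \<omega>\<bar> \<le> real N * C * \<bar>g (int n) \<theta> \<omega> - gh n \<omega>\<bar>"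
      proof (rule AE_all_countable[THEN iffD2], rule allI)
        fix n
        show "AE \<omega> in M. \<bar>\<alpha> n \<omega> - \<beta> n \<omega>\<bar> \<le> real N * C * \<bar>g (int n) \<theta> \<omega> - gh n \<omega>\<bar>"
          using \<beta>_eq[of n] s2_pos[of "int n"] gh_K[of n] g_in_K[OF \<theta>, of "int n"]
        proof eventually_elim
          case (elim \<omega>)
          have "\<alpha> n \<omega> - \<beta> n \<omega> = min (s2 (int n) \<omega>) (real N) * (1 / l (g (int n) \<theta> \<omega>) - 1 / l (gh n \<omega>))"
            unfolding elim(1) by (simp add: \<alpha>_def F_def right_diff_distrib)
          then have "\<bar>\<alpha> n \<omega> - \<beta> n \<omega>\<bar> = min (s2 (int n) \<omega>) (real N) * \<bar>1 / l (g (int n) \<theta> \<omega>) - 1 / l (gh n \<omega>)\<bar>"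
            using elim(2) by (simp add: abs_mult)
          also have "\<dots> \<le> real N * (C * \<bar>g (int n) \<theta> \<omega> - gh n \<omega>\<bar>)"
            by (intro mult_mono lip elim) auto
          finally show ?case by simp
        qed
      qed
      then show ?thesis using conv
      proof eventually_elim
        case (elim \<omega>)
        have "(\<lambda>n. real N * C * \<bar>g (int n) \<theta> \<omega> - gh n \<omega>\<bar>) \<longlonglongrightarrow> real N * C * 0"
          using elim(2) by (intro tendsto_mult_left tendsto_rabs_zero)
        then show ?case
          by (intro Lim_null_comparison[of "\<lambda>n. \<alpha> n \<omega> - \<beta> n \<omega>"]) (use elim(1) in \<open>auto intro!: always_eventually\<close>)
      qed
    qed
    show "(\<integral>x. U n x * \<beta> n x \<partial>M) = integral\<^sup>L M (\<beta> n)" for n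
    proof -
      have "indep_var borel ((\<lambda>x. x) \<circ> \<beta> n) borel ((\<lambda>x. x\<^sup>2) \<circ> Z (int n))"
        by (rule indep_var_compose[OF ind_n]) measurable
      then have "indep_var borel (\<beta> n) borel (U n)" by (simp add: comp_def U_def[abs_def])
      moreover have "integrable M (\<beta> n)" using bd(2)[of n] by (intro integrable_const_bound[of _ "real N / m"]) auto
      ultimately have "(\<integral>x. \<beta> n x * U n x \<partial>M) = integral\<^sup>L M (\<beta> n) * integral\<^sup>L M (U n)"
        using U_int by (intro indep_var_lebesgue_integral)
      then show ?thesis using U_int by (simp add: mult.commute)
    qed
  qed (use U_int bd pq in \<open>auto simp: U_def\<close>)
  moreover have "U 0 = (\<lambda>\<omega>. (Z 0 \<omega>)\<^sup>2)" "\<alpha> 0 = (\<lambda>\<omega>. min (s2 0 \<omega>) (real N) / l (g 0 \<theta> \<omega>))"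
    by (simp_all add: fun_eq_iff U_def \<alpha>_def F_def)
  ultimately show ?thesis using pq[of 0] by simp
qed

end

section \<open>Separation of the quasi likelihood\<close>

text \<open>
The link \<open>l\<close> is total, Borel and bounded below everywhere; a link that has these properties on \<open>K\<close> only
can be changed off \<open>K\<close>. The assumption \<open>innovation\<close> is all that is retained of the causal structure.
\<close>

locale qml_factor_model = stationary_factor_model M Z s2 g H G K \<Theta>
  for M :: "'a measure" and Z s2 and g :: "int \<Rightarrow> 'p::euclidean_space \<Rightarrow> 'a \<Rightarrow> real" and H G K \<Theta> +
  fixes ghat :: "nat \<Rightarrow> 'p \<Rightarrow> 'a \<Rightarrow> real" and l :: "real \<Rightarrow> real" and \<theta>0 :: 'p and m C :: real
  assumes l_borel [measurable]: "l \<in> borel_measurable borel"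
    and l_lower: "0 < m" "\<And>x. m \<le> l x"
    and l_lip: "\<And>x y. x \<in> K \<Longrightarrow> y \<in> K \<Longrightarrow> \<bar>ln (l x) - ln (l y)\<bar> \<le> C * \<bar>x - y\<bar>" and C_nonneg: "0 \<le> C"
    and log_moment: "integrable M (\<lambda>\<omega>. max 0 (ln (s2 0 \<omega>)))"
    and compact_\<Theta>: "compact \<Theta>" and \<theta>0_in: "\<theta>0 \<in> \<Theta>"
    and at_truth: "AE \<omega> in M. l (g 0 \<theta>0 \<omega>) = s2 0 \<omega>"
    and off_truth: "\<And>\<theta>. \<theta> \<in> \<Theta> \<Longrightarrow> \<theta> \<noteq> \<theta>0 \<Longrightarrow> \<not> (AE \<omega> in M. l (g 0 \<theta> \<omega>) = s2 0 \<omega>)"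
    and ghat_cont: "AE \<omega> in M. \<forall>t. (\<lambda>\<theta>. ghat t \<theta> \<omega>) \<in> cont_maps \<Theta> K"
    and ghat_conv: "AE \<omega> in M. (\<lambda>t. unif_norm \<Theta> (\<lambda>\<theta>. ghat t \<theta> \<omega> - g (int t) \<theta> \<omega>)) \<longlonglongrightarrow> 0"
    and innovation: "\<And>\<theta> N::nat. \<theta> \<in> \<Theta> \<Longrightarrow>
      (\<integral>\<omega>. (Z 0 \<omega>)\<^sup>2 * (min (s2 0 \<omega>) (real N) / l (g 0 \<theta> \<omega>)) \<partial>M) = (\<integral>\<omega>. min (s2 0 \<omega>) (real N) / l (g 0 \<theta> \<omega>) \<partial>M)"
begin

definition osc_small :: "'p set \<Rightarrow> 'p \<Rightarrow> real \<Rightarrow> nat \<Rightarrow> (int \<Rightarrow> real) set" where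
  "osc_small D \<theta>1 \<eta> k = {z. \<forall>\<theta>\<in>D. dist \<theta> \<theta>1 < 1 / real (Suc k) \<longrightarrow> \<bar>G \<theta> z - G \<theta>1 z\<bar> \<le> \<eta>}"

lemma osc_small_measurable:
  assumes D: "countable D" "D \<subseteq> \<Theta>" and \<theta>1: "\<theta>1 \<in> \<Theta>"
  shows "osc_small D \<theta>1 \<eta> k \<in> sets paths"
proof -
  have [measurable]: "G \<theta>1 \<in> borel_measurable paths" by (rule G_measurable[OF \<theta>1])
  have "osc_small D \<theta>1 \<eta> k = {z\<in>space paths. \<forall>\<theta>\<in>D. dist \<theta> \<theta>1 < 1 / real (Suc k) \<longrightarrow> \<bar>G \<theta> z - G \<theta>1 z\<bar> \<le> \<eta>}"
    by (simp add: osc_small_def)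
  also have "\<dots> \<in> sets paths"
  proof (rule sets.sets_Collect_countable_All'[OF _ D(1)])
    fix \<theta> assume "\<theta> \<in> D"
    then have [measurable]: "G \<theta> \<in> borel_measurable paths" using D(2) G_measurable by blast
    show "{z\<in>space paths. dist \<theta> \<theta>1 < 1 / real (Suc k) \<longrightarrow> \<bar>G \<theta> z - G \<theta>1 z\<bar> \<le> \<eta>} \<in> sets paths"
      by measurable
  qed
  finally show ?thesis .
qed

text \<open>
Let \<open>A\<close> be the event on the right. The shifted noise path lies in \<open>A\<close> whenever \<open>ghat n\<close>, which is continuous
at \<open>\<theta>1\<close>, is within \<open>\<eta> / 3\<close> of \<open>g n\<close>. This holds for all large \<open>n\<close>. The probability that the shifted path
lies in \<open>A\<close> does not depend on \<open>n\<close>, so it is one. Restricting to a countable \<open>D\<close> makes \<open>A\<close> measurable.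
\<close>

lemma asymptotic_equicontinuity:
  assumes D: "countable D" "D \<subseteq> \<Theta>" and \<theta>1: "\<theta>1 \<in> \<Theta>" and \<eta>: "0 < \<eta>"
  shows "AE z in iid \<nu>. z \<in> (\<Union>k. osc_small D \<theta>1 \<eta> k)"
proof -
  interpret L: prob_space "iid \<nu>" by (rule prob_space_iid[OF noise_law])
  define A where "A = (\<Union>k. osc_small D \<theta>1 \<eta> k)"
  have A: "A \<in> sets paths"
    unfolding A_def by (rule sets.countable_UN) (use osc_small_measurable[OF D \<theta>1] in auto)
  have fac: "AE \<omega> in M. \<forall>n. \<forall>\<theta>\<in>insert \<theta>1 D. g (int n) \<theta> \<omega> = G \<theta> (shift (int n) (noise_path \<omega>))"
    using D \<theta>1 g_factor by (intro AE_all_countable[THEN iffD2] allI AE_ball_countable[THEN iffD2]) auto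
  have "AE \<omega> in M. \<forall>\<^sub>F n in sequentially. shift (int n) (noise_path \<omega>) \<in> A"
    using fac ghat_cont ghat_conv
  proof eventually_elim
    case (elim \<omega>)
    have "\<forall>\<^sub>F n in sequentially. unif_norm \<Theta> (\<lambda>\<theta>. ghat n \<theta> \<omega> - g (int n) \<theta> \<omega>) < ennreal (\<eta> / 3)"
      using order_tendstoD(2)[OF elim(3), of "ennreal (\<eta> / 3)"] \<eta> by simp
    then show ?case
    proof eventually_elim
      case (elim n)
      have close: "\<bar>ghat n \<theta> \<omega> - g (int n) \<theta> \<omega>\<bar> \<le> \<eta> / 3" if "\<theta> \<in> \<Theta>" for \<theta>
        using order_le_less_trans[OF SUP_upper[OF that] elim[unfolded unif_norm_def]] \<eta>
        by (simp add: ennreal_less_iff)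
      have "continuous_on \<Theta> (\<lambda>\<theta>. ghat n \<theta> \<omega>)" using \<open>\<forall>t. (\<lambda>\<theta>. ghat t \<theta> \<omega>) \<in> cont_maps \<Theta> K\<close> by (simp add: cont_maps_def)
      then obtain \<delta> where \<delta>: "0 < \<delta>" "\<And>\<theta>. \<theta> \<in> \<Theta> \<Longrightarrow> dist \<theta> \<theta>1 < \<delta> \<Longrightarrow> dist (ghat n \<theta> \<omega>) (ghat n \<theta>1 \<omega>) < \<eta> / 3"
        using \<theta>1 \<eta> unfolding continuous_on_iff by (metis zero_less_divide_iff zero_less_numeral)
      obtain k :: nat where k: "1 / real (Suc k) < \<delta>"
        using nat_approx_posE[OF \<delta>(1)] by blast
      have "\<bar>G \<theta> (shift (int n) (noise_path \<omega>)) - G \<theta>1 (shift (int n) (noise_path \<omega>))\<bar> \<le> \<eta>"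
        if "\<theta> \<in> D" "dist \<theta> \<theta>1 < 1 / real (Suc k)" for \<theta>
        using close[of \<theta>] close[OF \<theta>1] \<delta>(2)[of \<theta>] that D k
          \<open>\<forall>n. \<forall>\<theta>\<in>insert \<theta>1 D. g (int n) \<theta> \<omega> = G \<theta> (shift (int n) (noise_path \<omega>))\<close>
        by (auto simp: dist_real_def subset_iff abs_le_iff abs_less_iff) (smt (verit) field_sum_of_halves)+
      then show ?case unfolding A_def osc_small_def by blast
    qed
  qed
  then have "AE \<omega> in M. (\<lambda>n. indicator A (shift (int n) (noise_path \<omega>)) :: real) \<longlonglongrightarrow> 1"
    by (rule AE_mp) (auto intro!: AE_I2 tendsto_eventually elim: eventually_mono)
  then have "(\<lambda>n. \<integral>\<omega>. indicator A (shift (int n) (noise_path \<omega>)) \<partial>M) \<longlonglongrightarrow> (\<integral>\<omega>. (1::real) \<partial>M)"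
    by (intro integral_dominated_convergence[where w = "\<lambda>_. 1"]) (use A in \<open>auto split: split_indicator\<close>)
  moreover have "(\<integral>\<omega>. indicator A (shift (int n) (noise_path \<omega>)) \<partial>M) = L.prob A" for n
    using integral_path(1)[of "indicator A" "int n"] A by (simp add: sets_iid[OF noise_law])
  ultimately have "L.prob A = 1" by (simp add: LIMSEQ_const_iff prob_space)
  then have "AE z in iid \<nu>. z \<in> A" using A by (intro L.AE_prob_1)
  then show ?thesis by (simp add: A_def)
qed

text \<open>
The summand of the criterion, with \<open>X\<^sub>t\<^sup>2\<close> written as \<open>\<sigma>\<^sub>t\<^sup>2 Z\<^sub>t\<^sup>2\<close>.
\<close>

definition loss :: "'p \<Rightarrow> nat \<Rightarrow> 'a \<Rightarrow> real" where
  "loss \<theta> t \<omega> = s2 (int t) \<omega> * (Z (int t) \<omega>)\<^sup>2 / l (ghat t \<theta> \<omega>) + ln (l (ghat t \<theta> \<omega>))"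

text \<open>
Once \<open>ghat t\<close> is within \<open>\<eta>\<close> of \<open>g t\<close>, the minorant \<open>w\<close> evaluated at the shifted noise path is below the
contrast, uniformly over the neighbourhood of \<open>\<theta>1\<close>. Its mean is positive, so its partial sums tend to
infinity. The oscillation of \<open>g t\<close> is known on a dense set \<open>D\<close> only; continuity of \<open>ghat t\<close> extends
the resulting bound to all parameters.
\<close>

lemma local_separation:
  assumes \<theta>1: "\<theta>1 \<in> \<Theta>" "\<theta>1 \<noteq> \<theta>0"
  shows "\<exists>r>0. AE \<omega> in M. \<forall>\<^sub>F n in sequentially. \<forall>\<theta>\<in>\<Theta> \<inter> ball \<theta>1 r.
    0 < (\<Sum>t = 1..n. loss \<theta> t \<omega> - loss \<theta>0 t \<omega>)"
proof -
  interpret L: prob_space "iid \<nu>" by (rule prob_space_iid[OF noise_law])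
  have [measurable_cong]: "sets (iid \<nu>) = sets paths" by (rule sets_iid[OF noise_law])
  have G1 [measurable]: "G \<theta>1 \<in> borel_measurable paths" by (rule G_measurable[OF \<theta>1(1)])
  have [measurable]: "g 0 \<theta>1 \<in> borel_measurable M" by (rule g_measurable[OF \<theta>1(1)])
  have lpos: "0 < l x" for x using l_lower(1) l_lower(2)[of x] by simp
  obtain D where D: "countable D" "D \<subseteq> \<Theta>" "\<Theta> \<subseteq> closure D" using separable by blast
  define U where "U z = (z 0)\<^sup>2" for z :: "int \<Rightarrow> real"
  define v where "v z = l (G \<theta>1 z)" for z
  have [measurable]: "U \<in> borel_measurable paths" "v \<in> borel_measurable paths"
    unfolding U_def[abs_def] v_def[abs_def] by measurable
  define A where A_eq: "A = osc_small D \<theta>1"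
  note A_def = A_eq osc_small_def
  have A: "A \<eta> k \<in> sets paths" for \<eta> k
    unfolding A_eq by (rule osc_small_measurable[OF D(1,2) \<theta>1(1)])
  have fac0: "AE \<omega> in M. s2 0 \<omega> = H (shift 0 (noise_path \<omega>)) \<and> g 0 \<theta>1 \<omega> = G \<theta>1 (shift 0 (noise_path \<omega>))"
    using s2_factor[of 0] g_factor[OF \<theta>1(1), of 0] by eventually_elim simp
  have meas: "H \<in> borel_measurable (iid \<nu>)" "v \<in> borel_measurable (iid \<nu>)" "U \<in> borel_measurable (iid \<nu>)"
    by measurable
  have pos: "AE z in iid \<nu>. 0 < H z"
  proof (rule AE_pathI[where t = 0])
    show "AE \<omega> in M. 0 < H (shift 0 (noise_path \<omega>))" using fac0 s2_pos[of 0] by eventually_elim simp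
  qed measurable
  have log: "integrable (iid \<nu>) (\<lambda>z. max 0 (ln (H z)))"
  proof (subst integral_path(2)[where t = 0])
    show "integrable M (\<lambda>\<omega>. max 0 (ln (H (shift 0 (noise_path \<omega>)))))"
      by (rule integrable_cong_AE_imp[OF log_moment]) (use fac0 in \<open>auto elim: eventually_mono\<close>)
  qed measurable
  have differ: "\<not> (AE z in iid \<nu>. v z = H z)"
  proof
    assume "AE z in iid \<nu>. v z = H z"
    from AE_shift_path[OF this, of 0] fac0 have "AE \<omega> in M. l (g 0 \<theta>1 \<omega>) = s2 0 \<omega>"
      by eventually_elim (simp add: v_def)
    with off_truth[OF \<theta>1] show False ..
  qed
  have U: "integrable (iid \<nu>) U" "integral\<^sup>L (iid \<nu>) U = 1"
    using Z_var by (simp_all add: integral_path[of U 0] U_def)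
  have vm: "AE z in iid \<nu>. m \<le> v z" by (simp add: v_def l_lower(2))
  have U_indep: "integrable (iid \<nu>) (\<lambda>z. U z * (min (H z) (real N) / v z))"
    "(\<integral>z. U z * (min (H z) (real N) / v z) \<partial>iid \<nu>) = (\<integral>z. min (H z) (real N) / v z \<partial>iid \<nu>)" for N :: nat
  proof -
    show "integrable (iid \<nu>) (\<lambda>z. U z * (min (H z) (real N) / v z))"
    proof (rule Bochner_Integration.integrable_bound)
      show "integrable (iid \<nu>) (\<lambda>z. (real N / m) * U z)" using U(1) by simp
      show "AE z in iid \<nu>. norm (U z * (min (H z) (real N) / v z)) \<le> norm (real N / m * U z)"
        using pos
      proof eventually_elim
        case (elim z)
        have "\<bar>min (H z) (real N) / v z\<bar> \<le> real N / m"
          using elim l_lower by (auto simp: v_def abs_of_pos[OF lpos] intro!: frac_le)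
        from mult_left_mono[OF this, of "U z"] show ?case
          using l_lower(1) by (simp add: U_def abs_mult mult.commute)
      qed
    qed measurable
    have "(\<integral>\<omega>. U (shift 0 (noise_path \<omega>)) * (min (H (shift 0 (noise_path \<omega>))) (real N) / v (shift 0 (noise_path \<omega>))) \<partial>M)
      = (\<integral>\<omega>. (Z 0 \<omega>)\<^sup>2 * (min (s2 0 \<omega>) (real N) / l (g 0 \<theta>1 \<omega>)) \<partial>M)"
      by (rule integral_cong_AE, measurable) (use fac0 in \<open>eventually_elim, simp add: U_def v_def\<close>)
    moreover have "(\<integral>\<omega>. min (H (shift 0 (noise_path \<omega>))) (real N) / v (shift 0 (noise_path \<omega>)) \<partial>M)
      = (\<integral>\<omega>. min (s2 0 \<omega>) (real N) / l (g 0 \<theta>1 \<omega>) \<partial>M)"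
      by (rule integral_cong_AE, measurable) (use fac0 in \<open>eventually_elim, simp add: U_def v_def\<close>)
    ultimately show "(\<integral>z. U z * (min (H z) (real N) / v z) \<partial>iid \<nu>) = (\<integral>z. min (H z) (real N) / v z \<partial>iid \<nu>)"
      using innovation[OF \<theta>1(1), of N] by (subst (1 2) integral_path(1)[where t = 0]) simp_all
  qed
  have inc: "incseq (A \<eta>)" for \<eta>
  proof (rule incseq_SucI, rule subsetI)
    fix k z assume z: "z \<in> A \<eta> k"
    have "1 / real (Suc (Suc k)) \<le> 1 / real (Suc k)" by (simp add: frac_le)
    with z show "z \<in> A \<eta> (Suc k)" unfolding A_def by (auto intro: less_le_trans)
  qed
  have full: "AE z in iid \<nu>. z \<in> (\<Union>k. A \<eta> k)" if "0 < \<eta>" for \<eta>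
    using asymptotic_equicontinuity[OF D(1,2) \<theta>1(1) that] by (simp add: A_eq)
  define W where "W \<eta> k N z = (if z \<in> A \<eta> k
      then exp (- 2 * C * \<eta>) * (U z * (min (H z) (real N) / v z)) + min (real N) (ln (v z) - ln (H z))
      else ln m - max 0 (ln (H z))) - (3 * C * \<eta> + exp (C * \<eta>) * U z)" for \<eta> k and N :: nat and z
  have "\<exists>\<eta> k N. 0 < \<eta> \<and> integrable (iid \<nu>) (W \<eta> k N) \<and> 0 < integral\<^sup>L (iid \<nu>) (W \<eta> k N)"
    using L.positive_contrast[where A = A and C = C, OF meas(1,2) pos l_lower(1) vm log differ U U_indep _ inc full] A
    unfolding Let_def sets_iid[OF noise_law] W_def[abs_def] by simp
  then obtain \<eta> k N where \<eta>: "0 < \<eta>" and w: "integrable (iid \<nu>) (W \<eta> k N)"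
    and wpos: "0 < integral\<^sup>L (iid \<nu>) (W \<eta> k N)" by blast
  define w where w_eq: "w = W \<eta> k N"
  note w_def = w_eq W_def
  define r where "r = 1 / real (Suc k)"
  have drift: "AE \<omega> in M. filterlim (\<lambda>n. \<Sum>j<n. w (shift (int j) (noise_path \<omega>))) at_top sequentially"
    using AE_shift_path[OF iid_positive_drift[OF noise_law w wpos], of 0] by (simp add: w_eq)
  have true_t: "AE \<omega> in M. l (g (int n) \<theta>0 \<omega>) = s2 (int n) \<omega>" for n
  proof -
    have [measurable]: "G \<theta>0 \<in> borel_measurable paths" by (rule G_measurable[OF \<theta>0_in])
    have "AE z in iid \<nu>. l (G \<theta>0 z) = H z"
    proof (rule AE_pathI[where t = 0])
      show "AE \<omega> in M. l (G \<theta>0 (shift 0 (noise_path \<omega>))) = H (shift 0 (noise_path \<omega>))"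
        using at_truth s2_factor[of 0] g_factor[OF \<theta>0_in, of 0] by eventually_elim simp
    qed measurable
    from AE_shift_path[OF this, of "int n"] show ?thesis
      using s2_factor[of "int n"] g_factor[OF \<theta>0_in, of "int n"] by eventually_elim simp
  qed
  have all: "AE \<omega> in M. \<forall>n. (\<forall>\<theta>\<in>insert \<theta>1 D. g (int n) \<theta> \<omega> = G \<theta> (shift (int n) (noise_path \<omega>)) \<and> g (int n) \<theta> \<omega> \<in> K)
      \<and> s2 (int n) \<omega> = H (shift (int n) (noise_path \<omega>)) \<and> 0 < s2 (int n) \<omega>
      \<and> l (g (int n) \<theta>0 \<omega>) = s2 (int n) \<omega> \<and> g (int n) \<theta>0 \<omega> \<in> K"
    using D \<theta>1(1) g_factor g_in_K s2_factor s2_pos true_t \<theta>0_in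
    by (intro AE_all_countable[THEN iffD2] allI AE_conjI AE_ball_countable[THEN iffD2]) auto
  have "AE \<omega> in M. \<forall>\<^sub>F n in sequentially. \<forall>\<theta>\<in>\<Theta> \<inter> ball \<theta>1 r. 0 < (\<Sum>t = 1..n. loss \<theta> t \<omega> - loss \<theta>0 t \<omega>)"
    using all ghat_cont ghat_conv drift
  proof eventually_elim
    case (elim \<omega>)
    have gK: "ghat t \<theta> \<omega> \<in> K" if "\<theta> \<in> \<Theta>" for t \<theta>
      using elim(2) that by (auto simp: cont_maps_def image_subset_iff)
    have gcont: "continuous_on \<Theta> (\<lambda>\<theta>. ghat t \<theta> \<omega>)" for t using elim(2) by (simp add: cont_maps_def)
    have spos: "0 < s2 (int t) \<omega>" for t using elim(1) by blast
    have "\<forall>\<^sub>F n in sequentially. unif_norm \<Theta> (\<lambda>\<theta>. ghat n \<theta> \<omega> - g (int n) \<theta> \<omega>) < ennreal \<eta>"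
      using order_tendstoD(2)[OF elim(3), of "ennreal \<eta>"] \<eta> by simp
    then obtain T where T: "\<And>n. T \<le> n \<Longrightarrow> unif_norm \<Theta> (\<lambda>\<theta>. ghat n \<theta> \<omega> - g (int n) \<theta> \<omega>) < ennreal \<eta>"
      unfolding eventually_sequentially by blast
    have close: "\<bar>ghat n \<theta> \<omega> - g (int n) \<theta> \<omega>\<bar> \<le> \<eta>" if "T \<le> n" "\<theta> \<in> \<Theta>" for n \<theta>
      using order_le_less_trans[OF SUP_upper[OF that(2)] T[OF that(1), unfolded unif_norm_def]] \<eta>
      by (simp add: ennreal_less_iff)
    show ?case
    proof (rule sum_eventually_pos[OF elim(4)])
      fix t \<theta> assume \<theta>: "\<theta> \<in> \<Theta> \<inter> ball \<theta>1 r"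
      have "0 \<le> s2 (int t) \<omega> * (Z (int t) \<omega>)\<^sup>2 / l (ghat t \<theta> \<omega>)"
        using spos[of t] lpos[of "ghat t \<theta> \<omega>"] by simp
      moreover have "ln m \<le> ln (l (ghat t \<theta> \<omega>))" using l_lower(1) l_lower(2)[of "ghat t \<theta> \<omega>"] by simp
      ultimately show "ln m - loss \<theta>0 t \<omega> \<le> loss \<theta> t \<omega> - loss \<theta>0 t \<omega>"
        unfolding loss_def[of \<theta>] by simp
    next
      fix t \<theta> assume t: "T \<le> t" and \<theta>: "\<theta> \<in> \<Theta> \<inter> ball \<theta>1 r"
      define z where "z = shift (int t) (noise_path \<omega>)"
      have G1z: "G \<theta>1 z = g (int t) \<theta>1 \<omega>" "H z = s2 (int t) \<omega>"
        using elim(1) by (auto simp: z_def)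
      have near: "\<bar>ghat t \<theta> \<omega> - g (int t) \<theta>1 \<omega>\<bar> \<le> 2 * \<eta>" if zA: "z \<in> A \<eta> k"
      proof -
        have D_near: "\<bar>ghat t \<theta>' \<omega> - g (int t) \<theta>1 \<omega>\<bar> \<le> 2 * \<eta>" if "\<theta>' \<in> D" "\<theta>' \<in> ball \<theta>1 r" for \<theta>'
        proof -
          have "g (int t) \<theta>' \<omega> = G \<theta>' z" using elim(1) that(1) by (auto simp: z_def)
          moreover have "\<bar>G \<theta>' z - G \<theta>1 z\<bar> \<le> \<eta>" using zA that by (auto simp: A_def r_def dist_commute)
          moreover have "\<bar>ghat t \<theta>' \<omega> - g (int t) \<theta>' \<omega>\<bar> \<le> \<eta>" using close[OF t] that D(2) by blast
          ultimately show ?thesis using G1z by linarith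
        qed
        from \<theta> D(3) have "\<theta> \<in> closure D" by auto
        then obtain x where x: "\<And>i. x i \<in> D" "x \<longlonglongrightarrow> \<theta>" unfolding closure_sequential by blast
        have "\<forall>\<^sub>F i in sequentially. x i \<in> ball \<theta>1 r"
          using x(2) \<theta> by (intro topological_tendstoD) auto
        then have "\<forall>\<^sub>F i in sequentially. \<bar>ghat t (x i) \<omega> - g (int t) \<theta>1 \<omega>\<bar> \<le> 2 * \<eta>"
          by eventually_elim (use D_near x(1) in blast)
        moreover have "(\<lambda>i. ghat t (x i) \<omega>) \<longlonglongrightarrow> ghat t \<theta> \<omega>"
          using continuous_on_tendsto_compose[OF gcont x(2)] \<theta> x(1) D(2) by (auto simp: subset_iff)
        then have "(\<lambda>i. \<bar>ghat t (x i) \<omega> - g (int t) \<theta>1 \<omega>\<bar>) \<longlonglongrightarrow> \<bar>ghat t \<theta> \<omega> - g (int t) \<theta>1 \<omega>\<bar>"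
          by (intro tendsto_intros)
        ultimately show ?thesis by (intro tendsto_upperbound) auto
      qed
      have z0: "z 0 = Z (int t) \<omega>" by (simp add: z_def shift_def)
      have "g (int t) \<theta>0 \<omega> \<in> K" "g (int t) \<theta>1 \<omega> \<in> K" "l (g (int t) \<theta>0 \<omega>) = s2 (int t) \<omega>"
        using elim(1) by blast+
      then have "(if z \<in> A \<eta> k
          then exp (- 2 * C * \<eta>) * ((Z (int t) \<omega>)\<^sup>2 * (min (s2 (int t) \<omega>) (real N) / l (g (int t) \<theta>1 \<omega>)))
            + min (real N) (ln (l (g (int t) \<theta>1 \<omega>)) - ln (s2 (int t) \<omega>))
          else ln m - max 0 (ln (s2 (int t) \<omega>))) - (3 * C * \<eta> + exp (C * \<eta>) * (Z (int t) \<omega>)\<^sup>2)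
        \<le> (s2 (int t) \<omega> * (Z (int t) \<omega>)\<^sup>2 / l (ghat t \<theta> \<omega>) + ln (l (ghat t \<theta> \<omega>)))
          - (s2 (int t) \<omega> * (Z (int t) \<omega>)\<^sup>2 / l (ghat t \<theta>0 \<omega>) + ln (l (ghat t \<theta>0 \<omega>)))"
        using spos[of t] gK \<theta> \<theta>0_in close[OF t \<theta>0_in] near
        by (intro contrast_step[where K = K and ?g0.0 = "g (int t) \<theta>0 \<omega>", OF l_lip C_nonneg l_lower]) auto
      then have "w z \<le> loss \<theta> t \<omega> - loss \<theta>0 t \<omega>"
        unfolding w_def loss_def v_def G1z U_def z0 .
      then show "w (shift (int t) (noise_path \<omega>)) \<le> loss \<theta> t \<omega> - loss \<theta>0 t \<omega>" by (simp add: z_def)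
    qed
  qed
  then show ?thesis by (intro exI[of _ r]) (simp add: r_def)
qed

lemma loss_separation:
  "AE \<omega> in M. \<forall>\<epsilon>>0. \<forall>\<^sub>F n in sequentially. \<forall>\<theta>\<in>\<Theta>. \<epsilon> \<le> dist \<theta> \<theta>0 \<longrightarrow>
    (\<Sum>t = 1..n. loss \<theta>0 t \<omega>) < (\<Sum>t = 1..n. loss \<theta> t \<omega>)"
proof -
  have "\<exists>r. \<forall>\<theta>1\<in>\<Theta> - {\<theta>0}. 0 < r \<theta>1 \<and> (AE \<omega> in M. \<forall>\<^sub>F n in sequentially. \<forall>\<theta>\<in>\<Theta> \<inter> ball \<theta>1 (r \<theta>1).
    0 < (\<Sum>t = 1..n. loss \<theta> t \<omega> - loss \<theta>0 t \<omega>))"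
    by (intro bchoice ballI) (use local_separation in auto)
  then obtain r where r: "\<And>\<theta>1. \<theta>1 \<in> \<Theta> - {\<theta>0} \<Longrightarrow> 0 < r \<theta>1"
    "\<And>\<theta>1. \<theta>1 \<in> \<Theta> - {\<theta>0} \<Longrightarrow> AE \<omega> in M. \<forall>\<^sub>F n in sequentially. \<forall>\<theta>\<in>\<Theta> \<inter> ball \<theta>1 (r \<theta>1).
      0 < (\<Sum>t = 1..n. loss \<theta> t \<omega> - loss \<theta>0 t \<omega>)"
    by blast
  have one: "AE \<omega> in M. \<forall>\<^sub>F n in sequentially. \<forall>\<theta>\<in>\<Theta>. \<epsilon> \<le> dist \<theta> \<theta>0 \<longrightarrow>
    (\<Sum>t = 1..n. loss \<theta>0 t \<omega>) < (\<Sum>t = 1..n. loss \<theta> t \<omega>)" if \<epsilon>: "0 < \<epsilon>" for \<epsilon>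
  proof -
    have cpt: "compact (\<Theta> - ball \<theta>0 \<epsilon>)" using compact_\<Theta> by (intro compact_diff) auto
    have cover: "\<Theta> - ball \<theta>0 \<epsilon> \<subseteq> (\<Union>\<theta>1\<in>\<Theta> - ball \<theta>0 \<epsilon>. ball \<theta>1 (r \<theta>1))"
    proof
      fix x assume x: "x \<in> \<Theta> - ball \<theta>0 \<epsilon>"
      with \<epsilon> have "0 < r x" by (intro r(1)) auto
      with x show "x \<in> (\<Union>\<theta>1\<in>\<Theta> - ball \<theta>0 \<epsilon>. ball \<theta>1 (r \<theta>1))" by force
    qed
    obtain F where F: "F \<subseteq> \<Theta> - ball \<theta>0 \<epsilon>" "finite F" "\<Theta> - ball \<theta>0 \<epsilon> \<subseteq> (\<Union>\<theta>1\<in>F. ball \<theta>1 (r \<theta>1))"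
      by (rule compactE_image[OF cpt _ cover]) auto
    have "AE \<omega> in M. \<forall>\<theta>1\<in>F. \<forall>\<^sub>F n in sequentially. \<forall>\<theta>\<in>\<Theta> \<inter> ball \<theta>1 (r \<theta>1).
      0 < (\<Sum>t = 1..n. loss \<theta> t \<omega> - loss \<theta>0 t \<omega>)"
      using F(1) \<epsilon> by (intro AE_finite_allI[OF F(2)] r(2)) auto
    then show ?thesis
    proof eventually_elim
      case (elim \<omega>)
      then have "\<forall>\<^sub>F n in sequentially. \<forall>\<theta>1\<in>F. \<forall>\<theta>\<in>\<Theta> \<inter> ball \<theta>1 (r \<theta>1).
        0 < (\<Sum>t = 1..n. loss \<theta> t \<omega> - loss \<theta>0 t \<omega>)"
        by (intro eventually_ball_finite F(2))
      then show ?case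
      proof eventually_elim
        case (elim n)
        show ?case
        proof (intro ballI impI)
          fix \<theta> assume "\<theta> \<in> \<Theta>" "\<epsilon> \<le> dist \<theta> \<theta>0"
          then have "\<theta> \<in> \<Theta> - ball \<theta>0 \<epsilon>" by (auto simp: dist_commute)
          with F(3) obtain \<theta>1 where "\<theta>1 \<in> F" "\<theta> \<in> ball \<theta>1 (r \<theta>1)" by blast
          with elim \<open>\<theta> \<in> \<Theta>\<close> have "0 < (\<Sum>t = 1..n. loss \<theta> t \<omega> - loss \<theta>0 t \<omega>)" by blast
          then show "(\<Sum>t = 1..n. loss \<theta>0 t \<omega>) < (\<Sum>t = 1..n. loss \<theta> t \<omega>)" by (simp add: sum_subtractf)
        qed
      qed
    qed
  qed
  have "AE \<omega> in M. \<forall>j::nat. \<forall>\<^sub>F n in sequentially. \<forall>\<theta>\<in>\<Theta>. 1 / real (Suc j) \<le> dist \<theta> \<theta>0 \<longrightarrow>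
    (\<Sum>t = 1..n. loss \<theta>0 t \<omega>) < (\<Sum>t = 1..n. loss \<theta> t \<omega>)"
    by (intro AE_all_countable[THEN iffD2] allI one) simp
  then show ?thesis
  proof eventually_elim
    case (elim \<omega>)
    show ?case
    proof (intro allI impI)
      fix \<epsilon> :: real assume "0 < \<epsilon>"
      then obtain j where j: "1 / real (Suc j) < \<epsilon>" using nat_approx_posE by blast
      from elim have "\<forall>\<^sub>F n in sequentially. \<forall>\<theta>\<in>\<Theta>. 1 / real (Suc j) \<le> dist \<theta> \<theta>0 \<longrightarrow>
        (\<Sum>t = 1..n. loss \<theta>0 t \<omega>) < (\<Sum>t = 1..n. loss \<theta> t \<omega>)" by blast
      then show "\<forall>\<^sub>F n in sequentially. \<forall>\<theta>\<in>\<Theta>. \<epsilon> \<le> dist \<theta> \<theta>0 \<longrightarrow>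
        (\<Sum>t = 1..n. loss \<theta>0 t \<omega>) < (\<Sum>t = 1..n. loss \<theta> t \<omega>)"
        by eventually_elim (use j in fastforce)
    qed
  qed
qed

end

section \<open>Strong consistency\<close>

theorem theorem1:
  fixes M :: "'a measure"
    and Z X sigma2 :: "int \<Rightarrow> 'a \<Rightarrow> real"
    and h l :: "real \<Rightarrow> real"
    and D E K :: "real set"
    and \<psi> \<phi> :: "real \<Rightarrow> real \<Rightarrow> 'p::euclidean_space \<Rightarrow> real"
    and \<Theta> :: "'p set" and \<theta>0 :: 'p
    and g :: "int \<Rightarrow> 'p \<Rightarrow> 'a \<Rightarrow> real"
    and g0 :: "'p \<Rightarrow> real"
    and theta_hat :: "nat \<Rightarrow> 'a \<Rightarrow> 'p"
  assumes prob: "prob_space M"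
    and Z_indep: "prob_space.indep_vars M (\<lambda>_. borel) Z UNIV"
    and Z_ident: "\<And>t. distr M borel (Z t) = distr M borel (Z 0)"
    and Z_mean: "integrable M (Z 0)" "(LINT \<omega>|M. Z 0 \<omega>) = 0"
    and Z_var: "integrable M (\<lambda>\<omega>. (Z 0 \<omega>)\<^sup>2)" "(LINT \<omega>|M. (Z 0 \<omega>)\<^sup>2) = 1"
    and h_bij: "bij_betw h D E" and D_pos: "D \<subseteq> {0<..}"
    and l_def: "l = inv_into D h"
    and D_E_borel: "D \<in> sets borel" "E \<in> sets borel"
    and h_l_borel: "h \<in> borel_measurable (restrict_space borel D)"
                   "l \<in> borel_measurable (restrict_space borel E)"
    and psi_borel: "\<And>\<theta>. \<theta> \<in> \<Theta> \<Longrightarrow>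
        (\<lambda>(x, z). \<psi> x z \<theta>) \<in> borel_measurable (restrict_space borel E \<Otimes>\<^sub>M borel)"
    and Theta: "compact \<Theta>" "\<theta>0 \<in> \<Theta>"
    and X_def: "X = (\<lambda>t \<omega>. sqrt (sigma2 t \<omega>) * Z t \<omega>)"
    and phi_def: "\<phi> = inverted_map \<psi> l"
    and K: "K \<subseteq> E" "K \<in> sets borel"
    and phi_K: "AE \<omega> in M. \<forall>t. \<forall>x\<in>K. \<forall>\<theta>\<in>\<Theta>. \<phi> x (X t \<omega>) \<theta> \<in> K"
    and approx_cont: "\<And>f. f \<in> cont_maps \<Theta> K \<Longrightarrow>
        AE \<omega> in M. \<forall>t. approx_vol \<phi> (\<lambda>s. X s \<omega>) f t \<in> cont_maps \<Theta> K"
    and g_solution: "\<And>\<theta>. \<theta> \<in> \<Theta> \<Longrightarrow>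
        unique_stationary_solution M X (\<lambda>y. y) (\<lambda>x y. \<phi> x y \<theta>) K (\<lambda>t. g t \<theta>)"
    and sigma2_solution: "unique_stationary_solution M Z h (\<lambda>x z. \<psi> x z \<theta>0) D sigma2"
    and non_anticipative: "\<And>t. indep_rvs M borel (sigma2 t)
        (\<Pi>\<^sub>M s\<in>{t..}. borel) (\<lambda>\<omega>. \<lambda>s\<in>{t..}. Z s \<omega>)"
    and log_moment: "integrable M (\<lambda>\<omega>. max 0 (ln (sigma2 0 \<omega>)))"
    and lip: "\<exists>C. C-lipschitz_on K (\<lambda>x. 1 / l x)" "\<exists>C. C-lipschitz_on K (\<lambda>x. ln (l x))"
    and lower: "\<exists>m>0. \<forall>x\<in>K. m \<le> l x"
    and identifiable: "\<And>\<theta>. \<theta> \<in> \<Theta> \<Longrightarrow> (AE \<omega> in M. l (g 0 \<theta> \<omega>) = sigma2 0 \<omega>) \<longleftrightarrow> \<theta> = \<theta>0"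
    and invertible: "continuously_invertible M \<Theta> K \<phi> X g"
    and g0: "g0 \<in> cont_maps \<Theta> K"
    and theta_hat: "\<And>n. n \<ge> 1 \<Longrightarrow> AE \<omega> in M.
        is_arg_min (quasi_lik l (\<lambda>s. X s \<omega>) (approx_vol \<phi> (\<lambda>s. X s \<omega>) g0) n)
          (\<lambda>\<theta>. \<theta> \<in> \<Theta>) (theta_hat n \<omega>)"
  shows "AE \<omega> in M. (\<lambda>n. theta_hat n \<omega>) \<longlonglongrightarrow> \<theta>0"
proof -
  interpret prob_space M by (rule prob)
  have Zm [measurable]: "Z t \<in> borel_measurable M" for t using Z_indep by (simp add: indep_vars_def)
  obtain C1 where C1: "C1-lipschitz_on K (\<lambda>x. 1 / l x)" using lip(1) by blast
  obtain C2 where C2: "C2-lipschitz_on K (\<lambda>x. ln (l x))" using lip(2) by blast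
  obtain m where m: "0 < m" "\<And>x. x \<in> K \<Longrightarrow> m \<le> l x" using lower by blast
  \<comment> \<open>Off \<open>K\<close> the link may be unmeasurable or small; the value \<open>m\<close> keeps the lower bound.\<close>
  define l' where "l' x = (if x \<in> K then l x else m)" for x
  have l'K: "l' x = l x" if "x \<in> K" for x using that by (simp add: l'_def)
  have l'm: "m \<le> l' x" for x using m by (simp add: l'_def)
  have lK: "l \<in> borel_measurable (restrict_space borel K)"
    using measurable_restrict_mono[OF h_l_borel(2) K(1)] .
  have l' [measurable]: "l' \<in> borel_measurable borel"
    unfolding l'_def[abs_def] by (rule borel_measurable_extend[OF K(2) lK])
  have hDE: "h x \<in> E" "l (h x) = x" if "x \<in> D" for x
    using h_bij that unfolding l_def by (auto simp: bij_betw_def inv_into_f_f)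

  have sol_s: "stationary_solution M Z h (\<lambda>x z. \<psi> x z \<theta>0) D sigma2"
    using sigma2_solution by (simp add: unique_stationary_solution_def)
  have sm [measurable]: "sigma2 t \<in> borel_measurable M" and sD: "AE \<omega> in M. sigma2 t \<omega> \<in> D"
    and s_eq: "AE \<omega> in M. h (sigma2 (t + 1) \<omega>) = \<psi> (h (sigma2 t \<omega>)) (Z t \<omega>) \<theta>0" for t
    using sol_s by (auto simp: stationary_solution_def)
  have s_pos: "AE \<omega> in M. 0 < sigma2 t \<omega>" for t
    using sD[of t] by eventually_elim (use D_pos in auto)
  have sol_g: "stationary_solution M X (\<lambda>y. y) (\<lambda>x y. \<phi> x y \<theta>) K (\<lambda>t. g t \<theta>)" if "\<theta> \<in> \<Theta>" for \<theta>
    using g_solution[OF that] by (simp add: unique_stationary_solution_def)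
  have gm: "g t \<theta> \<in> borel_measurable M" and gK: "AE \<omega> in M. g t \<theta> \<omega> \<in> K" if "\<theta> \<in> \<Theta>" for t \<theta>
    using sol_g[OF that] by (auto simp: stationary_solution_def)
  have Xm [measurable]: "X t \<in> borel_measurable M" for t unfolding X_def by measurable

  have Z_stat: "strictly_stationary M Z"
    unfolding strictly_stationary_iff[OF Zm] path_law_iid[OF Z_indep Z_ident]
  proof
    fix k
    have \<nu>: "prob_space (distr M borel (Z 0))" "sets (distr M borel (Z 0)) = sets borel"
      by (auto intro: prob_space_distr)
    have "distr (iid (distr M borel (Z 0))) paths (shift k)
        = distr (iid (distr M borel (Z 0))) (iid (distr M borel (Z 0))) (shift k)"
      by (intro distr_cong refl sets_iid[OF \<nu>, symmetric])
    then show "distr (iid (distr M borel (Z 0))) paths (shift k) = iid (distr M borel (Z 0))"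
      by (simp only: distr_shift_iid[OF \<nu>])
  qed
  have graph_s: "recursion_graph h (\<lambda>x z. \<psi> x z \<theta>0) D \<in> sets borel"
  proof (rule recursion_graph_measurable[OF D_E_borel(1) h_l_borel(1)])
    have "h \<in> restrict_space borel D \<rightarrow>\<^sub>M restrict_space borel E"
      by (rule measurable_restrict_space2[OF _ h_l_borel(1)]) (use hDE in \<open>auto simp: space_restrict_space\<close>)
    then have "(\<lambda>p. (h (fst p), snd p)) \<in> restrict_space borel D \<Otimes>\<^sub>M borel \<rightarrow>\<^sub>M restrict_space borel E \<Otimes>\<^sub>M (borel :: real measure)"
      by (intro measurable_Pair measurable_compose[OF measurable_fst] measurable_snd)
    from measurable_compose[OF this psi_borel[OF Theta(2)]]
    show "(\<lambda>(x, z). \<psi> (h x) z \<theta>0) \<in> borel_measurable (restrict_space borel D \<Otimes>\<^sub>M borel)"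
      by (simp add: split_beta')
  qed
  have graph_g: "recursion_graph (\<lambda>y. y) (\<lambda>x y. \<phi> x y \<theta>) K \<in> sets borel" if \<theta>: "\<theta> \<in> \<Theta>" for \<theta>
  proof (rule recursion_graph_measurable[OF K(2)])
    show "(\<lambda>y. y) \<in> borel_measurable (restrict_space borel K)" by (intro measurable_restrict_space1) simp
    have id: "(\<lambda>y. y) \<in> restrict_space borel K \<rightarrow>\<^sub>M restrict_space borel E"
      by (intro measurable_restrict_space3) (use K(1) in auto)
    have [measurable]: "(\<lambda>p. l (fst p)) \<in> borel_measurable (restrict_space borel K \<Otimes>\<^sub>M (borel :: real measure))"
      by (rule measurable_compose[OF measurable_fst lK])
    have "(\<lambda>p. (fst p, snd p / sqrt (l (fst p)))) \<in> restrict_space borel K \<Otimes>\<^sub>M borel \<rightarrow>\<^sub>M restrict_space borel E \<Otimes>\<^sub>M (borel :: real measure)"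
    proof (rule measurable_Pair)
      show "fst \<in> restrict_space borel K \<Otimes>\<^sub>M borel \<rightarrow>\<^sub>M restrict_space borel E"
        by (rule measurable_compose[OF measurable_fst id])
    qed measurable
    from measurable_compose[OF this psi_borel[OF \<theta>]]
    show "(\<lambda>(x, z). \<phi> x z \<theta>) \<in> borel_measurable (restrict_space borel K \<Otimes>\<^sub>M borel)"
      by (simp add: split_beta' phi_def inverted_map_def)
  qed

  obtain H where H [measurable]: "H \<in> borel_measurable paths"
    and sH: "\<And>t. AE \<omega> in M. sigma2 t \<omega> = H (shift t (\<lambda>s. Z s \<omega>))"
    using solution_stationary_functional[OF graph_s prob Zm Z_stat sigma2_solution] by blast
  \<comment> \<open>The observations are functionals of the noise path, hence stationary; they drive \<open>g \<theta>\<close>.\<close>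
  define XX where "XX z = sqrt (H z) * z 0" for z
  have XX [measurable]: "XX \<in> borel_measurable paths" unfolding XX_def[abs_def] by measurable
  have X_fac: "AE \<omega> in M. X t \<omega> = XX (shift t (\<lambda>s. Z s \<omega>))" for t
    using sH[of t] by eventually_elim (simp add: X_def XX_def shift_def)
  have X_stat: "strictly_stationary M X"
    by (rule strictly_stationary_factor[OF Zm Xm XX Z_stat X_fac])
  have "\<forall>\<theta>\<in>\<Theta>. \<exists>F. F \<in> borel_measurable paths \<and> (\<forall>t. AE \<omega> in M. g t \<theta> \<omega> = F (shift t (\<lambda>s. X s \<omega>)))"
    using solution_stationary_functional[OF graph_g prob Xm X_stat g_solution] by blast
  from bchoice[OF this] obtain F where F: "\<And>\<theta>. \<theta> \<in> \<Theta> \<Longrightarrow> F \<theta> \<in> borel_measurable paths"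
    "\<And>\<theta> t. \<theta> \<in> \<Theta> \<Longrightarrow> AE \<omega> in M. g t \<theta> \<omega> = F \<theta> (shift t (\<lambda>s. X s \<omega>))" by blast
  define G where "G \<theta> z = F \<theta> (\<lambda>t. XX (shift t z))" for \<theta> z
  have XXp: "(\<lambda>z t. XX (shift t z)) \<in> paths \<rightarrow>\<^sub>M paths" by (rule path_measurable) measurable
  have Gm: "G \<theta> \<in> borel_measurable paths" if "\<theta> \<in> \<Theta>" for \<theta>
    unfolding G_def[abs_def] by (rule measurable_compose[OF XXp F(1)[OF that]])
  have gG: "AE \<omega> in M. g t \<theta> \<omega> = G \<theta> (shift t (\<lambda>s. Z s \<omega>))" if "\<theta> \<in> \<Theta>" for \<theta> t
  proof -
    have "AE \<omega> in M. \<forall>s. X s \<omega> = XX (shift s (\<lambda>s. Z s \<omega>))"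
      by (intro AE_all_countable[THEN iffD2] allI X_fac)
    with F(2)[OF that, of t] show ?thesis
    proof eventually_elim
      case (elim \<omega>)
      have "shift t (\<lambda>s. X s \<omega>) = (\<lambda>s. XX (shift s (shift t (\<lambda>s. Z s \<omega>))))"
        using elim(2) by (simp add: fun_eq_iff) (simp add: shift_def)
      with elim(1) show ?case by (simp add: G_def)
    qed
  qed
  interpret stationary_factor_model M Z sigma2 g H G K \<Theta>
    by (unfold_locales) (use Z_indep Z_ident Z_var H Gm sm gm sH gG s_pos gK in auto)

  define ghat where "ghat t \<theta> \<omega> = approx_vol \<phi> (\<lambda>s. X s \<omega>) g0 t \<theta>" for t \<theta> \<omega>
  have ghat_cont: "AE \<omega> in M. \<forall>t. (\<lambda>\<theta>. ghat t \<theta> \<omega>) \<in> cont_maps \<Theta> K"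
    using approx_cont[OF g0] by (simp add: ghat_def)
  have ghat_conv: "AE \<omega> in M. (\<lambda>t. unif_norm \<Theta> (\<lambda>\<theta>. ghat t \<theta> \<omega> - g (int t) \<theta> \<omega>)) \<longlonglongrightarrow> 0"
    using invertible g0 by (simp add: continuously_invertible_def ghat_def)
  have innov: "(\<integral>\<omega>. (Z 0 \<omega>)\<^sup>2 * (min (sigma2 0 \<omega>) (real N) / l' (g 0 \<theta> \<omega>)) \<partial>M)
    = (\<integral>\<omega>. min (sigma2 0 \<omega>) (real N) / l' (g 0 \<theta> \<omega>) \<partial>M)" if \<theta>: "\<theta> \<in> \<Theta>" for \<theta> and N :: nat
  proof -
    define \<psi>' where "\<psi>' \<theta> p = (if fst p \<in> E then \<psi> (fst p) (snd p) \<theta> else 0)" for \<theta> p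
    define h' where "h' x = (if x \<in> D then h x else 0)" for x
    define lE where "lE x = (if x \<in> E then l x else 0)" for x
    have \<psi>': "\<psi>' \<theta> \<in> borel_measurable (borel \<Otimes>\<^sub>M borel)" if "\<theta> \<in> \<Theta>" for \<theta>
    proof -
      have "\<psi>' \<theta> = (\<lambda>p. if fst p \<in> E then (\<lambda>(x, z). \<psi> x z \<theta>) p else 0)"
        by (simp add: fun_eq_iff \<psi>'_def split_beta)
      then show ?thesis using borel_measurable_extend_fst[OF D_E_borel(2) psi_borel[OF that], of 0] by (simp only:)
    qed
    note [measurable] = \<psi>'[OF \<theta>] \<psi>'[OF Theta(2)]
    have [measurable]: "h' \<in> borel_measurable borel" "lE \<in> borel_measurable borel"
      unfolding h'_def[abs_def] lE_def[abs_def]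
      by (rule borel_measurable_extend[OF D_E_borel(1) h_l_borel(1)], rule borel_measurable_extend[OF D_E_borel(2) h_l_borel(2)])
    \<comment> \<open>One step of the pair (approximation at \<open>\<theta>\<close>, volatility), driven by the innovation alone.\<close>
    define \<Phi> where "\<Phi> v z = (\<psi>' \<theta> (fst v, sqrt (snd v) * z / sqrt (l' (fst v))), lE (\<psi>' \<theta>0 (h' (snd v), z)))" for v z
    have \<Phi>: "(\<lambda>(v, z). \<Phi> v z) \<in> (borel \<Otimes>\<^sub>M borel) \<Otimes>\<^sub>M borel \<rightarrow>\<^sub>M borel \<Otimes>\<^sub>M borel"
      unfolding \<Phi>_def split_beta' by measurable
    have gh_K: "AE \<omega> in M. ghat n \<theta> \<omega> \<in> K" for n
      using ghat_cont by eventually_elim (use \<theta> in \<open>auto simp: cont_maps_def image_subset_iff\<close>)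
    have state: "AE \<omega> in M. driven_state \<Phi> (g0 \<theta>, sigma2 0 \<omega>) (\<lambda>s. Z s \<omega>) n = (ghat n \<theta> \<omega>, sigma2 (int n) \<omega>)" for n
    proof (induction n)
      case 0
      show ?case by (simp add: ghat_def)
    next
      case (Suc n)
      from Suc gh_K[of n] sD[of "int n"] sD[of "int n + 1"] s_eq[of "int n"] show ?case
      proof eventually_elim
        case (elim \<omega>)
        have "ghat (Suc n) \<theta> \<omega> = \<psi> (ghat n \<theta> \<omega>) (sqrt (sigma2 (int n) \<omega>) * Z (int n) \<omega> / sqrt (l (ghat n \<theta> \<omega>))) \<theta>"
          by (simp add: ghat_def phi_def inverted_map_def X_def)
        moreover have "sigma2 (int n + 1) \<omega> = l (\<psi> (h (sigma2 (int n) \<omega>)) (Z (int n) \<omega>) \<theta>0)"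
          "\<psi> (h (sigma2 (int n) \<omega>)) (Z (int n) \<omega>) \<theta>0 \<in> E"
          using hDE[OF elim(4)] elim(5) by simp_all
        ultimately show ?case
          using elim K(1) hDE(1)[OF elim(3)]
          by (auto simp: \<Phi>_def \<psi>'_def h'_def lE_def l'K add.commute)
      qed
    qed
    have conv: "AE \<omega> in M. (\<lambda>n. g (int n) \<theta> \<omega> - ghat n \<theta> \<omega>) \<longlonglongrightarrow> 0"
      using ghat_conv
    proof eventually_elim
      case (elim \<omega>)
      show ?case
      proof (rule LIMSEQ_I)
        fix r :: real assume r: "0 < r"
        have "\<forall>\<^sub>F n in sequentially. unif_norm \<Theta> (\<lambda>\<theta>. ghat n \<theta> \<omega> - g (int n) \<theta> \<omega>) < ennreal r"
          using order_tendstoD(2)[OF elim, of "ennreal r"] r by simp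
        then have "\<forall>\<^sub>F n in sequentially. norm (g (int n) \<theta> \<omega> - ghat n \<theta> \<omega> - 0) < r"
        proof eventually_elim
          case (elim n)
          from order_le_less_trans[OF SUP_upper[OF \<theta>] this[unfolded unif_norm_def]] r
          show ?case by (simp add: ennreal_less_iff abs_minus_commute)
        qed
        then show "\<exists>no. \<forall>n\<ge>no. norm (g (int n) \<theta> \<omega> - ghat n \<theta> \<omega> - 0) < r"
          by (simp add: eventually_sequentially)
      qed
    qed
    show ?thesis
    proof (rule innovation_identity[OF \<theta> non_anticipative \<Phi> state l' m(1) l'm _ gh_K conv])
      show "\<bar>1 / l' x - 1 / l' y\<bar> \<le> C1 * \<bar>x - y\<bar>" if "x \<in> K" "y \<in> K" for x y
        using lipschitz_onD[OF C1 that] by (simp add: dist_real_def l'K that)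
    qed
  qed
  have l'_g: "(AE \<omega> in M. l' (g 0 \<theta> \<omega>) = sigma2 0 \<omega>) \<longleftrightarrow> (AE \<omega> in M. l (g 0 \<theta> \<omega>) = sigma2 0 \<omega>)" if "\<theta> \<in> \<Theta>" for \<theta>
  proof -
    have e: "AE \<omega> in M. l' (g 0 \<theta> \<omega>) = l (g 0 \<theta> \<omega>)"
      using gK[OF that, of 0] by eventually_elim (simp add: l'K)
    show ?thesis
    proof
      assume "AE \<omega> in M. l' (g 0 \<theta> \<omega>) = sigma2 0 \<omega>"
      with e show "AE \<omega> in M. l (g 0 \<theta> \<omega>) = sigma2 0 \<omega>" by eventually_elim simp
    next
      assume "AE \<omega> in M. l (g 0 \<theta> \<omega>) = sigma2 0 \<omega>"
      with e show "AE \<omega> in M. l' (g 0 \<theta> \<omega>) = sigma2 0 \<omega>" by eventually_elim simp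
    qed
  qed
  interpret qml_factor_model M Z sigma2 g H G K \<Theta> ghat l' \<theta>0 m C2
  proof
    show "\<bar>ln (l' x) - ln (l' y)\<bar> \<le> C2 * \<bar>x - y\<bar>" if "x \<in> K" "y \<in> K" for x y
      using lipschitz_onD[OF C2 that] by (simp add: dist_real_def l'K that)
    show "0 \<le> C2" by (rule lipschitz_on_nonneg[OF C2])
    show "AE \<omega> in M. l' (g 0 \<theta>0 \<omega>) = sigma2 0 \<omega>"
      using l'_g[OF Theta(2)] identifiable[OF Theta(2)] by simp
    show "\<not> (AE \<omega> in M. l' (g 0 \<theta> \<omega>) = sigma2 0 \<omega>)" if "\<theta> \<in> \<Theta>" "\<theta> \<noteq> \<theta>0" for \<theta>
      using l'_g[OF that(1)] identifiable[OF that(1)] that(2) by simp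
  qed (use l' m(1) l'm log_moment Theta ghat_cont ghat_conv innov in auto)
  have arg: "AE \<omega> in M. \<forall>n\<ge>1. is_arg_min (quasi_lik l (\<lambda>s. X s \<omega>) (approx_vol \<phi> (\<lambda>s. X s \<omega>) g0) n)
      (\<lambda>\<theta>. \<theta> \<in> \<Theta>) (theta_hat n \<omega>)"
  proof (rule AE_all_countable[THEN iffD2], rule allI)
    fix n show "AE \<omega> in M. 1 \<le> n \<longrightarrow> is_arg_min (quasi_lik l (\<lambda>s. X s \<omega>) (approx_vol \<phi> (\<lambda>s. X s \<omega>) g0) n)
      (\<lambda>\<theta>. \<theta> \<in> \<Theta>) (theta_hat n \<omega>)"
      using theta_hat[of n] by (cases "1 \<le> n") auto
  qed
  have pos_all: "AE \<omega> in M. \<forall>t. 0 < sigma2 t \<omega>" by (intro AE_all_countable[THEN iffD2] allI s_pos)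
  show ?thesis
    using arg pos_all ghat_cont loss_separation
  proof eventually_elim
    case (elim \<omega>)
    have lik: "quasi_lik l (\<lambda>s. X s \<omega>) (approx_vol \<phi> (\<lambda>s. X s \<omega>) g0) n \<theta> = (\<Sum>t = 1..n. loss \<theta> t \<omega>) / (2 * real n)"
      if "\<theta> \<in> \<Theta>" for n \<theta>
    proof -
      have "(X (int t) \<omega>)\<^sup>2 / l (approx_vol \<phi> (\<lambda>s. X s \<omega>) g0 t \<theta>) + ln (l (approx_vol \<phi> (\<lambda>s. X s \<omega>) g0 t \<theta>)) = loss \<theta> t \<omega>" for t
      proof -
        have "(X (int t) \<omega>)\<^sup>2 = sigma2 (int t) \<omega> * (Z (int t) \<omega>)\<^sup>2"
          using elim(2) by (simp add: X_def power_mult_distrib less_imp_le)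
        moreover have "ghat t \<theta> \<omega> \<in> K" using elim(3) that by (auto simp: cont_maps_def image_subset_iff)
        ultimately show ?thesis by (simp add: loss_def l'K ghat_def)
      qed
      then show ?thesis by (simp add: quasi_lik_def)
    qed
    show ?case
    proof (rule metric_LIMSEQ_I)
      fix r :: real assume "0 < r"
      with elim(4) have "\<forall>\<^sub>F n in sequentially. \<forall>\<theta>\<in>\<Theta>. r \<le> dist \<theta> \<theta>0 \<longrightarrow>
        (\<Sum>t = 1..n. loss \<theta>0 t \<omega>) < (\<Sum>t = 1..n. loss \<theta> t \<omega>)" by blast
      then have "\<forall>\<^sub>F n in sequentially. dist (theta_hat n \<omega>) \<theta>0 < r"
        using eventually_ge_at_top[of 1]
      proof eventually_elim
        case (elim n)
        with \<open>\<forall>n\<ge>1. is_arg_min _ _ _\<close>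
        have hat: "theta_hat n \<omega> \<in> \<Theta>" "\<not> (\<Sum>t = 1..n. loss \<theta>0 t \<omega>) / (2 * real n) < (\<Sum>t = 1..n. loss (theta_hat n \<omega>) t \<omega>) / (2 * real n)"
          using lik Theta(2) by (auto simp: is_arg_min_def)
        then have "\<not> (\<Sum>t = 1..n. loss \<theta>0 t \<omega>) < (\<Sum>t = 1..n. loss (theta_hat n \<omega>) t \<omega>)"
          using divide_strict_right_mono[of "\<Sum>t = 1..n. loss \<theta>0 t \<omega>" _ "2 * real n"] elim(2) by auto
        with elim(1) hat(1) show ?case by force
      qed
      then show "\<exists>no. \<forall>n\<ge>no. dist (theta_hat n \<omega>) \<theta>0 < r" by (simp add: eventually_sequentially)
    qed
  qed
qed

end
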